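(* Suppose that the $\mathbb Z$-valued random variable $\kappa$ satisfies $\mathbb E[e^{\lambda|\kappa|}]<\infty$ for some $\lambda>0$. Let $(\tilde X_n,\tilde Y_n)_{n\in\mathbb Z_+}$ be the noisy simple harmonic urn with noise $\kappa$, let $\tau=\min\{n\in\mathbb Z_+:|\tilde X_n|+|\tilde Y_n|=1\}$, for $n\in\mathbb N$ let $T_n$ be the area of the triangle with vertices $(0,0)$, $(\tilde X_{n-1},\tilde Y_{n-1})$ and $(\tilde X_n,\tilde Y_n)$, and let $A=\sum_{n=1}^{\tau}T_n$. (i) Suppose that $\mathbb E[\kappa]<1/3$. Then $\mathbb P(A=\infty)>0$. (ii) Suppose that $\mathbb E[\kappa]\ge1/3$. Then $\mathbb E[A^p]<\infty$ for $p<\frac{3\mathbb E[\kappa]-1}{3}$.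
   Context: $\mathbb Z_+=\{0,1,2,\dots\}$, $\mathbb N=\{1,2,\dots\}$, $\min\varnothing=\infty$, and $\operatorname{sgn}(x)=-1,0,1$ according as $x<0$, $x=0$, $x>0$. Let $\kappa,\kappa_1,\kappa_2,\dots$ be i.i.d. $\mathbb Z$-valued random variables. The noisy simple harmonic urn is the Markov chain $(\tilde X_n,\tilde Y_n)_{n\in\mathbb Z_+}$ on $\mathbb Z^2\setminus\{(0,0)\}$ with $(\tilde X_0,\tilde Y_0)=(z_0,1)$, $z_0\in\mathbb N$, and the following transition law, where $\kappa_n$ is independent of all other randomness up to time $n$. Given $(\tilde X_n,\tilde Y_n)=(x,y)$ with $xy\neq0$, $$(\tilde X_{n+1},\tilde Y_{n+1})=\begin{cases}(x,y+\operatorname{sgn}(x)) & \text{with probability } \frac{|x|}{|x|+|y|},\\ (x-\operatorname{sgn}(y),y) & \text{with probability } \frac{|y|}{|x|+|y|};\end{cases}$$ if $x=0$, then $(\tilde X_{n+1},\tilde Y_{n+1})=(-\operatorname{sgn}(y),\ \operatorname{sgn}(y)\max(1,|y|-\kappa_n))$; if $y=0$, then $(\tilde X_{n+1},\tilde Y_{n+1})=(\operatorname{sgn}(x)\max(1,|x|-\kappa_n),\ \operatorname{sgn}(x))$. *)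

theory Defs
  imports "HOL-Probability.Probability"
begin

text \<open>
  The i.i.d. family \<open>\<kappa>, \<kappa>\<^sub>1, \<kappa>\<^sub>2, \<dots>\<close> is \<open>kappa 0, kappa 1, kappa 2, \<dots>\<close>: the variable \<open>kappa 0\<close> is
  the generic copy \<open>\<kappa>\<close>. It is not used by the dynamics, since the chain starts at
  \<open>(z0, 1)\<close>, off the axes. The transition law is conditional on the whole trajectory up to
  time \<open>n\<close> (Markov property), for every trajectory \<open>(h 0, \<dots>, h n)\<close> of positive probability.
\<close>

locale noisy_simple_harmonic_urn = prob_space M
  for M :: "'a measure" +
  fixes kappa :: "nat \<Rightarrow> 'a \<Rightarrow> int"
    and X Y :: "nat \<Rightarrow> 'a \<Rightarrow> int"
    and z0 :: nat
  assumes X_measurable: "\<And>n. X n \<in> measurable M (count_space UNIV)"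
    and Y_measurable: "\<And>n. Y n \<in> measurable M (count_space UNIV)"
    and kappa_indep: "indep_vars (\<lambda>_. count_space UNIV) kappa UNIV"
    and kappa_ident_distr:
      "\<And>n. distr M (count_space UNIV) (kappa n) = distr M (count_space UNIV) (kappa 0)"
    and kappa_indep_past:
      "\<And>n. indep_set
         (sets (vimage_algebra (space M) (kappa n) (count_space UNIV)))
         (sets (vimage_algebra (space M)
            (\<lambda>\<omega>. (map (\<lambda>k. (X k \<omega>, Y k \<omega>)) [0..<Suc n], map (\<lambda>k. kappa k \<omega>) [1..<n]))
            (count_space UNIV)))"
    and z0_pos: "z0 \<ge> 1"
    and start: "AE \<omega> in M. (X 0 \<omega>, Y 0 \<omega>) = (int z0, 1)"
    and state_space: "\<And>n. AE \<omega> in M. (X n \<omega>, Y n \<omega>) \<noteq> (0, 0)"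
    and step_vertical:
      "\<And>n h x y. h n = (x, y) \<Longrightarrow> x * y \<noteq> 0 \<Longrightarrow>
         \<P>(\<omega> in M. \<forall>k\<le>n. (X k \<omega>, Y k \<omega>) = h k) > 0 \<Longrightarrow>
         \<P>(\<omega> in M. (X (Suc n) \<omega>, Y (Suc n) \<omega>) = (x, y + sgn x)
              \<bar> \<forall>k\<le>n. (X k \<omega>, Y k \<omega>) = h k)
           = real_of_int \<bar>x\<bar> / real_of_int (\<bar>x\<bar> + \<bar>y\<bar>)"
    and step_horizontal:
      "\<And>n h x y. h n = (x, y) \<Longrightarrow> x * y \<noteq> 0 \<Longrightarrow>
         \<P>(\<omega> in M. \<forall>k\<le>n. (X k \<omega>, Y k \<omega>) = h k) > 0 \<Longrightarrow>
         \<P>(\<omega> in M. (X (Suc n) \<omega>, Y (Suc n) \<omega>) = (x - sgn y, y)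
              \<bar> \<forall>k\<le>n. (X k \<omega>, Y k \<omega>) = h k)
           = real_of_int \<bar>y\<bar> / real_of_int (\<bar>x\<bar> + \<bar>y\<bar>)"
    and step_from_y_axis:
      "\<And>n. AE \<omega> in M. X n \<omega> = 0 \<longrightarrow>
         (X (Suc n) \<omega>, Y (Suc n) \<omega>)
           = (- sgn (Y n \<omega>), sgn (Y n \<omega>) * max 1 (\<bar>Y n \<omega>\<bar> - kappa n \<omega>))"
    and step_from_x_axis:
      "\<And>n. AE \<omega> in M. Y n \<omega> = 0 \<longrightarrow>
         (X (Suc n) \<omega>, Y (Suc n) \<omega>)
           = (sgn (X n \<omega>) * max 1 (\<bar>X n \<omega>\<bar> - kappa n \<omega>), sgn (X n \<omega>))"

definition urn_tau :: "(nat \<Rightarrow> 'a \<Rightarrow> int) \<Rightarrow> (nat \<Rightarrow> 'a \<Rightarrow> int) \<Rightarrow> 'a \<Rightarrow> enat" where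
  "urn_tau X Y \<omega> = Inf {enat n | n. \<bar>X n \<omega>\<bar> + \<bar>Y n \<omega>\<bar> = 1}"

definition int_point :: "int \<Rightarrow> int \<Rightarrow> real ^ 2" where
  "int_point x y = vector [real_of_int x, real_of_int y]"

definition urn_triangle_area ::
    "(nat \<Rightarrow> 'a \<Rightarrow> int) \<Rightarrow> (nat \<Rightarrow> 'a \<Rightarrow> int) \<Rightarrow> nat \<Rightarrow> 'a \<Rightarrow> real" where
  "urn_triangle_area X Y n \<omega> =
     measure lborel
       (convex hull {0, int_point (X (n - 1) \<omega>) (Y (n - 1) \<omega>), int_point (X n \<omega>) (Y n \<omega>)})"

definition urn_area :: "(nat \<Rightarrow> 'a \<Rightarrow> int) \<Rightarrow> (nat \<Rightarrow> 'a \<Rightarrow> int) \<Rightarrow> 'a \<Rightarrow> ennreal" where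
  "urn_area X Y \<omega> =
     (\<Sum>n. if 1 \<le> n \<and> enat n \<le> urn_tau X Y \<omega> then ennreal (urn_triangle_area X Y n \<omega>) else 0)"

text \<open>Real powers on \<open>[0, \<infinity>]\<close>, with \<open>x\<^sup>0 = 1\<close> for all \<open>x\<close>.\<close>

definition ennreal_powr :: "ennreal \<Rightarrow> real \<Rightarrow> ennreal" where
  "ennreal_powr x p =
     (if p = 0 then 1
      else if x = \<infinity> then (if p > 0 then \<infinity> else 0)
      else if x = 0 \<and> p < 0 then \<infinity>
      else ennreal (enn2real x powr p))"

end

theory Submission
  imports Defs
begin

text \<open>
  Rotate the chain into the quadrant \<open>u \<ge> 0, v \<ge> 1\<close>, where inside the quadrant \<open>(u, v)\<close> moves to
  \<open>(u, v + 1)\<close> or \<open>(u - 1, v)\<close> with weights \<open>u\<close> and \<open>v\<close>, and \<open>(0, z)\<close> jumps to \<open>(max 1 (z - \<kappa>), 1)\<close>.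
  For \<open>r\<^sup>2 = u\<^sup>2 + v\<^sup>2\<close> an explicit perturbation of \<open>r powr \<alpha>\<close> has, outside a ball, drift at most
  \<open>- \<epsilon> * r powr (\<alpha> - 2)\<close> whenever \<open>\<alpha> * (1 + \<alpha> - 3 * E \<kappa>) < 0\<close>.

  If \<open>E \<kappa> < 1/3\<close>, some \<open>\<alpha> < 0\<close> qualifies and gives a bounded supermartingale vanishing at infinity.
  With positive probability the chain first climbs vertically far away and then never comes back,
  and every step of a surviving chain sweeps area at least \<open>1/2\<close>.

  If \<open>E \<kappa> > 1/3\<close>, every \<open>\<alpha>\<close> between \<open>0\<close> and \<open>3 * E \<kappa> - 1\<close> qualifies. Area has the order of \<open>r ^ 3\<close>,
  so \<open>\<alpha> = 3 * q\<close> with \<open>q \<ge> p\<close> is used to build a supermartingale in (area so far, state) that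
  dominates the \<open>p\<close>-th power of the area. Exponents \<open>p \<le> 0\<close> only need that the area is at
  least \<open>1/2\<close>.
\<close>

subsection \<open>Taylor bounds for powers\<close>

text \<open>The threshold 1/3 comes from the axes. The correction that balances the second-order
  terms inside a quadrant changes sign when \<open>u\<close> and \<open>v\<close> are exchanged:
  relative to the leading term it is \<open>- (a + b) / z\<close> at the end of a quarter turn and
  about \<open>(a + b) / z\<close> at the start of the next. A crossing thus contributes
  \<open>(2 * (a + b) - 2 * \<beta> * E \<kappa>) / z\<close>. For \<open>a = \<beta>\<close> and
  \<open>b = 2 * \<beta> * (\<beta> - 1) / 3\<close> this equals
  \<open>2 / 3 * \<beta> * (1 + 2 * \<beta> - 3 * E \<kappa>) / z\<close>, whence the sign condition
  with \<open>\<alpha> = 2 * \<beta>\<close>.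

  The exponent \<open>3 * q\<close> is a matter of scaling: if \<open>G\<close> has order
  \<open>r powr (3 * q)\<close> and drift of order \<open>r powr (3 * q - 2)\<close>, then
  \<open>G powr (1 / q)\<close> falls by order \<open>r\<close> per step, the order of the area
  swept in a step. Making a supermartingale of this needs convexity for \<open>q \<ge> 1\<close> and
  concavity for \<open>q < 1\<close>, hence two potentials.

  The hypotheses fix transition probabilities conditionally on whole trajectories. The
  supermartingales therefore live on finite histories, a countable space on which the law of the urn
  is identified exactly.\<close>

lemma powr_bound_near_one:
  fixes t g :: real
  assumes "\<bar>t\<bar> \<le> 1/2"
  shows "(1 + t) powr g \<le> 2 powr \<bar>g\<bar>"
proof -
  have l: "\<bar>ln (1 + t)\<bar> \<le> ln 2"
  proof -
    have "ln (1+t) \<le> ln 2" using assms by (subst ln_le_cancel_iff) auto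
    moreover have "ln (1/2) \<le> ln (1+t)" using assms by (subst ln_le_cancel_iff) auto
    moreover have "ln (1/2::real) = - ln 2" by (simp add: ln_div)
    ultimately show ?thesis by auto
  qed
  have "g * ln (1 + t) \<le> \<bar>g\<bar> * ln 2"
  proof -
    have "g * ln (1+t) \<le> \<bar>g\<bar> * \<bar>ln (1+t)\<bar>" by (metis abs_ge_self abs_mult)
    also have "\<dots> \<le> \<bar>g\<bar> * ln 2" using l by (intro mult_left_mono) auto
    finally show ?thesis .
  qed
  then show ?thesis using assms by (auto simp: powr_def)
qed

text \<open>Three orders of expansion are needed. One step changes the squared radius by a relative
  amount \<open>x\<close> of order \<open>1 / r\<close>. The leading power of \<open>lyap\<close> is
  expanded up to the square of \<open>x\<close>; the power in its correction to first order where it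
  multiplies the old numerator, and to order zero where it multiplies the increment of the
  numerator.\<close>

lemma powr_taylor0:
  fixes g :: real
  obtains C where "C \<ge> 0" "\<And>x. \<bar>x\<bar> \<le> 1/2 \<Longrightarrow> \<bar>(1 + x) powr g - 1\<bar> \<le> C * \<bar>x\<bar>"
proof
  define d where "d = (\<lambda>(m::nat) t. if m = 0 then (1 + t) powr g else g * (1 + t) powr (g - 1) :: real)"
  show "0 \<le> \<bar>g\<bar> * 2 powr \<bar>g - 1\<bar>" by simp
  fix x :: real assume x: "\<bar>x\<bar> \<le> 1/2"
  have "\<exists>t. \<bar>t\<bar> \<le> \<bar>x\<bar> \<and> (1 + x) powr g
      = (\<Sum>m<1. d m 0 / fact m * x ^ m) + d 1 t / fact 1 * x ^ 1"
    by (rule Maclaurin_bi_le[of d "\<lambda>x. (1+x) powr g"])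
      (use x in \<open>auto simp: d_def intro!: derivative_eq_intros\<close>)
  then obtain t where t: "\<bar>t\<bar> \<le> \<bar>x\<bar>" "(1 + x) powr g - 1 = g * (1 + t) powr (g - 1) * x"
    by (auto simp: d_def)
  have "(1 + t) powr (g - 1) \<le> 2 powr \<bar>g - 1\<bar>" using t x by (intro powr_bound_near_one) auto
  then show "\<bar>(1 + x) powr g - 1\<bar> \<le> \<bar>g\<bar> * 2 powr \<bar>g - 1\<bar> * \<bar>x\<bar>"
    unfolding t(2) abs_mult by (intro mult_right_mono mult_left_mono) auto
qed

lemma powr_taylor1:
  fixes g :: real
  obtains C where "C \<ge> 0"
    "\<And>x. \<bar>x\<bar> \<le> 1/2 \<Longrightarrow> \<bar>(1 + x) powr g - 1 - g * x\<bar> \<le> C * \<bar>x\<bar>\<^sup>2"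
proof
  define d where "d = (\<lambda>(m::nat) t. if m = 0 then (1 + t) powr g
     else if m = 1 then g * (1 + t) powr (g - 1)
     else g * ((g - 1) * (1 + t) powr (g - 2)) :: real)"
  let ?C = "\<bar>g * (g - 1)\<bar> * 2 powr \<bar>g - 2\<bar>"
  show "0 \<le> ?C" by simp
  fix x :: real assume x: "\<bar>x\<bar> \<le> 1/2"
  have "\<exists>t. \<bar>t\<bar> \<le> \<bar>x\<bar> \<and> (1 + x) powr g
      = (\<Sum>m<2. d m 0 / fact m * x ^ m) + d 2 t / fact 2 * x ^ 2"
    by (rule Maclaurin_bi_le[of d "\<lambda>x. (1+x) powr g"])
      (use x in \<open>auto simp: d_def less_2_cases_iff intro!: derivative_eq_intros\<close>)
  then obtain t where t: "\<bar>t\<bar> \<le> \<bar>x\<bar>"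
     "(1 + x) powr g - 1 - g * x = g * (g - 1) * (1 + t) powr (g - 2) * (x\<^sup>2 / 2)"
    by (auto simp: d_def numeral_2_eq_2)
  have "(1 + t) powr (g - 2) \<le> 2 powr \<bar>g - 2\<bar>" using t x by (intro powr_bound_near_one) auto
  then show "\<bar>(1 + x) powr g - 1 - g * x\<bar> \<le> ?C * \<bar>x\<bar>\<^sup>2"
    unfolding t(2) abs_mult[of _ "x\<^sup>2/2"] abs_mult[of _ "(1+t) powr (g-2)"]
    by (intro mult_mono mult_left_mono) auto
qed

lemma powr_taylor2:
  fixes g :: real
  obtains C where "C \<ge> 0"
    "\<And>x. \<bar>x\<bar> \<le> 1/2 \<Longrightarrow> \<bar>(1 + x) powr g - 1 - g * x - g * (g - 1) / 2 * x\<^sup>2\<bar> \<le> C * \<bar>x\<bar> ^ 3"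
proof
  define d where "d = (\<lambda>(m::nat) t. if m = 0 then (1 + t) powr g
     else if m = 1 then g * (1 + t) powr (g - 1)
     else if m = 2 then g * ((g - 1) * (1 + t) powr (g - 2))
     else g * ((g - 1) * ((g - 2) * (1 + t) powr (g - 3))) :: real)"
  let ?C = "\<bar>g * (g - 1) * (g - 2)\<bar> * 2 powr \<bar>g - 3\<bar>"
  show "0 \<le> ?C" by simp
  fix x :: real assume x: "\<bar>x\<bar> \<le> 1/2"
  have 3: "m < 3 \<longleftrightarrow> m = 0 \<or> m = 1 \<or> m = 2" for m :: nat by auto
  have "\<exists>t. \<bar>t\<bar> \<le> \<bar>x\<bar> \<and> (1 + x) powr g
      = (\<Sum>m<3. d m 0 / fact m * x ^ m) + d 3 t / fact 3 * x ^ 3"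
    by (rule Maclaurin_bi_le[of d "\<lambda>x. (1+x) powr g"])
      (use x in \<open>auto simp: d_def 3 intro!: derivative_eq_intros\<close>)
  then obtain t where t: "\<bar>t\<bar> \<le> \<bar>x\<bar>"
     "(1 + x) powr g = (\<Sum>m<3. d m 0 / fact m * x ^ m) + d 3 t / fact 3 * x ^ 3" by blast
  have e: "(1 + x) powr g - 1 - g * x - g * (g - 1) / 2 * x\<^sup>2
        = g * (g - 1) * (g - 2) * (1 + t) powr (g - 3) * (x ^ 3 / 6)"
    unfolding t(2) by (simp add: d_def numeral_3_eq_3 fact_numeral) (simp add: numeral_2_eq_2)
  have "(1 + t) powr (g - 3) \<le> 2 powr \<bar>g - 3\<bar>" using t x by (intro powr_bound_near_one) auto
  then show "\<bar>(1 + x) powr g - 1 - g * x - g * (g - 1) / 2 * x\<^sup>2\<bar> \<le> ?C * \<bar>x\<bar> ^ 3"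
    unfolding e abs_mult[of _ "x^3/6"] abs_mult[of _ "(1+t) powr (g-3)"]
    by (intro mult_mono mult_left_mono) (auto simp: power_abs)
qed

subsection \<open>The Lyapunov function inside the quadrant\<close>

text \<open>
  To leading order \<open>(u\<^sup>2 + v\<^sup>2) powr \<beta>\<close> is invariant under the rotation
  \<open>u \<partial>\<^sub>v - v \<partial>\<^sub>u\<close>. The correction, homogeneous of degree \<open>2 * \<beta> - 1\<close>, is chosen so that for
  \<open>a = \<beta>\<close> and \<open>b = 2 * \<beta> * (\<beta> - 1) / 3\<close> its rotation cancels the second-order term of the
  generator; taking \<open>a = \<beta> + \<epsilon>\<close> instead leaves a strictly negative drift.
\<close>

definition lyap :: "real \<Rightarrow> real \<Rightarrow> real \<Rightarrow> real \<Rightarrow> real \<Rightarrow> real" where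
  "lyap \<beta> a b u v = (u\<^sup>2 + v\<^sup>2) powr \<beta>
     - (a * (v - u) * (u\<^sup>2 + v\<^sup>2) + b * (v ^ 3 - u ^ 3)) * (u\<^sup>2 + v\<^sup>2) powr (\<beta> - 2)"

text \<open>Puts the value after a step on the scale of the state before it: with \<open>s\<close>
  the old squared radius and \<open>x\<close> its relative change, only powers of
  \<open>1 + x\<close> remain to be expanded.\<close>

lemma lyap_scale:
  fixes s u v :: real
  assumes s: "s > 0" and x: "u\<^sup>2 + v\<^sup>2 = s * (1 + x)" "\<bar>x\<bar> \<le> 1/2"
  shows "lyap \<beta> a b u v = s powr \<beta> * ((1 + x) powr \<beta>
    - (a * (v - u) * (u\<^sup>2 + v\<^sup>2) + b * (v ^ 3 - u ^ 3)) / s\<^sup>2 * (1 + x) powr (\<beta> - 2))"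
proof -
  have 1: "(u\<^sup>2 + v\<^sup>2) powr g = s powr g * (1 + x) powr g" for g
    unfolding x(1) using s x(2) by (simp add: powr_mult)
  have 2: "s powr (\<beta> - 2) = s powr \<beta> / s\<^sup>2"
    using s by (simp add: powr_diff)
  show ?thesis unfolding lyap_def 1 2 using s by (simp add: field_simps)
qed

lemma coords_le:
  fixes u v r :: real
  assumes "0 \<le> r" "u\<^sup>2 + v\<^sup>2 = r\<^sup>2"
  shows "u \<le> r" "v \<le> r"
proof -
  have "u\<^sup>2 \<le> r\<^sup>2" "v\<^sup>2 \<le> r\<^sup>2"
    using assms(2) zero_le_power2[of u] zero_le_power2[of v] by linarith+
  then show "u \<le> r" "v \<le> r" using assms(1) power2_le_imp_le by blast+
qed

text \<open>The correction is smaller than the leading term by the factor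
  \<open>(\<bar>a\<bar> + \<bar>b\<bar>) / r\<close>.\<close>

lemma lyap_near:
  fixes u v :: real
  assumes uv: "0 \<le> u" "0 \<le> v" and r: "r \<ge> 2 * (\<bar>a\<bar> + \<bar>b\<bar>)" "r > 0" "u\<^sup>2 + v\<^sup>2 = r\<^sup>2"
  shows "\<bar>lyap \<beta> a b u v - (u\<^sup>2 + v\<^sup>2) powr \<beta>\<bar> \<le> (u\<^sup>2 + v\<^sup>2) powr \<beta> / 2"
proof -
  have u: "u \<le> r" and v: "v \<le> r"
    using coords_le[of r u v] r by auto
  let ?Q = "a * (v - u) * r\<^sup>2 + b * (v ^ 3 - u ^ 3)"
  have 1: "\<bar>v - u\<bar> \<le> r" using uv u v by auto
  have 2: "\<bar>v^3 - u^3\<bar> \<le> r^3"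
    using power_mono[OF u, of 3] power_mono[OF v, of 3] uv
    by (smt (verit) zero_le_power)
  have "\<bar>?Q\<bar> \<le> \<bar>a\<bar> * r * r\<^sup>2 + \<bar>b\<bar> * r^3"
    using mult_left_mono[OF 1, of "\<bar>a\<bar>"] mult_left_mono[OF 2, of "\<bar>b\<bar>"]
      mult_right_mono[of "\<bar>a\<bar> * \<bar>v - u\<bar>" "\<bar>a\<bar> * r" "r\<^sup>2"]
    by (auto simp: abs_mult intro!: order_trans[OF abs_triangle_ineq])
  also have "\<dots> = (\<bar>a\<bar> + \<bar>b\<bar>) * r^3" by (simp add: power3_eq_cube power2_eq_square algebra_simps)
  also have "\<dots> \<le> r / 2 * r^3" using r by (intro mult_right_mono) auto
  also have "\<dots> = (r\<^sup>2)\<^sup>2 / 2" by (simp add: power3_eq_cube power2_eq_square algebra_simps)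
  finally have Q: "\<bar>?Q\<bar> \<le> (r\<^sup>2)\<^sup>2 / 2" .
  have 3: "(r\<^sup>2) powr (\<beta> - 2) = (r\<^sup>2) powr \<beta> / (r\<^sup>2)\<^sup>2"
    using r by (simp add: powr_diff)
  have "\<bar>lyap \<beta> a b u v - (u\<^sup>2 + v\<^sup>2) powr \<beta>\<bar> = \<bar>?Q\<bar> * (r\<^sup>2) powr (\<beta> - 2)"
    unfolding lyap_def r(3) by (simp add: abs_mult)
  also have "\<dots> \<le> (r\<^sup>2)\<^sup>2 / 2 * (r\<^sup>2) powr (\<beta> - 2)" using Q by (intro mult_right_mono) auto
  also have "\<dots> = (r\<^sup>2) powr \<beta> / 2" unfolding 3 using r by simp
  finally show ?thesis using r by simp
qed

lemma abs_mult_le: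
  fixes x y :: real
  assumes "\<bar>x\<bar> \<le> X" "\<bar>y\<bar> \<le> Y"
  shows "\<bar>x * y\<bar> \<le> X * Y"
  unfolding abs_mult using assms by (intro mult_mono) auto

text \<open>After division by the leading power, the extra \<open>\<epsilon>\<close> in
  \<open>a\<close> yields \<open>- \<epsilon> * (u + v) / s\<close>, while every remainder is
  bounded by a constant over \<open>s\<close>. As \<open>u + v \<ge> r\<close>, half of the gain
  absorbs all remainders once \<open>r\<close> is large.\<close>

lemma lyap_interior_drift:
  fixes \<beta> \<epsilon> :: real
  assumes e: "\<epsilon> > 0"
  defines "a \<equiv> \<beta> + \<epsilon>" and "b \<equiv> 2 * \<beta> * (\<beta> - 1) / 3"
  obtains R where "R > 0" "\<And>u v r. 0 \<le> u \<Longrightarrow> 0 \<le> v \<Longrightarrow> r \<ge> R \<Longrightarrow> u\<^sup>2 + v\<^sup>2 = r\<^sup>2 \<Longrightarrow>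
    u * lyap \<beta> a b u (v + 1) + v * lyap \<beta> a b (u - 1) v
      \<le> (u + v) * (lyap \<beta> a b u v - \<epsilon> / 2 * (u\<^sup>2 + v\<^sup>2) powr (\<beta> - 1))"
proof -
  define g where "g = \<beta> - 2"
  obtain C2 where C2: "C2 \<ge> 0" "\<And>x. \<bar>x\<bar> \<le> 1/2 \<Longrightarrow>
      \<bar>(1 + x) powr \<beta> - 1 - \<beta> * x - \<beta> * (\<beta> - 1) / 2 * x\<^sup>2\<bar> \<le> C2 * \<bar>x\<bar> ^ 3"
    using powr_taylor2[of \<beta>] by blast
  obtain C1 where C1: "C1 \<ge> 0" "\<And>x. \<bar>x\<bar> \<le> 1/2 \<Longrightarrow>
      \<bar>(1 + x) powr g - 1 - g * x\<bar> \<le> C1 * \<bar>x\<bar>\<^sup>2"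
    using powr_taylor1[of g] by blast
  obtain C0 where C0: "C0 \<ge> 0" "\<And>x. \<bar>x\<bar> \<le> 1/2 \<Longrightarrow> \<bar>(1 + x) powr g - 1\<bar> \<le> C0 * \<bar>x\<bar>"
    using powr_taylor0[of g] by blast
  define N where "N = \<bar>a\<bar> + \<bar>b\<bar>"
  have N0: "N \<ge> 0" unfolding N_def by simp
  \<comment> \<open>The summands are, in order, the bounds for \<open>E1\<close> to
    \<open>E6\<close> below.\<close>
  define K where "K = 54 * C2 + N * (2 * \<bar>g\<bar>) + N * (18 * C1) + 7 * N * (6 * C0) + 4 * N + \<bar>\<beta> * (\<beta> - 1)\<bar>"
  show thesis
  \<comment> \<open>The 6 gives \<open>3 / r \<le> 1 / 2\<close>, the range of the Taylor bounds;
    the other entry lets half of the drift pay for \<open>K\<close>.\<close>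
  proof (rule that[of "max 6 (2 * K / \<epsilon>)"])
    show "max 6 (2 * K / \<epsilon>) > 0" by simp
    fix u v r :: real
    assume uv: "0 \<le> u" "0 \<le> v" and R: "max 6 (2 * K / \<epsilon>) \<le> r" and sr: "u\<^sup>2 + v\<^sup>2 = r\<^sup>2"
    have r6: "r \<ge> 6" and rK: "2 * K / \<epsilon> \<le> r" using R by auto
    have u: "u \<le> r" and v: "v \<le> r"
      using coords_le[of r u v] r6 sr by auto
    have ruv: "r \<le> u + v"
      by (rule power2_le_imp_le) (use uv sr in \<open>auto simp: power2_sum\<close>)
    define s where "s = r\<^sup>2"
    have s0: "s > 0" using r6 by (auto simp: s_def)
    define x1 where "x1 = (2 * v + 1) / s"
    define x2 where "x2 = (1 - 2 * u) / s"
    have x1: "u\<^sup>2 + (v + 1)\<^sup>2 = s * (1 + x1)" 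
      using s0 sr by (simp add: x1_def s_def field_simps power2_sum)
    have x2: "(u - 1)\<^sup>2 + v\<^sup>2 = s * (1 + x2)" 
      using s0 sr by (simp add: x2_def s_def field_simps power2_diff)
    have "\<bar>x1\<bar> \<le> 3 * r / s" "\<bar>x2\<bar> \<le> 3 * r / s"
      unfolding x1_def x2_def abs_divide using s0 uv u v r6
      by (auto intro!: divide_right_mono)
    moreover have "3 * r / s = 3 / r" using r6 by (simp add: s_def power2_eq_square)
    ultimately have bx: "\<bar>x1\<bar> \<le> 3 / r" "\<bar>x2\<bar> \<le> 3 / r" by auto
    have "3 / r \<le> 1/2" using r6 by (simp add: field_simps)
    then have hx: "\<bar>x1\<bar> \<le> 1/2" "\<bar>x2\<bar> \<le> 1/2" using bx by linarith+
    define Q where "Q = a * (v - u) * (u\<^sup>2 + v\<^sup>2) + b * (v ^ 3 - u ^ 3)"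
    define q1 where "q1 = a * (s + (v - u) * (2 * v + 1) + (2 * v + 1)) + b * (3 * v\<^sup>2 + 3 * v + 1)"
    define q2 where "q2 = a * (s + (v - u) * (1 - 2 * u) + (1 - 2 * u)) + b * (3 * u\<^sup>2 - 3 * u + 1)"
    have Q1: "a * (v + 1 - u) * (u\<^sup>2 + (v + 1)\<^sup>2) + b * ((v + 1) ^ 3 - u ^ 3) = Q + q1"
      unfolding Q_def q1_def s_def sr[symmetric] by (simp add: power2_eq_square power3_eq_cube algebra_simps)
    have Q2: "a * (v - (u - 1)) * ((u - 1)\<^sup>2 + v\<^sup>2) + b * (v ^ 3 - (u - 1) ^ 3) = Q + q2"
      unfolding Q_def q2_def s_def sr[symmetric] by (simp add: power2_eq_square power3_eq_cube algebra_simps)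
    define A1 where "A1 = (1 + x1) powr \<beta>"
    define A2 where "A2 = (1 + x2) powr \<beta>"
    define B1 where "B1 = (1 + x1) powr g"
    define B2 where "B2 = (1 + x2) powr g"
    have L1: "lyap \<beta> a b u (v + 1) = s powr \<beta> * (A1 - (Q + q1) / s\<^sup>2 * B1)"
      using lyap_scale[OF s0 x1 hx(1), of \<beta> a b] unfolding Q1 A1_def B1_def g_def by simp
    have L2: "lyap \<beta> a b (u - 1) v = s powr \<beta> * (A2 - (Q + q2) / s\<^sup>2 * B2)"
      using lyap_scale[OF s0 x2 hx(2), of \<beta> a b] unfolding Q2 A2_def B2_def g_def by simp
    have L: "lyap \<beta> a b u v = s powr \<beta> * (1 - Q / s\<^sup>2)"
      using lyap_scale[OF s0, of u v 0 \<beta> a b] sr unfolding Q_def s_def by simp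
    define e1 where "e1 = A1 - 1 - \<beta> * x1 - \<beta> * (\<beta> - 1) / 2 * x1\<^sup>2"
    define e2 where "e2 = A2 - 1 - \<beta> * x2 - \<beta> * (\<beta> - 1) / 2 * x2\<^sup>2"
    define f1 where "f1 = B1 - 1 - g * x1"
    define f2 where "f2 = B2 - 1 - g * x2"
    have be: "\<bar>e1\<bar> \<le> C2 * (3 / r) ^ 3" "\<bar>e2\<bar> \<le> C2 * (3 / r) ^ 3"
      unfolding e1_def e2_def A1_def A2_def
      by (rule order_trans[OF C2(2)[OF hx(1)]] order_trans[OF C2(2)[OF hx(2)]],
          intro mult_left_mono power_mono bx C2(1), simp)+
    have bf: "\<bar>f1\<bar> \<le> C1 * (3 / r)\<^sup>2" "\<bar>f2\<bar> \<le> C1 * (3 / r)\<^sup>2"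
      unfolding f1_def f2_def B1_def B2_def
      by (rule order_trans[OF C1(2)[OF hx(1)]] order_trans[OF C1(2)[OF hx(2)]],
          intro mult_left_mono power_mono bx C1(1), simp)+
    have bB: "\<bar>B1 - 1\<bar> \<le> C0 * (3 / r)" "\<bar>B2 - 1\<bar> \<le> C0 * (3 / r)"
      unfolding B1_def B2_def
      by (rule order_trans[OF C0(2)[OF hx(1)]] order_trans[OF C0(2)[OF hx(2)]],
          intro mult_left_mono bx C0(1))+
    have au: "\<bar>u\<bar> \<le> r" "\<bar>v\<bar> \<le> r" "\<bar>v - u\<bar> \<le> r" "\<bar>2 * v + 1\<bar> \<le> 3 * r" "\<bar>1 - 2 * u\<bar> \<le> 3 * r" "\<bar>u + v\<bar> \<le> 2 * r"
      using u v uv r6 by auto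
    have r1: "r \<le> r\<^sup>2" "1 \<le> r\<^sup>2" using r6 by (auto simp: power2_eq_square mult_ge1_I)
    have u2: "u\<^sup>2 \<le> r\<^sup>2" "v\<^sup>2 \<le> r\<^sup>2" using uv u v by (auto intro: power_mono)
    have bQ: "\<bar>Q\<bar> \<le> N * r ^ 3"
    proof -
      have "\<bar>v^3 - u^3\<bar> \<le> r^3"
        using power_mono[OF u, of 3] power_mono[OF v, of 3] uv by (smt (verit) zero_le_power)
      then have "\<bar>b * (v^3 - u^3)\<bar> \<le> \<bar>b\<bar> * r^3" by (intro abs_mult_le) auto
      moreover have "\<bar>a * (v - u) * r\<^sup>2\<bar> \<le> \<bar>a\<bar> * r * r\<^sup>2" by (intro abs_mult_le au) auto
      ultimately show ?thesis unfolding Q_def sr N_def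
        by (simp add: power3_eq_cube power2_eq_square algebra_simps)
    qed
    have bq: "\<bar>q1\<bar> \<le> 7 * N * r\<^sup>2" "\<bar>q2\<bar> \<le> 7 * N * r\<^sup>2"
    proof -
      have "\<bar>(v - u) * (2 * v + 1)\<bar> \<le> r * (3 * r)" "\<bar>(v - u) * (1 - 2 * u)\<bar> \<le> r * (3 * r)"
        by (intro abs_mult_le au)+
      then have "\<bar>s + (v - u) * (2 * v + 1) + (2 * v + 1)\<bar> \<le> 7 * r\<^sup>2"
        "\<bar>s + (v - u) * (1 - 2 * u) + (1 - 2 * u)\<bar> \<le> 7 * r\<^sup>2"
        using au(4,5) r1 r6 unfolding s_def power2_eq_square by linarith+
      moreover have "\<bar>3 * v\<^sup>2 + 3 * v + 1\<bar> \<le> 7 * r\<^sup>2" "\<bar>3 * u\<^sup>2 - 3 * u + 1\<bar> \<le> 7 * r\<^sup>2"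
        using u2 au(1,2) r1 zero_le_power2[of u] zero_le_power2[of v] by linarith+
      moreover have N7: "7 * N * r\<^sup>2 = \<bar>a\<bar> * (7 * r\<^sup>2) + \<bar>b\<bar> * (7 * r\<^sup>2)"
        by (simp add: N_def algebra_simps)
      ultimately have "\<bar>a * (s + (v - u) * (2 * v + 1) + (2 * v + 1))\<bar> \<le> \<bar>a\<bar> * (7 * r\<^sup>2)"
        "\<bar>a * (s + (v - u) * (1 - 2 * u) + (1 - 2 * u))\<bar> \<le> \<bar>a\<bar> * (7 * r\<^sup>2)"
        "\<bar>b * (3 * v\<^sup>2 + 3 * v + 1)\<bar> \<le> \<bar>b\<bar> * (7 * r\<^sup>2)"
        "\<bar>b * (3 * u\<^sup>2 - 3 * u + 1)\<bar> \<le> \<bar>b\<bar> * (7 * r\<^sup>2)"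
        by (auto intro!: abs_mult_le)
      then show "\<bar>q1\<bar> \<le> 7 * N * r\<^sup>2" "\<bar>q2\<bar> \<le> 7 * N * r\<^sup>2"
        unfolding q1_def q2_def N7 by linarith+
    qed
    \<comment> \<open>The remainders: \<open>E1\<close> is the cubic Taylor error of the leading
      power, \<open>E2\<close> and \<open>E3\<close> are the linear part and the error in the change
      of the power multiplying \<open>Q\<close>, \<open>E4\<close> is the product of both changes in
      the correction, and \<open>E5\<close>, \<open>E6\<close> collect the lower-order parts of the
      increments of \<open>Q\<close> and of the squared relative changes.\<close>
    define E1 where "E1 = u * e1 + v * e2"
    define E2 where "E2 = Q * (g * (u + v))"
    define E3 where "E3 = Q * (u * f1 + v * f2)"
    define E4 where "E4 = u * (q1 * (B1 - 1)) + v * (q2 * (B2 - 1))"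
    define E5 where "E5 = a * ((v - u) * (u + v)) + (a + b) * (u + v)"
    define E6 where "E6 = \<beta> * (\<beta> - 1) / 2 * (u + v)"
    have bE1: "\<bar>E1\<bar> \<le> 54 * C2 / s"
    proof -
      have "\<bar>E1\<bar> \<le> r * (C2 * (3/r)^3) + r * (C2 * (3/r)^3)"
        unfolding E1_def by (intro order_trans[OF abs_triangle_ineq] add_mono abs_mult_le au be)
      also have "\<dots> = 54 * C2 / s" using r6 by (simp add: s_def field_simps power3_eq_cube power2_eq_square)
      finally show ?thesis .
    qed
    have bE2: "\<bar>E2\<bar> \<le> N * (2 * \<bar>g\<bar>) * s\<^sup>2"
    proof -
      have "\<bar>E2\<bar> \<le> (N * r^3) * (\<bar>g\<bar> * (2 * r))"
        unfolding E2_def by (intro abs_mult_le bQ au) auto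
      also have "\<dots> = N * (2 * \<bar>g\<bar>) * s\<^sup>2" by (simp add: s_def field_simps power3_eq_cube power2_eq_square)
      finally show ?thesis .
    qed
    have bE3: "\<bar>E3\<bar> \<le> N * (18 * C1) * s"
    proof -
      have "\<bar>E3\<bar> \<le> (N * r^3) * (r * (C1 * (3/r)\<^sup>2) + r * (C1 * (3/r)\<^sup>2))"
        unfolding E3_def by (intro abs_mult_le order_trans[OF abs_triangle_ineq] add_mono bQ au bf)
      also have "\<dots> = N * (18 * C1) * s" using r6 by (simp add: s_def field_simps power3_eq_cube power2_eq_square)
      finally show ?thesis .
    qed
    have bE4: "\<bar>E4\<bar> \<le> 7 * N * (6 * C0) * s"
    proof -
      have "\<bar>E4\<bar> \<le> r * (7 * N * r\<^sup>2 * (C0 * (3/r))) + r * (7 * N * r\<^sup>2 * (C0 * (3/r)))"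
        unfolding E4_def by (intro order_trans[OF abs_triangle_ineq] add_mono abs_mult_le au bq bB)
      also have "\<dots> = 7 * N * (6 * C0) * s" using r6 by (simp add: s_def field_simps power3_eq_cube power2_eq_square)
      finally show ?thesis .
    qed
    have bE5: "\<bar>E5\<bar> \<le> 4 * N * s"
    proof -
      have "\<bar>E5\<bar> \<le> \<bar>a\<bar> * (r * (2 * r)) + N * (2 * r)"
        unfolding E5_def by (intro order_trans[OF abs_triangle_ineq] add_mono abs_mult_le au) (auto simp: N_def)
      also have "\<dots> \<le> N * (r * (2 * r)) + N * (2 * r\<^sup>2)"
        using r1 r6 N0 by (intro add_mono mult_left_mono mult_right_mono) (auto simp: N_def)
      also have "\<dots> = 4 * N * s" by (simp add: s_def field_simps power2_eq_square)
      finally show ?thesis .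
    qed
    have bE6: "\<bar>E6\<bar> \<le> \<bar>\<beta> * (\<beta> - 1)\<bar> * s"
    proof -
      have "\<bar>E6\<bar> \<le> \<bar>\<beta> * (\<beta> - 1) / 2\<bar> * (2 * r)"
        unfolding E6_def by (intro abs_mult_le au) auto
      also have "\<dots> = \<bar>\<beta> * (\<beta> - 1)\<bar> * r" by simp
      also have "\<dots> \<le> \<bar>\<beta> * (\<beta> - 1)\<bar> * s" unfolding s_def using r1 by (intro mult_left_mono) auto
      finally show ?thesis .
    qed
    have id: "u * (A1 - (Q + q1) / s\<^sup>2 * B1) + v * (A2 - (Q + q2) / s\<^sup>2 * B2) - (u + v) * (1 - Q / s\<^sup>2)
      = - \<epsilon> * (u + v) / s + E1 - E2 / s ^ 3 - E3 / s\<^sup>2 - E4 / s\<^sup>2 - E5 / s\<^sup>2 + E6 / s\<^sup>2"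
    proof -
      have A: "A1 = 1 + \<beta> * x1 + \<beta> * (\<beta> - 1) / 2 * x1\<^sup>2 + e1"
        "A2 = 1 + \<beta> * x2 + \<beta> * (\<beta> - 1) / 2 * x2\<^sup>2 + e2" by (auto simp: e1_def e2_def)
      \<comment> \<open>The terms \<open>2 * u * v\<close> of the two moves cancel (rotation
        preserves the radius), so \<open>u * x1 + v * x2\<close> is only
        \<open>(u + v) / s\<close>.\<close>
      have h1: "u * A1 + v * A2 - (u + v)
          = \<beta> * (u + v) / s + 2 * \<beta> * (\<beta> - 1) * (u * v * (u + v)) / s\<^sup>2 + E6 / s\<^sup>2 + E1"
        unfolding A E1_def E6_def x1_def x2_def using s0
        by (simp add: field_simps power2_eq_square)
      have h2: "u * (Q * (B1 - 1)) + v * (Q * (B2 - 1)) = E2 / s + E3"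
        unfolding E2_def E3_def f1_def f2_def x1_def x2_def using s0
        by (simp add: field_simps)
      have h3: "u * q1 + v * q2 = a * s * (u + v) + 3 * b * (u * v * (u + v)) + E5"
        unfolding q1_def q2_def E5_def by (simp add: algebra_simps power2_eq_square)
      have "u * (A1 - (Q + q1) / s\<^sup>2 * B1) + v * (A2 - (Q + q2) / s\<^sup>2 * B2) - (u + v) * (1 - Q / s\<^sup>2)
        = (u * A1 + v * A2 - (u + v)) - (u * (Q * (B1 - 1)) + v * (Q * (B2 - 1))) / s\<^sup>2
          - (u * q1 + v * q2) / s\<^sup>2 - E4 / s\<^sup>2"
        unfolding E4_def using s0 by (simp add: field_simps)
      \<comment> \<open>Here the choice of \<open>a\<close> and \<open>b\<close> matters:
        \<open>3 * b\<close> cancels the \<open>u * v * (u + v)\<close> term of \<open>h1\<close>,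
        and \<open>a\<close> cancels \<open>\<beta> * (u + v) / s\<close> up to the surplus
        \<open>\<epsilon>\<close>.\<close>
      also have "\<dots> = - \<epsilon> * (u + v) / s + E1 - E2 / s ^ 3 - E3 / s\<^sup>2 - E4 / s\<^sup>2 - E5 / s\<^sup>2 + E6 / s\<^sup>2"
        unfolding h1 h2 h3 a_def b_def using s0
        by (simp add: field_simps power2_eq_square power3_eq_cube)
      finally show ?thesis .
    qed
    have "\<bar>E2 / s ^ 3\<bar> \<le> N * (2 * \<bar>g\<bar>) * s\<^sup>2 / s ^ 3" "\<bar>E3 / s\<^sup>2\<bar> \<le> N * (18 * C1) * s / s\<^sup>2"
      "\<bar>E4 / s\<^sup>2\<bar> \<le> 7 * N * (6 * C0) * s / s\<^sup>2" "\<bar>E5 / s\<^sup>2\<bar> \<le> 4 * N * s / s\<^sup>2"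
      "\<bar>E6 / s\<^sup>2\<bar> \<le> \<bar>\<beta> * (\<beta> - 1)\<bar> * s / s\<^sup>2"
      using bE2 bE3 bE4 bE5 bE6 s0 by (auto simp: abs_divide intro!: divide_right_mono)
    moreover have "x * s\<^sup>2 / s ^ 3 = x / s" "x * s / s\<^sup>2 = x / s" for x
      using s0 by (auto simp: field_simps power2_eq_square power3_eq_cube)
    ultimately have "u * (A1 - (Q + q1) / s\<^sup>2 * B1) + v * (A2 - (Q + q2) / s\<^sup>2 * B2) - (u + v) * (1 - Q / s\<^sup>2)
      \<le> - \<epsilon> * (u + v) / s + 54 * C2 / s + N * (2 * \<bar>g\<bar>) / s + N * (18 * C1) / s + 7 * N * (6 * C0) / s
        + 4 * N / s + \<bar>\<beta> * (\<beta> - 1)\<bar> / s"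
      unfolding id using bE1 by (smt (verit))
    also have "\<dots> = (- \<epsilon> * (u + v) + K) / s"
      unfolding K_def by (simp add: add_divide_distrib diff_divide_distrib)
    also have "\<dots> \<le> (- \<epsilon> / 2 * (u + v)) / s"
    proof -
      have "K \<le> \<epsilon> / 2 * r" using rK e by (simp add: field_simps)
      also have "\<dots> \<le> \<epsilon> / 2 * (u + v)" using e ruv by (intro mult_left_mono) auto
      finally show ?thesis using s0 by (intro divide_right_mono) auto
    qed
    finally have main: "u * (A1 - (Q + q1) / s\<^sup>2 * B1) + v * (A2 - (Q + q2) / s\<^sup>2 * B2)
      \<le> (u + v) * (1 - Q / s\<^sup>2) + (- \<epsilon> / 2 * (u + v)) / s" by linarith
    have ps: "s powr (\<beta> - 1) = s powr \<beta> / s" using s0 by (simp add: powr_diff)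
    have "u * lyap \<beta> a b u (v + 1) + v * lyap \<beta> a b (u - 1) v
      = s powr \<beta> * (u * (A1 - (Q + q1) / s\<^sup>2 * B1) + v * (A2 - (Q + q2) / s\<^sup>2 * B2))"
      unfolding L1 L2 by (simp add: algebra_simps)
    also have "\<dots> \<le> s powr \<beta> * ((u + v) * (1 - Q / s\<^sup>2) + (- \<epsilon> / 2 * (u + v)) / s)"
      by (intro mult_left_mono main) auto
    also have "\<dots> = (u + v) * (lyap \<beta> a b u v - \<epsilon> / 2 * (u\<^sup>2 + v\<^sup>2) powr (\<beta> - 1))"
      unfolding L sr s_def[symmetric] ps using s0 by (simp add: field_simps)
    finally show "u * lyap \<beta> a b u (v + 1) + v * lyap \<beta> a b (u - 1) v
      \<le> (u + v) * (lyap \<beta> a b u v - \<epsilon> / 2 * (u\<^sup>2 + v\<^sup>2) powr (\<beta> - 1))" .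
  qed
qed

subsection \<open>The Lyapunov function across an axis\<close>

text \<open>\<open>lyap\<close> need not be positive near the origin, hence the truncation.\<close>

definition tlyap :: "real \<Rightarrow> real \<Rightarrow> real \<Rightarrow> real \<Rightarrow> real \<Rightarrow> real \<Rightarrow> real \<Rightarrow> real" where
  "tlyap \<rho> c \<beta> a b u v = (if u\<^sup>2 + v\<^sup>2 < \<rho>\<^sup>2 then c else lyap \<beta> a b u v)"

lemma tlyap_bounds:
  fixes u v :: real
  assumes uv: "0 \<le> u" "0 \<le> v" and \<rho>: "\<rho> \<ge> 2 * (\<bar>a\<bar> + \<bar>b\<bar>)" "\<rho> > 0" and s: "\<rho>\<^sup>2 \<le> u\<^sup>2 + v\<^sup>2"
  shows "(u\<^sup>2 + v\<^sup>2) powr \<beta> / 2 \<le> tlyap \<rho> c \<beta> a b u v" "tlyap \<rho> c \<beta> a b u v \<le> 2 * (u\<^sup>2 + v\<^sup>2) powr \<beta>"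
proof -
  define r where "r = sqrt (u\<^sup>2 + v\<^sup>2)"
  have "0 < u\<^sup>2 + v\<^sup>2" using s \<rho>(2) zero_less_power[of \<rho> 2] by linarith
  have "\<rho> \<le> r" unfolding r_def using s \<rho> by (intro real_le_rsqrt) auto
  with \<open>0 < u\<^sup>2 + v\<^sup>2\<close> have "\<bar>lyap \<beta> a b u v - (u\<^sup>2 + v\<^sup>2) powr \<beta>\<bar> \<le> (u\<^sup>2 + v\<^sup>2) powr \<beta> / 2"
    using \<rho> by (intro lyap_near[of u v a b r] uv) (auto simp: r_def)
  then show "(u\<^sup>2 + v\<^sup>2) powr \<beta> / 2 \<le> tlyap \<rho> c \<beta> a b u v" "tlyap \<rho> c \<beta> a b u v \<le> 2 * (u\<^sup>2 + v\<^sup>2) powr \<beta>"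
    using s unfolding tlyap_def by (simp_all, linarith+)
qed

text \<open>At the start of a quarter turn \<open>u\<close> exceeds \<open>v\<close>, so the
  correction enters with the sign opposite to that at \<open>(0, z)\<close>; the noise adds
  \<open>- 2 * \<beta> * k / z\<close> through the leading power. The error is kept polynomial in
  \<open>k\<close> so that it can be integrated, and \<open>\<bar>k\<bar> \<le> z / 8\<close> keeps
  the relative change within the Taylor range.\<close>

lemma lyap_axis_near:
  fixes \<beta> a b :: real
  obtains C where "C \<ge> 0" "\<And>z k. z \<ge> 4 \<Longrightarrow> \<bar>k\<bar> \<le> z / 8 \<Longrightarrow>
    lyap \<beta> a b (z - k) 1
      \<le> (z\<^sup>2) powr \<beta> * (1 + (a + b - 2 * \<beta> * k) / z + C * (1 + \<bar>k\<bar>)\<^sup>2 / z\<^sup>2)"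
proof -
  define g where "g = \<beta> - 2"
  obtain C1 where C1: "C1 \<ge> 0" "\<And>x. \<bar>x\<bar> \<le> 1/2 \<Longrightarrow>
      \<bar>(1 + x) powr \<beta> - 1 - \<beta> * x\<bar> \<le> C1 * \<bar>x\<bar>\<^sup>2"
    using powr_taylor1[of \<beta>] by blast
  obtain C0 where C0: "C0 \<ge> 0" "\<And>x. \<bar>x\<bar> \<le> 1/2 \<Longrightarrow> \<bar>(1 + x) powr g - 1\<bar> \<le> C0 * \<bar>x\<bar>"
    using powr_taylor0[of g] by blast
  define N where "N = \<bar>a\<bar> + \<bar>b\<bar>"
  have N0: "N \<ge> 0" unfolding N_def by simp
  define K where "K = \<bar>\<beta>\<bar> + 9 * C1 + 14 * N + 14 * N * C0 + 3 * N * C0"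
  show thesis
  proof (rule that[of K])
    show "0 \<le> K" using N0 C1(1) C0(1) unfolding K_def by simp
    fix z k :: real assume z: "z \<ge> 4" and k: "\<bar>k\<bar> \<le> z / 8"
    define w where "w = z - k"
    define y where "y = 1 + \<bar>k\<bar>"
    have y1: "y \<ge> 1" "\<bar>k\<bar> \<le> y" by (auto simp: y_def)
    define x where "x = (k\<^sup>2 + 1 - 2 * z * k) / z\<^sup>2"
    have z2: "z\<^sup>2 > 0" using z by auto
    have wx: "w\<^sup>2 + 1\<^sup>2 = z\<^sup>2 * (1 + x)"
      using z by (simp add: w_def x_def field_simps power2_diff)
    have k2: "k\<^sup>2 \<le> z / 8 * \<bar>k\<bar>"
      using mult_right_mono[OF k, of "\<bar>k\<bar>"] by (simp add: power2_eq_square)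
    have k2': "z / 8 * \<bar>k\<bar> \<le> z / 8 * (z / 8)" using k z by (intro mult_left_mono) auto
    have zk: "\<bar>z * k\<bar> = z * \<bar>k\<bar>" using z by (simp add: abs_mult)
    have num: "\<bar>k\<^sup>2 + 1 - 2 * z * k\<bar> \<le> 3 * z * y"
    proof -
      have "\<bar>k\<^sup>2 + 1 - 2 * z * k\<bar> \<le> k\<^sup>2 + 1 + 2 * (z * \<bar>k\<bar>)" using zk zero_le_power2[of k] by linarith
      also have "\<dots> \<le> z / 8 * \<bar>k\<bar> + z + 2 * (z * \<bar>k\<bar>)" using k2 z by linarith
      also have "\<dots> = z * (17 / 8 * \<bar>k\<bar> + 1)" by (simp add: algebra_simps)
      also have "\<dots> \<le> z * (3 * y)" using z unfolding y_def by (intro mult_left_mono) auto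
      finally show ?thesis by simp
    qed
    have bx: "\<bar>x\<bar> \<le> 3 * y / z"
    proof -
      have "\<bar>x\<bar> \<le> 3 * z * y / z\<^sup>2" unfolding x_def abs_divide using num by (auto intro!: divide_right_mono)
      also have "\<dots> = 3 * y / z" using z by (simp add: power2_eq_square)
      finally show ?thesis .
    qed
    have hx: "\<bar>x\<bar> \<le> 1/2"
    proof -
      have "16 \<le> z * z" using mult_mono[of 4 z 4 z] z by auto
      then have "\<bar>k\<^sup>2 + 1 - 2 * z * k\<bar> \<le> 1/2 * z\<^sup>2"
        using k2 k2' zk zero_le_power2[of k] unfolding power2_eq_square[of z] by linarith
      then show ?thesis unfolding x_def abs_divide using z2 by (simp add: field_simps)
    qed
    define A where "A = (1 + x) powr \<beta>"
    define B where "B = (1 + x) powr g"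
    have y2: "y \<le> y\<^sup>2" using y1 by (simp add: power2_eq_square)
    have bA: "A \<le> 1 - 2 * \<beta> * k / z + (\<bar>\<beta>\<bar> + 9 * C1) * y\<^sup>2 / z\<^sup>2"
    proof -
      have "A \<le> 1 + \<beta> * x + C1 * \<bar>x\<bar>\<^sup>2" using C1(2)[OF hx] unfolding A_def by linarith
      also have "C1 * \<bar>x\<bar>\<^sup>2 \<le> C1 * (3 * y / z)\<^sup>2" using bx C1(1) by (intro mult_left_mono power_mono) auto
      also have "\<dots> = 9 * C1 * y\<^sup>2 / z\<^sup>2" by (simp add: power_divide power_mult_distrib)
      also have "\<beta> * x = - 2 * \<beta> * k / z + \<beta> * (k\<^sup>2 + 1) / z\<^sup>2"
        using z unfolding x_def by (simp add: field_simps power2_eq_square)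
      also have "\<beta> * (k\<^sup>2 + 1) / z\<^sup>2 \<le> \<bar>\<beta>\<bar> * y\<^sup>2 / z\<^sup>2"
        unfolding y_def by (intro divide_right_mono mult_mono) (auto simp: power2_sum)
      finally show ?thesis by (simp add: add_divide_distrib distrib_right)
    qed
    have w: "0 \<le> w" "w \<le> 2 * z" using k z by (auto simp: w_def abs_le_iff)
    \<comment> \<open>\<open>P\<close> is minus the numerator of the correction at
      \<open>(w, 1)\<close>, and \<open>D\<close> its deviation from the leading part
      \<open>(a + b) * z ^ 3\<close>.\<close>
    define P where "P = a * (w - 1) * (w\<^sup>2 + 1) + b * (w ^ 3 - 1)"
    define D where "D = P - (a + b) * z ^ 3"
    have bD: "\<bar>D\<bar> \<le> 14 * N * y * z\<^sup>2"
    proof -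
      have w2: "w\<^sup>2 \<le> 4 * z\<^sup>2" using power_mono[OF w(2) w(1), of 2] by (simp add: power_mult_distrib)
      have wz: "w * z \<le> 2 * z\<^sup>2" using mult_right_mono[OF w(2), of z] z by (simp add: power2_eq_square)
      have zz: "z \<le> z\<^sup>2" "1 \<le> z\<^sup>2" using z by (auto simp: power2_eq_square mult_ge1_I)
      have wzz: "0 \<le> w * z" using w z by simp
      have e3: "w ^ 3 - z ^ 3 = - k * (w\<^sup>2 + w * z + z\<^sup>2)"
        unfolding w_def by (simp add: power3_eq_cube power2_eq_square algebra_simps)
      have c3: "\<bar>w ^ 3 - z ^ 3\<bar> \<le> \<bar>k\<bar> * (7 * z\<^sup>2)"
        unfolding e3 using w2 wz wzz by (intro abs_mult_le) auto
      have d2: "\<bar>- w\<^sup>2 + w - 1\<bar> \<le> 7 * z\<^sup>2" using w2 w zz zero_le_power2[of w] by linarith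
      have "7 * z\<^sup>2 + \<bar>k\<bar> * (7 * z\<^sup>2) = 7 * y * z\<^sup>2" by (simp add: y_def algebra_simps)
      then have p1: "\<bar>(w ^ 3 - z ^ 3) + (- w\<^sup>2 + w - 1)\<bar> \<le> 14 * y * z\<^sup>2"
        "\<bar>(w ^ 3 - z ^ 3) - 1\<bar> \<le> 14 * y * z\<^sup>2"
        using c3 d2 zz by linarith+
      have "D = a * ((w ^ 3 - z ^ 3) + (- w\<^sup>2 + w - 1)) + b * ((w ^ 3 - z ^ 3) - 1)"
        unfolding D_def P_def by (simp add: power3_eq_cube power2_eq_square algebra_simps)
      then have "\<bar>D\<bar> \<le> \<bar>a\<bar> * (14 * y * z\<^sup>2) + \<bar>b\<bar> * (14 * y * z\<^sup>2)"
        using abs_mult_le[of a "\<bar>a\<bar>", OF _ p1(1)] abs_mult_le[of b "\<bar>b\<bar>", OF _ p1(2)]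
        by linarith
      then show ?thesis by (simp add: N_def algebra_simps)
    qed
    have bPB: "P / (z\<^sup>2)\<^sup>2 * B \<le> (a + b) / z + (14 * N + 14 * N * C0 + 3 * N * C0) * y\<^sup>2 / z\<^sup>2"
    proof -
      have e1: "\<bar>B - 1\<bar> \<le> C0 * (3 * y / z)"
        unfolding B_def by (rule order_trans[OF C0(2)[OF hx]]) (intro mult_left_mono bx C0(1))
      have e2: "\<bar>B - 1\<bar> \<le> C0"
        using C0(2)[OF hx] mult_left_mono[OF hx C0(1)] C0(1) unfolding B_def by linarith
      have "P * B = (a + b) * z ^ 3 + D + (a + b) * z ^ 3 * (B - 1) + D * (B - 1)"
        unfolding D_def by (simp add: algebra_simps)
      also have "\<dots> \<le> (a + b) * z ^ 3 + 14 * N * y * z\<^sup>2 + N * z ^ 3 * (C0 * (3 * y / z)) + 14 * N * y * z\<^sup>2 * C0"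
      proof -
        have "\<bar>(a + b) * z ^ 3\<bar> \<le> N * z ^ 3" using z by (intro abs_mult_le) (auto simp: N_def)
        then show ?thesis using bD abs_mult_le[OF _ e1, of "(a + b) * z ^ 3" "N * z ^ 3"]
          abs_mult_le[OF bD e2] by linarith
      qed
      also have "N * z ^ 3 * (C0 * (3 * y / z)) = 3 * N * C0 * y * z\<^sup>2"
        using z by (simp add: power3_eq_cube power2_eq_square)
      finally have "P * B \<le> (a + b) * z ^ 3 + (14 * N + 14 * N * C0 + 3 * N * C0) * y * z\<^sup>2"
        by (simp add: algebra_simps)
      also have "\<dots> \<le> (a + b) * z ^ 3 + (14 * N + 14 * N * C0 + 3 * N * C0) * y\<^sup>2 * z\<^sup>2"
        using y2 N0 C0(1) by (intro add_left_mono mult_right_mono mult_left_mono) auto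
      finally have "P * B / (z\<^sup>2)\<^sup>2 \<le> ((a + b) * z ^ 3 + (14 * N + 14 * N * C0 + 3 * N * C0) * y\<^sup>2 * z\<^sup>2) / (z\<^sup>2)\<^sup>2"
        by (intro divide_right_mono) auto
      also have "\<dots> = (a + b) / z + (14 * N + 14 * N * C0 + 3 * N * C0) * y\<^sup>2 / z\<^sup>2"
        using z by (simp add: field_simps power2_eq_square power3_eq_cube)
      finally show ?thesis by simp
    qed
    have "lyap \<beta> a b w 1 = (z\<^sup>2) powr \<beta> * (A + P / (z\<^sup>2)\<^sup>2 * B)"
      using lyap_scale[OF z2 wx hx, of \<beta> a b] unfolding A_def B_def g_def P_def
      by (simp add: algebra_simps diff_divide_distrib add_divide_distrib)
    also have "\<dots> \<le> (z\<^sup>2) powr \<beta> * (1 + (a + b - 2 * \<beta> * k) / z + K * y\<^sup>2 / z\<^sup>2)"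
      using bA bPB unfolding K_def
      by (intro mult_left_mono) (auto simp: add_divide_distrib diff_divide_distrib distrib_right)
    finally show "lyap \<beta> a b (z - k) 1
      \<le> (z\<^sup>2) powr \<beta> * (1 + (a + b - 2 * \<beta> * k) / z + K * (1 + \<bar>k\<bar>)\<^sup>2 / z\<^sup>2)"
      unfolding w_def y_def .
  qed
qed

text \<open>Large noise is harmless: if \<open>\<bar>k\<bar> > z / 8\<close>, then any power of
  \<open>z\<close> that appears is at most a power of \<open>8 * \<bar>k\<bar>\<close> and
  disappears in the error term. The cut-off \<open>max 1\<close> acts only in this range.\<close>

lemma tlyap_axis:
  fixes \<beta> a b c \<rho> :: real
  assumes \<rho>: "\<rho> \<ge> 2 * (\<bar>a\<bar> + \<bar>b\<bar>)" "\<rho> > 0" and c: "c \<le> 1"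
  obtains C R m where "C \<ge> 0" "(R::real) \<ge> 4"
    "\<And>z k::int. R \<le> z \<Longrightarrow> tlyap \<rho> c \<beta> a b (real_of_int (max 1 (z - k))) 1
      \<le> ((real_of_int z)\<^sup>2) powr \<beta> * (1 + (a + b - 2 * \<beta> * k) / z + C * (1 + \<bar>real_of_int k\<bar>) ^ m / (real_of_int z)\<^sup>2)"
proof (rule lyap_axis_near[of \<beta> a b])
  fix C1 :: real
  assume C1: "C1 \<ge> 0" "\<And>z k. z \<ge> 4 \<Longrightarrow> \<bar>k\<bar> \<le> z / 8 \<Longrightarrow>
    lyap \<beta> a b (z - k) 1
      \<le> (z\<^sup>2) powr \<beta> * (1 + (a + b - 2 * \<beta> * k) / z + C1 * (1 + \<bar>k\<bar>)\<^sup>2 / z\<^sup>2)"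
  define e where "e = \<bar>\<beta>\<bar>"
  \<comment> \<open>With \<open>y = \<bar>k\<bar>\<close> and \<open>z \<le> 8 * y\<close>, the new
    value costs \<open>y powr (2 * e)\<close> and its division by
    \<open>z powr (2 * \<beta> - 2)\<close> another \<open>y powr (2 + 2 * e)\<close>; the linear
    terms multiplied by the square of \<open>z\<close> need \<open>y ^ 3\<close>.\<close>
  define m where "m = nat \<lceil>3 + 4 * e\<rceil>"
  have m: "3 + 4 * e \<le> real m" "m \<ge> 3" unfolding m_def e_def by (auto simp: le_nat_iff)
  \<comment> \<open>The summands serve \<open>t1\<close> and \<open>t2\<close> below. The 82 is
    \<open>9 ^ 2 + 1\<close>, from a new coordinate of at most \<open>9 * y\<close>; the 64 is
    \<open>8 ^ 2\<close>.\<close>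
  define C2 where "C2 = 3 * (82 powr e * 8 powr (2 + 2 * e)) + 64 * (1 + \<bar>a\<bar> + \<bar>b\<bar> + 2 * e)"
  have C2: "C2 \<ge> 0" unfolding C2_def e_def by (intro add_nonneg_nonneg mult_nonneg_nonneg) auto
  define C where "C = C1 + C2"
  show thesis
  proof (rule that[of C "max 4 (2 * \<rho>)" m])
    show "0 \<le> C" using C1(1) C2 by (simp add: C_def)
    show "4 \<le> max 4 (2 * \<rho>)" by simp
    fix z k :: int assume "max 4 (2 * \<rho>) \<le> z"
    then have z: "real_of_int z \<ge> 4" and zr: "2 * \<rho> \<le> real_of_int z" by auto
    show "tlyap \<rho> c \<beta> a b (real_of_int (max 1 (z - k))) 1
      \<le> ((real_of_int z)\<^sup>2) powr \<beta> * (1 + (a + b - 2 * \<beta> * k) / z + C * (1 + \<bar>real_of_int k\<bar>) ^ m / (real_of_int z)\<^sup>2)"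
    proof (cases "\<bar>real_of_int k\<bar> \<le> real_of_int z / 8")
      case True
      have le: "z - k \<ge> 1"
      proof -
        have "real_of_int (z - k) \<ge> 1" using True z by (simp add: abs_le_iff)
        then show ?thesis by linarith
      qed
      then have mx: "max 1 (z - k) = z - k" by simp
      have "\<rho>\<^sup>2 \<le> (real_of_int (z - k))\<^sup>2" using True zr \<rho>(2) z by (intro power_mono) (auto simp: abs_le_iff)
      then have "tlyap \<rho> c \<beta> a b (real_of_int (max 1 (z - k))) 1 = lyap \<beta> a b (real_of_int z - real_of_int k) 1"
        unfolding mx tlyap_def by simp
      also have "\<dots> \<le> ((real_of_int z)\<^sup>2) powr \<beta> * (1 + (a + b - 2 * \<beta> * k) / z + C1 * (1 + \<bar>real_of_int k\<bar>)\<^sup>2 / (real_of_int z)\<^sup>2)"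
        by (rule C1(2)[OF z True])
      also have "\<dots> \<le> ((real_of_int z)\<^sup>2) powr \<beta> * (1 + (a + b - 2 * \<beta> * k) / z + C * (1 + \<bar>real_of_int k\<bar>) ^ m / (real_of_int z)\<^sup>2)"
        using m C1(1) C2 unfolding C_def
        by (intro mult_left_mono add_left_mono divide_right_mono mult_mono power_increasing) auto
      finally show ?thesis .
    next
      case False
      define zz where "zz = real_of_int z"
      define y where "y = \<bar>real_of_int k\<bar>"
      have zy: "zz \<le> 8 * y" using False by (simp add: zz_def y_def)
      have y1: "y \<ge> 1"
      proof -
        have "k \<noteq> 0" using False z by auto
        then show ?thesis unfolding y_def by linarith
      qed
      have z4: "zz \<ge> 4" using z by (simp add: zz_def)
      define w where "w = real_of_int (max 1 (z - k))"
      have w: "1 \<le> w" "w \<le> 9 * y"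
        using zy y1 unfolding w_def zz_def y_def by (auto simp: max_def abs_if split: if_splits)
      have e0: "e \<ge> 0" by (simp add: e_def)
      define T where "T = tlyap \<rho> c \<beta> a b w 1"
      have s1: "w\<^sup>2 + 1 \<le> 82 * y\<^sup>2"
        using power_mono[OF w(2), of 2] w(1) one_le_power[OF y1, of 2] unfolding power_mult_distrib by simp
      have p1: "(w\<^sup>2 + 1) powr \<beta> \<le> (82 * y\<^sup>2) powr e"
      proof -
        have "(w\<^sup>2 + 1) powr \<beta> \<le> (w\<^sup>2 + 1) powr e" using w by (intro powr_mono) (auto simp: e_def)
        also have "\<dots> \<le> (82 * y\<^sup>2) powr e" using s1 e0 by (intro powr_mono2) auto
        finally show ?thesis .
      qed
      have p2: "1 \<le> (82 * y\<^sup>2) powr e"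
      proof -
        have "1 \<le> 82 * y\<^sup>2" using s1 zero_le_power2[of w] by linarith
        then show ?thesis using e0 by (simp add: ge_one_powr_ge_zero)
      qed
      have T1: "T \<le> 3 * (82 * y\<^sup>2) powr e"
      proof (cases "w\<^sup>2 + 1 < \<rho>\<^sup>2")
        case True then show ?thesis unfolding T_def tlyap_def using c p2 by simp
      next
        case False
        then have "T \<le> 2 * (w\<^sup>2 + 1\<^sup>2) powr \<beta>" unfolding T_def using w \<rho> by (intro tlyap_bounds) auto
        then show ?thesis using p1 p2 by simp
      qed
      have yp: "y\<^sup>2 = y powr 2" "y ^ m = y powr (real m)" using y1 by (auto simp: powr_realpow)
      have zz2: "zz\<^sup>2 = zz powr 2" using z4 by (simp add: powr_numeral)
      have zp: "(zz\<^sup>2) powr (1 - \<beta>) \<le> (8 * y) powr (2 + 2 * e)"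
      proof -
        have "(zz\<^sup>2) powr (1 - \<beta>) = zz powr (2 * (1 - \<beta>))"
          unfolding zz2 powr_powr by simp
        also have "\<dots> \<le> zz powr (2 + 2 * e)" using z4 by (intro powr_mono) (auto simp: e_def)
        also have "\<dots> \<le> (8 * y) powr (2 + 2 * e)" using z4 zy e0 by (intro powr_mono2) auto
        finally show ?thesis .
      qed
      have "T * (zz\<^sup>2) powr (1 - \<beta>) \<le> 3 * (82 * y\<^sup>2) powr e * (8 * y) powr (2 + 2 * e)"
      proof -
        have "T * (zz\<^sup>2) powr (1 - \<beta>) \<le> 3 * (82 * y\<^sup>2) powr e * (zz\<^sup>2) powr (1 - \<beta>)"
          by (intro mult_right_mono T1) auto
        also have "\<dots> \<le> 3 * (82 * y\<^sup>2) powr e * (8 * y) powr (2 + 2 * e)"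
          by (intro mult_left_mono zp) auto
        finally show ?thesis .
      qed
      also have "\<dots> = 3 * (82 powr e * 8 powr (2 + 2 * e)) * y powr (2 + 4 * e)"
      proof -
        have "(82 * y\<^sup>2) powr e = 82 powr e * y powr (2 * e)"
          using y1 unfolding yp by (subst powr_mult) (auto simp: powr_powr simp del: powr_numeral)
        moreover have "(8 * y) powr (2 + 2 * e) = 8 powr (2 + 2 * e) * y powr (2 + 2 * e)"
          using y1 by (subst powr_mult) auto
        moreover have "y powr (2 * e) * y powr (2 + 2 * e) = y powr (2 + 4 * e)"
          by (simp only: powr_add[symmetric]) (simp add: add.commute)
        ultimately show ?thesis by simp
      qed
      also have "\<dots> \<le> 3 * (82 powr e * 8 powr (2 + 2 * e)) * y ^ m"
        unfolding yp using y1 m by (intro mult_left_mono powr_mono) auto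
      finally have t1: "T * (zz\<^sup>2) powr (1 - \<beta>) \<le> 3 * (82 powr e * 8 powr (2 + 2 * e)) * y ^ m" .
      have t2: "- (1 + (a + b - 2 * \<beta> * k) / zz) * zz\<^sup>2 \<le> 64 * (1 + \<bar>a\<bar> + \<bar>b\<bar> + 2 * e) * y ^ m"
      proof -
        have "2 * \<bar>\<beta> * k\<bar> = 2 * e * y" by (simp add: e_def y_def abs_mult)
        then have n: "\<bar>a + b - 2 * \<beta> * k\<bar> \<le> \<bar>a\<bar> + \<bar>b\<bar> + 2 * e * y"
          by (simp add: abs_le_iff) linarith
        have "\<bar>(a + b - 2 * \<beta> * k) / zz\<bar> \<le> \<bar>a + b - 2 * \<beta> * k\<bar>"
          unfolding abs_divide using z4 by (simp add: divide_le_eq mult_le_cancel_left1)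
        then have "- (1 + (a + b - 2 * \<beta> * k) / zz) \<le> 1 + \<bar>a\<bar> + \<bar>b\<bar> + 2 * e * y"
          using n by linarith
        also have "\<dots> \<le> (1 + \<bar>a\<bar> + \<bar>b\<bar> + 2 * e) * y"
        proof -
          have "(1 + \<bar>a\<bar> + \<bar>b\<bar>) * 1 \<le> (1 + \<bar>a\<bar> + \<bar>b\<bar>) * y" using y1 by (intro mult_left_mono) auto
          then show ?thesis by (simp add: algebra_simps)
        qed
        finally have "- (1 + (a + b - 2 * \<beta> * k) / zz) * zz\<^sup>2 \<le> (1 + \<bar>a\<bar> + \<bar>b\<bar> + 2 * e) * y * zz\<^sup>2"
          by (intro mult_right_mono) auto
        also have "\<dots> \<le> (1 + \<bar>a\<bar> + \<bar>b\<bar> + 2 * e) * y * (8 * y)\<^sup>2"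
          using zy z4 y1 e0 by (intro mult_left_mono power_mono) auto
        also have "\<dots> = 64 * (1 + \<bar>a\<bar> + \<bar>b\<bar> + 2 * e) * y ^ 3"
          by (simp add: power2_eq_square power3_eq_cube)
        also have "\<dots> \<le> 64 * (1 + \<bar>a\<bar> + \<bar>b\<bar> + 2 * e) * y ^ m"
          using y1 m e0 by (intro mult_left_mono power_increasing) auto
        finally show ?thesis .
      qed
      have "T * (zz\<^sup>2) powr (1 - \<beta>) - (1 + (a + b - 2 * \<beta> * k) / zz) * zz\<^sup>2 \<le> C2 * y ^ m"
        using t1 t2 unfolding C2_def by (simp add: algebra_simps)
      also have "\<dots> \<le> C * (1 + y) ^ m"
        using C1(1) C2 y1 unfolding C_def by (intro mult_mono power_mono) auto
      finally have fin: "T * (zz\<^sup>2) powr (1 - \<beta>) \<le> (1 + (a + b - 2 * \<beta> * k) / zz) * zz\<^sup>2 + C * (1 + y) ^ m"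
        by simp
      have pz: "(zz\<^sup>2) powr (1 - \<beta>) * (zz\<^sup>2) powr (\<beta> - 1) = 1"
        using z4 by (simp add: powr_add[symmetric])
      have pz2: "(zz\<^sup>2) powr (\<beta> - 1) = (zz\<^sup>2) powr \<beta> / zz\<^sup>2" using z4 by (simp add: powr_diff)
      have "T = T * (zz\<^sup>2) powr (1 - \<beta>) * (zz\<^sup>2) powr (\<beta> - 1)" using pz by (simp add: mult.assoc)
      also have "\<dots> \<le> ((1 + (a + b - 2 * \<beta> * k) / zz) * zz\<^sup>2 + C * (1 + y) ^ m) * (zz\<^sup>2) powr (\<beta> - 1)"
        by (intro mult_right_mono fin) auto
      also have "\<dots> = (zz\<^sup>2) powr \<beta> * (1 + (a + b - 2 * \<beta> * k) / zz + C * (1 + y) ^ m / zz\<^sup>2)"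
        unfolding pz2 using z4 by (simp add: divide_simps)
      finally show ?thesis unfolding T_def w_def zz_def y_def .
    qed
  qed
qed

text \<open>
  The urn rotated into the first quadrant: \<open>u\<close> is the coordinate being run down, \<open>v\<close> the one being
  built up, and an axis point \<open>z\<close> is \<open>(0, z)\<close>, the end of a quarter turn.
\<close>

definition kern :: "int pmf \<Rightarrow> int \<times> int \<Rightarrow> (int \<times> int) pmf" where
  "kern K z = (case z of (u, v) \<Rightarrow>
     if u = 0 then map_pmf (\<lambda>k. (max 1 (v - k), 1)) K
     else map_pmf (\<lambda>b. if b then (u, v + 1) else (u - 1, v)) (bernoulli_pmf (u / (u + v))))"

definition sqn :: "int \<times> int \<Rightarrow> real" where
  "sqn z = (real_of_int (fst z))\<^sup>2 + (real_of_int (snd z))\<^sup>2"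

definition quad :: "int \<times> int \<Rightarrow> bool" where
  "quad z \<longleftrightarrow> 0 \<le> fst z \<and> 1 \<le> snd z"

lemma sqn_ge1: "quad z \<Longrightarrow> 1 \<le> sqn z"
proof -
  assume "quad z"
  then have "1 \<le> real_of_int (snd z)" by (simp add: quad_def)
  then have "1 \<le> (real_of_int (snd z))\<^sup>2" by (rule one_le_power)
  then show ?thesis unfolding sqn_def by (simp add: add_increasing)
qed

lemma quad_kern: "quad z \<Longrightarrow> z' \<in> set_pmf (kern K z) \<Longrightarrow> quad z'"
  unfolding kern_def quad_def by (cases z) (auto split: if_splits)

lemma nn_integral_kern_interior:
  assumes "1 \<le> u" "1 \<le> v" "0 \<le> f (u, v + 1)" "0 \<le> f (u - 1, v)"
  shows "(\<integral>\<^sup>+z. ennreal (f z) \<partial>kern K (u, v))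
    = ennreal ((real_of_int u * f (u, v + 1) + real_of_int v * f (u - 1, v)) / real_of_int (u + v))"
proof -
  define p where "p = real_of_int u / real_of_int (u + v)"
  have uv: "real_of_int u \<ge> 1" "real_of_int v \<ge> 1" using assms by auto
  have p: "0 \<le> p" "p \<le> 1" unfolding p_def using uv by (auto simp: divide_le_eq)
  have q: "1 - p = real_of_int v / real_of_int (u + v)" unfolding p_def using uv by (simp add: field_simps)
  have "(\<integral>\<^sup>+z. ennreal (f z) \<partial>kern K (u, v)) = ennreal (f (u, v + 1)) * p + ennreal (f (u - 1, v)) * (1 - p)"
    unfolding kern_def using assms p by (simp add: p_def)
  also have "\<dots> = ennreal (f (u, v + 1) * p + f (u - 1, v) * (1 - p))"
    using assms p by (simp add: ennreal_mult' ennreal_plus)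
  also have "f (u, v + 1) * p + f (u - 1, v) * (1 - p) = (real_of_int u * f (u, v + 1) + real_of_int v * f (u - 1, v)) / real_of_int (u + v)"
    unfolding q unfolding p_def by (simp add: add_divide_distrib mult.commute)
  finally show ?thesis .
qed

lemma nn_integral_kern_axis:
  "(\<integral>\<^sup>+z. f z \<partial>kern K (0, v)) = (\<integral>\<^sup>+k. f (max 1 (v - k), 1) \<partial>K)"
  unfolding kern_def by simp

section \<open>Moments of the noise and the drift under the kernel\<close>

definition noise_mean :: "int pmf \<Rightarrow> real" where
  "noise_mean K = measure_pmf.expectation K real_of_int"

text \<open>The form in which the exponential moment is used: the exponent \<open>m\<close> of the
  error in \<open>tlyap_axis\<close> grows with \<open>\<bar>\<beta>\<bar>\<close>.\<close>

definition all_moments :: "int pmf \<Rightarrow> bool" where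
  "all_moments K \<longleftrightarrow> (\<forall>m. integrable (measure_pmf K) (\<lambda>k. (1 + \<bar>real_of_int k\<bar>) ^ m))"

lemma all_moments_integrable:
  assumes "all_moments K" shows "integrable (measure_pmf K) real_of_int"
proof -
  have "integrable (measure_pmf K) (\<lambda>k. (1 + \<bar>real_of_int k\<bar>) ^ 1)"
    using assms unfolding all_moments_def by blast
  then show ?thesis by (rule Bochner_Integration.integrable_bound) auto
qed

text \<open>Inside the quadrant the drift is negative for either sign of \<open>\<beta>\<close>; the
  sign condition is what the axis jumps require. The value \<open>c\<close> on the truncated ball
  stays free: 0 is used for positive exponents and 1 for negative ones.\<close>

lemma lyap_kern_drift:
  fixes \<beta> c :: real
  assumes mom: "all_moments K" and sgn: "\<beta> * (1 + 2 * \<beta> - 3 * noise_mean K) < 0"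
    and c: "0 \<le> c" "c \<le> 1"
  obtains f \<rho> R \<epsilon> where "\<epsilon> > 0" "1 \<le> \<rho>" "\<rho> < R" "\<And>z. quad z \<Longrightarrow> 0 \<le> f z"
    "\<And>z. quad z \<Longrightarrow> sqn z < \<rho>\<^sup>2 \<Longrightarrow> f z = c"
    "\<And>z. quad z \<Longrightarrow> \<rho>\<^sup>2 \<le> sqn z \<Longrightarrow> sqn z powr \<beta> / 2 \<le> f z"
    "\<And>z. quad z \<Longrightarrow> \<rho>\<^sup>2 \<le> sqn z \<Longrightarrow> f z \<le> 2 * sqn z powr \<beta>"
    "\<And>z. quad z \<Longrightarrow> R\<^sup>2 \<le> sqn z \<Longrightarrow> \<epsilon> * sqn z powr (\<beta> - 1) \<le> f z \<and>
       (\<integral>\<^sup>+z'. ennreal (f z') \<partial>kern K z) \<le> ennreal (f z - \<epsilon> * sqn z powr (\<beta> - 1))"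
proof -
  define \<mu> where "\<mu> = noise_mean K"
  define D where "D = \<beta> * (1 + 2 * \<beta> - 3 * \<mu>)"
  have D: "D < 0" using sgn by (simp add: D_def \<mu>_def)
  \<comment> \<open>For \<open>a = \<beta>\<close> the crossing coefficient is
    \<open>2 / 3 * D\<close>. Raising \<open>a\<close> by \<open>e\<close> adds
    \<open>2 * e\<close>, so this choice keeps half of it, \<open>D / 3 = - 2 * e\<close>.\<close>
  define e where "e = - D / 6"
  have e: "e > 0" using D by (simp add: e_def)
  define a where "a = \<beta> + e"
  define b where "b = 2 * \<beta> * (\<beta> - 1) / 3"
  have ab: "2 * (a + b) - 2 * \<beta> * \<mu> = - 2 * e"
    unfolding a_def b_def e_def D_def by (simp add: field_simps)
  define \<rho> where "\<rho> = max 1 (2 * (\<bar>a\<bar> + \<bar>b\<bar>))"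
  have \<rho>: "\<rho> \<ge> 2 * (\<bar>a\<bar> + \<bar>b\<bar>)" "\<rho> > 0" "\<rho> \<ge> 1" by (auto simp: \<rho>_def)
  define f where "f = (\<lambda>z. tlyap \<rho> c \<beta> a b (real_of_int (fst z)) (real_of_int (snd z)))"
  have fc: "f z = c" if "sqn z < \<rho>\<^sup>2" for z using that unfolding f_def tlyap_def sqn_def by simp
  have fb: "sqn z powr \<beta> / 2 \<le> f z" "f z \<le> 2 * sqn z powr \<beta>" if "quad z" "\<rho>\<^sup>2 \<le> sqn z" for z
    unfolding f_def sqn_def
    by (rule tlyap_bounds; use that \<rho> in \<open>simp add: sqn_def quad_def\<close>)+
  have f0: "0 \<le> f z" if "quad z" for z
  proof (cases "sqn z < \<rho>\<^sup>2")
    case False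
    have "0 \<le> sqn z powr \<beta> / 2" by simp
    also have "\<dots> \<le> f z" using fb[of z] that False by simp
    finally show ?thesis .
  qed (use c fc in auto)
  have fl: "f z = lyap \<beta> a b (real_of_int (fst z)) (real_of_int (snd z))" if "\<rho>\<^sup>2 \<le> sqn z" for z
    using that unfolding f_def tlyap_def sqn_def by simp
  obtain R1 where R1: "R1 > 0" "\<And>u v r. 0 \<le> u \<Longrightarrow> 0 \<le> v \<Longrightarrow> r \<ge> R1 \<Longrightarrow> u\<^sup>2 + v\<^sup>2 = r\<^sup>2 \<Longrightarrow>
    u * lyap \<beta> a b u (v + 1) + v * lyap \<beta> a b (u - 1) v
      \<le> (u + v) * (lyap \<beta> a b u v - e / 2 * (u\<^sup>2 + v\<^sup>2) powr (\<beta> - 1))"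
    using lyap_interior_drift[OF e, of \<beta>] unfolding a_def b_def by blast
  obtain C R2 m where C: "C \<ge> 0" "(R2::real) \<ge> 4"
    "\<And>z k::int. R2 \<le> z \<Longrightarrow> tlyap \<rho> c \<beta> a b (real_of_int (max 1 (z - k))) 1
      \<le> ((real_of_int z)\<^sup>2) powr \<beta> * (1 + (a + b - 2 * \<beta> * k) / z + C * (1 + \<bar>real_of_int k\<bar>) ^ m / (real_of_int z)\<^sup>2)"
    using tlyap_axis[OF \<rho>(1,2) c(2)] by blast
  define Mm where "Mm = measure_pmf.expectation K (\<lambda>k. (1 + \<bar>real_of_int k\<bar>) ^ m)"
  have im: "integrable (measure_pmf K) (\<lambda>k. (1 + \<bar>real_of_int k\<bar>) ^ m)"
    using mom unfolding all_moments_def by blast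
  have ik: "integrable (measure_pmf K) real_of_int" by (rule all_moments_integrable[OF mom])
  \<comment> \<open>The bound \<open>1 / 2\<close> keeps the subtracted drift below
    \<open>f z\<close>, so that \<open>ennreal\<close> does not truncate a negative difference to
    0.\<close>
  define \<epsilon> where "\<epsilon> = min (e / 2) (1 / 2)"
  have \<epsilon>: "\<epsilon> > 0" "\<epsilon> \<le> e / 2" "\<epsilon> \<le> 1 / 2" using e by (auto simp: \<epsilon>_def)
  \<comment> \<open>A step inside the quadrant lowers the radius by at most 1, so
    \<open>\<rho> + 1\<close> keeps both successors outside the truncated ball. The last entry makes
    the crossing gain \<open>2 * e / y\<close> exceed the error of order
    \<open>1 / y ^ 2\<close>.\<close>
  define R where "R = max (max (\<rho> + 1) R1) (max R2 ((C * Mm + \<epsilon>) / (2 * e)))"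
  have R: "\<rho> + 1 \<le> R" "R1 \<le> R" "R2 \<le> R" "(C * Mm + \<epsilon>) / (2 * e) \<le> R" by (auto simp: R_def)
  show thesis
  proof (rule that[of \<epsilon> \<rho> R f])
    show "0 < \<epsilon>" by (rule \<epsilon>)
    show "1 \<le> \<rho>" by (rule \<rho>)
    show "\<rho> < R" using R by simp
    fix z assume q: "quad z"
    show "0 \<le> f z" by (rule f0[OF q])
    show "sqn z < \<rho>\<^sup>2 \<Longrightarrow> f z = c" by (rule fc)
    show "\<rho>\<^sup>2 \<le> sqn z \<Longrightarrow> sqn z powr \<beta> / 2 \<le> f z" "\<rho>\<^sup>2 \<le> sqn z \<Longrightarrow> f z \<le> 2 * sqn z powr \<beta>"
      using fb[OF q] by auto
    assume zR: "R\<^sup>2 \<le> sqn z"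
    obtain u v where z: "z = (u, v)" by (cases z)
    have uv: "0 \<le> u" "1 \<le> v" using q by (auto simp: z quad_def)
    have "\<rho>\<^sup>2 \<le> R\<^sup>2" using R \<rho> by (intro power_mono) auto
    then have z\<rho>: "\<rho>\<^sup>2 \<le> sqn z" using zR by simp
    define s where "s = sqn z"
    have s1: "s \<ge> 1" unfolding s_def by (rule sqn_ge1[OF q])
    have p1: "s powr (\<beta> - 1) \<le> s powr \<beta>" using s1 by (intro powr_mono) auto
    have le: "\<epsilon> * s powr (\<beta> - 1) \<le> f z"
    proof -
      have "\<epsilon> * s powr (\<beta> - 1) \<le> 1 / 2 * s powr \<beta>" using p1 \<epsilon> by (intro mult_mono) auto
      then show ?thesis using fb(1)[OF q z\<rho>] unfolding s_def by simp
    qed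
    define r where "r = sqrt s"
    have r: "r\<^sup>2 = s" "r \<ge> 0" using s1 by (auto simp: r_def)
    have rR: "R \<le> r" unfolding r_def s_def using zR by (intro real_le_rsqrt) auto
    have "(\<integral>\<^sup>+z'. ennreal (f z') \<partial>kern K z) \<le> ennreal (f z - \<epsilon> * s powr (\<beta> - 1))"
    proof (cases "u = 0")
      case False
      then have u1: "1 \<le> u" using uv by simp
      have q12: "quad (u, v + 1)" "quad (u - 1, v)" using uv u1 by (auto simp: quad_def)
      have sr: "(real_of_int u)\<^sup>2 + (real_of_int v)\<^sup>2 = r\<^sup>2" unfolding r s_def sqn_def z by simp
      have "u \<le> r" using coords_le(1)[OF r(2) sr] by simp
      have "(r - 1)\<^sup>2 \<le> sqn (u - 1, v)"
        using \<open>u \<le> r\<close> sr unfolding sqn_def by (simp add: power2_diff)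
      moreover have "\<rho>\<^sup>2 \<le> (r - 1)\<^sup>2" using R rR \<rho> by (intro power_mono) auto
      ultimately have \<rho>2: "\<rho>\<^sup>2 \<le> sqn (u - 1, v)" by simp
      have "(real_of_int v)\<^sup>2 \<le> (real_of_int (v + 1))\<^sup>2" using uv by (intro power_mono) auto
      then have \<rho>1: "\<rho>\<^sup>2 \<le> sqn (u, v + 1)" using z\<rho> unfolding sqn_def z by simp
      have "(\<integral>\<^sup>+z'. ennreal (f z') \<partial>kern K z) = ennreal ((real_of_int u * f (u, v + 1) + real_of_int v * f (u - 1, v)) / real_of_int (u + v))"
        unfolding z by (rule nn_integral_kern_interior[OF u1 uv(2) f0[OF q12(1)] f0[OF q12(2)]])
      also have "\<dots> \<le> ennreal (f z - e / 2 * s powr (\<beta> - 1))"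
      proof (rule ennreal_leI)
        have "real_of_int u * f (u, v + 1) + real_of_int v * f (u - 1, v) \<le> (real_of_int u + real_of_int v) * (f z - e / 2 * s powr (\<beta> - 1))"
          using R1(2)[OF _ _ _ sr] uv R rR unfolding fl[OF \<rho>1] fl[OF \<rho>2] fl[OF z\<rho>]
          unfolding z s_def sqn_def by simp
        then show "(real_of_int u * f (u, v + 1) + real_of_int v * f (u - 1, v)) / real_of_int (u + v) \<le> f z - e / 2 * s powr (\<beta> - 1)"
          using uv u1 by (simp add: divide_le_eq mult.commute)
      qed
      also have "\<dots> \<le> ennreal (f z - \<epsilon> * s powr (\<beta> - 1))"
        using \<epsilon> by (intro ennreal_leI diff_left_mono mult_right_mono) auto
      finally show ?thesis .
    next
      case True
      define y where "y = real_of_int v"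
      have y1: "y \<ge> 1" using uv by (simp add: y_def)
      have sy: "s = y\<^sup>2" unfolding s_def sqn_def z True y_def by simp
      have ry: "r = y" unfolding r_def sy using y1 by simp
      define h where "h = (\<lambda>k. (y\<^sup>2) powr \<beta> * (1 + (a + b - 2 * \<beta> * real_of_int k) / y + C * (1 + \<bar>real_of_int k\<bar>) ^ m / y\<^sup>2))"
      have fh: "f (max 1 (v - k), 1) \<le> h k" for k
        using C(3)[of v k] R rR ry unfolding f_def h_def y_def by simp
      have h0: "0 \<le> h k" for k
        using order_trans[OF f0 fh[of k]] by (simp add: quad_def)
      have ih: "integrable (measure_pmf K) h"
        unfolding h_def using im ik by (auto simp: divide_inverse)
      have Eh: "measure_pmf.expectation K h = (y\<^sup>2) powr \<beta> * (1 + (a + b - 2 * \<beta> * \<mu>) / y + C * Mm / y\<^sup>2)"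
        unfolding h_def \<mu>_def noise_mean_def Mm_def using im ik by (simp add: divide_inverse)
      have "(\<integral>\<^sup>+z'. ennreal (f z') \<partial>kern K z) = (\<integral>\<^sup>+k. ennreal (f (max 1 (v - k), 1)) \<partial>K)"
        unfolding z True nn_integral_kern_axis ..
      also have "\<dots> \<le> (\<integral>\<^sup>+k. ennreal (h k) \<partial>K)"
        by (intro nn_integral_mono ennreal_leI fh)
      also have "\<dots> = ennreal (measure_pmf.expectation K h)"
        using ih h0 by (intro nn_integral_eq_integral) auto
      also have "\<dots> \<le> ennreal (f z - \<epsilon> * s powr (\<beta> - 1))"
      proof (rule ennreal_leI)
        have fz: "f z = (y\<^sup>2) powr \<beta> * (1 - (a + b) / y)"
        proof -
          have "(a * y * y\<^sup>2 + b * y ^ 3) / (y\<^sup>2)\<^sup>2 = (a + b) / y"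
            using y1 by (simp add: field_simps power2_eq_square power3_eq_cube)
          then show ?thesis unfolding fl[OF z\<rho>]
            using y1 lyap_scale[of "y\<^sup>2" 0 y 0 \<beta> a b] by (simp add: z True y_def[symmetric])
        qed
        have p2: "(y\<^sup>2) powr (\<beta> - 1) = (y\<^sup>2) powr \<beta> / y\<^sup>2" using y1 by (simp add: powr_diff)
        have "(C * Mm + \<epsilon>) / (2 * e) \<le> y" using R(4) rR ry by simp
        then have "C * Mm + \<epsilon> \<le> 2 * e * y" using e by (simp add: divide_le_eq mult.commute)
        then have "(C * Mm + \<epsilon>) / y\<^sup>2 \<le> 2 * e * y / y\<^sup>2" by (intro divide_right_mono) auto
        also have "\<dots> = - (2 * (a + b) - 2 * \<beta> * \<mu>) / y" unfolding ab using y1 by (simp add: power2_eq_square)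
        finally have "1 + (a + b - 2 * \<beta> * \<mu>) / y + C * Mm / y\<^sup>2 \<le> 1 - (a + b) / y - \<epsilon> / y\<^sup>2"
          by (simp add: diff_divide_distrib add_divide_distrib)
        then have "(y\<^sup>2) powr \<beta> * (1 + (a + b - 2 * \<beta> * \<mu>) / y + C * Mm / y\<^sup>2)
           \<le> (y\<^sup>2) powr \<beta> * (1 - (a + b) / y - \<epsilon> / y\<^sup>2)" by (intro mult_left_mono) auto
        then show "measure_pmf.expectation K h \<le> f z - \<epsilon> * s powr (\<beta> - 1)"
          unfolding Eh fz sy p2 by (simp add: algebra_simps)
      qed
      finally show ?thesis .
    qed
    then show "\<epsilon> * sqn z powr (\<beta> - 1) \<le> f z \<and>
       (\<integral>\<^sup>+z'. ennreal (f z') \<partial>kern K z) \<le> ennreal (f z - \<epsilon> * sqn z powr (\<beta> - 1))"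
      using le unfolding s_def by blast
  qed
qed

subsection \<open>A strict Lyapunov function on the whole quadrant\<close>

text \<open>
  If \<open>P (\<kappa> \<ge> 1) > 0\<close>, then \<open>hdist z\<close> steps suffice to go from \<open>z\<close> to \<open>(0, 1)\<close> with positive
  probability: run \<open>u\<close> down to \<open>0\<close>, jump to \<open>(w, 1)\<close> with \<open>w < v\<close>, run down again. Adding a multiple
  of \<open>hpot\<close> makes the drift of the Lyapunov function negative on a bounded region, and since
  \<open>hpot\<close> is maximal outside that region it does no harm there.
\<close>

definition hdist :: "int \<times> int \<Rightarrow> nat" where
  "hdist z = nat (fst z + 2 * snd z - 2)"

definition hpot :: "real \<Rightarrow> nat \<Rightarrow> int \<times> int \<Rightarrow> real" where
  "hpot \<theta> L z = (if hdist z \<le> L then 1 - \<theta> ^ hdist z else 1)"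

lemma hpot_bounds:
  assumes "0 < \<theta>" "\<theta> < 1"
  shows "0 \<le> hpot \<theta> L z" "hpot \<theta> L z \<le> 1"
  using assms by (auto simp: hpot_def power_le_one)

lemma hpot_decreasing_step:
  assumes "0 < \<theta>" "\<theta> < 1" "hdist z \<le> L" "hdist z' < hdist z"
  shows "hpot \<theta> L z' \<le> 1 - \<theta> ^ (hdist z - 1)"
proof -
  have "\<theta> ^ (hdist z - 1) \<le> \<theta> ^ hdist z'"
    using assms by (intro power_decreasing) auto
  then show ?thesis using assms by (simp add: hpot_def)
qed

lemma nn_integral_one_minus_indicator:
  fixes K :: "'b pmf"
  assumes "0 \<le> t" "t \<le> 1"
  shows "(\<integral>\<^sup>+k. ennreal (1 - t * indicator S k) \<partial>K) = ennreal (1 - t * measure_pmf.prob K S)"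
proof -
  have "(\<integral>\<^sup>+k. ennreal (1 - t * indicator S k) \<partial>K) = ennreal (measure_pmf.expectation K (\<lambda>k. 1 - t * indicator S k))"
    using assms by (intro nn_integral_eq_integral) (auto simp: indicator_def intro!: measure_pmf.integrable_const_bound[where B=1])
  also have "measure_pmf.expectation K (\<lambda>k. 1 - t * indicator S k) = 1 - t * measure_pmf.prob K S"
  proof -
    have "integrable (measure_pmf K) (indicat_real S)"
      by (rule measure_pmf.integrable_const_bound[where B=1]) auto
    then show ?thesis by simp
  qed
  finally show ?thesis .
qed

text \<open>With \<open>D = hdist z\<close>, a move that lowers \<open>hdist\<close> leads to at
  most \<open>1 - \<theta> ^ (D - 1)\<close>, any other to at most 1. If the former has probability
  at least \<open>2 * \<theta>\<close>, the mean is at most \<open>1 - 2 * \<theta> ^ D\<close>, a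
  gain of \<open>\<theta> ^ D\<close>. The two conditions on \<open>\<theta>\<close> provide that
  probability inside the quadrant, where \<open>u + v \<le> L + 2\<close>, and on the axis.\<close>

lemma hpot_drift:
  assumes q: "quad z" "z \<noteq> (0, 1)" and d: "hdist z \<le> L"
    and \<theta>: "0 < \<theta>" "\<theta> < 1" "2 * \<theta> \<le> 1 / (real L + 2)" "2 * \<theta> \<le> measure_pmf.prob K {1..}"
  shows "\<theta> ^ L \<le> hpot \<theta> L z"
    "(\<integral>\<^sup>+z'. ennreal (hpot \<theta> L z') \<partial>kern K z) \<le> ennreal (hpot \<theta> L z - \<theta> ^ L)"
proof -
  obtain u v where z: "z = (u, v)" by (cases z)
  have uv: "0 \<le> u" "1 \<le> v" "u \<noteq> 0 \<or> v \<noteq> 1" using q by (auto simp: z quad_def)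
  have d1: "1 \<le> hdist z" using uv by (auto simp: hdist_def z)
  define D where "D = hdist z"
  have pD: "\<theta> ^ D = \<theta> * \<theta> ^ (D - 1)" using d1 by (cases D) (auto simp: D_def)
  have pL: "\<theta> ^ L \<le> \<theta> ^ D" using d \<theta> unfolding D_def by (intro power_decreasing) auto
  have \<phi>: "hpot \<theta> L z = 1 - \<theta> ^ D" using d by (simp add: hpot_def D_def)
  have t1: "\<theta> ^ (D - 1) \<le> 1" "0 < \<theta> ^ (D - 1)" using \<theta> by (auto simp: power_le_one)
  have "1 / (real L + 2) \<le> 1 / 2" by (simp add: field_simps)
  then have "\<theta> \<le> 1 / 4" using \<theta>(3) by linarith
  then have "2 * \<theta> ^ D \<le> 1" unfolding pD using t1 \<theta> mult_mono[of \<theta> "1/4" "\<theta> ^ (D - 1)" 1] by simp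
  then show "\<theta> ^ L \<le> hpot \<theta> L z" using pL unfolding \<phi> by simp
  have key: "1 - \<theta> ^ (D - 1) * \<pi> \<le> hpot \<theta> L z - \<theta> ^ L" if "2 * \<theta> \<le> \<pi>" for \<pi>
  proof -
    have "\<theta> ^ (D - 1) * (2 * \<theta>) \<le> \<theta> ^ (D - 1) * \<pi>" using that t1 by (intro mult_left_mono) auto
    then show ?thesis using pL unfolding \<phi> pD by (simp add: algebra_simps)
  qed
  show "(\<integral>\<^sup>+z'. ennreal (hpot \<theta> L z') \<partial>kern K z) \<le> ennreal (hpot \<theta> L z - \<theta> ^ L)"
  proof (cases "u = 0")
    case True
    have v2: "v \<ge> 2" using uv True by auto
    have hk: "hpot \<theta> L (max 1 (v - k), 1) \<le> 1 - \<theta> ^ (D - 1) * indicator {1..} k" for k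
    proof (cases "k \<ge> 1")
      case True
      have "hdist (max 1 (v - k), 1) < hdist z"
        unfolding hdist_def z using \<open>u = 0\<close> v2 True by (auto simp: max_def)
      then show ?thesis using hpot_decreasing_step[OF \<theta>(1,2) d] True unfolding D_def by simp
    next
      case False
      then show ?thesis using hpot_bounds(2)[OF \<theta>(1,2)] by simp
    qed
    have "(\<integral>\<^sup>+z'. ennreal (hpot \<theta> L z') \<partial>kern K z) = (\<integral>\<^sup>+k. ennreal (hpot \<theta> L (max 1 (v - k), 1)) \<partial>K)"
      unfolding z True nn_integral_kern_axis ..
    also have "\<dots> \<le> (\<integral>\<^sup>+k. ennreal (1 - \<theta> ^ (D - 1) * indicator {1..} k) \<partial>K)"
      by (intro nn_integral_mono ennreal_leI hk)
    also have "\<dots> = ennreal (1 - \<theta> ^ (D - 1) * measure_pmf.prob K {1..})"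
      using t1 by (intro nn_integral_one_minus_indicator) auto
    also have "\<dots> \<le> ennreal (hpot \<theta> L z - \<theta> ^ L)" by (intro ennreal_leI key \<theta>)
    finally show ?thesis .
  next
    case False
    then have u1: "1 \<le> u" using uv by simp
    have ru: "real_of_int u \<ge> 1" "real_of_int v \<ge> 1" using u1 uv by auto
    define \<pi> where "\<pi> = real_of_int v / real_of_int (u + v)"
    have "int (hdist z) \<le> int L" using d by simp
    then have "u + 2 * v - 2 \<le> int L" using uv u1 by (simp add: hdist_def z)
    then have "u + v \<le> int L + 2" using uv by linarith
    then have "real_of_int (u + v) \<le> real L + 2" by linarith
    then have "1 / (real L + 2) \<le> \<pi>" unfolding \<pi>_def using ru by (intro frac_le) auto
    then have \<pi>: "2 * \<theta> \<le> \<pi>" using \<theta> by linarith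
    have "hdist (u - 1, v) < hdist z" unfolding hdist_def z using u1 uv by auto
    then have b2: "hpot \<theta> L (u - 1, v) \<le> 1 - \<theta> ^ (D - 1)"
      unfolding D_def by (rule hpot_decreasing_step[OF \<theta>(1,2) d])
    have "(\<integral>\<^sup>+z'. ennreal (hpot \<theta> L z') \<partial>kern K z)
      = ennreal ((real_of_int u * hpot \<theta> L (u, v + 1) + real_of_int v * hpot \<theta> L (u - 1, v)) / real_of_int (u + v))"
      unfolding z by (rule nn_integral_kern_interior[OF u1 uv(2) hpot_bounds(1)[OF \<theta>(1,2)] hpot_bounds(1)[OF \<theta>(1,2)]])
    also have "\<dots> \<le> ennreal ((real_of_int u * 1 + real_of_int v * (1 - \<theta> ^ (D - 1))) / real_of_int (u + v))"
      using ru b2 hpot_bounds(2)[OF \<theta>(1,2)]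
      by (intro ennreal_leI divide_right_mono add_mono mult_left_mono) auto
    also have "(real_of_int u * 1 + real_of_int v * (1 - \<theta> ^ (D - 1))) / real_of_int (u + v) = 1 - \<theta> ^ (D - 1) * \<pi>"
      unfolding \<pi>_def using ru by (simp add: field_simps)
    also have "ennreal (1 - \<theta> ^ (D - 1) * \<pi>) \<le> ennreal (hpot \<theta> L z - \<theta> ^ L)"
      by (intro ennreal_leI key \<pi>)
    finally show ?thesis .
  qed
qed

text \<open>Close to the origin the drift of the Lyapunov function has no useful sign. Finiteness is
  enough there, since a multiple of \<open>hpot\<close> will outweigh any bounded increase.\<close>

lemma kern_integral_bounded:
  fixes f :: "int \<times> int \<Rightarrow> real"
  assumes mom: "all_moments K" and \<beta>: "\<beta> \<ge> 0" and R: "R \<ge> 1"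
    and f: "\<And>z. quad z \<Longrightarrow> 0 \<le> f z" "\<And>z. quad z \<Longrightarrow> f z \<le> 2 * sqn z powr \<beta>"
  obtains B where "B \<ge> 0" "\<And>z. quad z \<Longrightarrow> sqn z < R\<^sup>2 \<Longrightarrow> (\<integral>\<^sup>+z'. ennreal (f z') \<partial>kern K z) \<le> ennreal B"
proof -
  define m where "m = nat \<lceil>\<beta>\<rceil>"
  have m: "\<beta> \<le> real m" unfolding m_def by linarith
  define Mm where "Mm = measure_pmf.expectation K (\<lambda>k. (1 + \<bar>real_of_int k\<bar>) ^ (2 * m))"
  have im: "integrable (measure_pmf K) (\<lambda>k. (1 + \<bar>real_of_int k\<bar>) ^ (2 * m))"
    using mom unfolding all_moments_def by blast
  have M0: "Mm \<ge> 0" unfolding Mm_def by (intro integral_nonneg_AE) auto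
  define B where "B = 2 * (R + 2) ^ (2 * m) * (1 + Mm)"
  have fm: "f z \<le> 2 * y ^ (2 * m)" if "quad z" "sqn z \<le> y\<^sup>2" for z y
  proof -
    have "sqn z powr \<beta> \<le> sqn z powr real m" using sqn_ge1[OF that(1)] m by (intro powr_mono) auto
    also have "\<dots> = sqn z ^ m" using sqn_ge1[OF that(1)] by (simp add: powr_realpow)
    also have "\<dots> \<le> (y\<^sup>2) ^ m" using sqn_ge1[OF that(1)] that(2) by (intro power_mono) auto
    finally show ?thesis using f(2)[OF that(1)] by (simp add: power_mult)
  qed
  show thesis
  proof (rule that[of B])
    show "0 \<le> B" unfolding B_def using R M0 by simp
    fix z assume q: "quad z" and zR: "sqn z < R\<^sup>2"
    obtain u v where z: "z = (u, v)" by (cases z)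
    have uv: "0 \<le> u" "1 \<le> v" using q by (auto simp: z quad_def)
    have ru: "0 \<le> real_of_int u" "1 \<le> real_of_int v" using uv by auto
    have "(real_of_int u)\<^sup>2 \<le> R\<^sup>2" "(real_of_int v)\<^sup>2 \<le> R\<^sup>2"
      using zR zero_le_power2[of "real_of_int u"] zero_le_power2[of "real_of_int v"]
      unfolding sqn_def z fst_conv snd_conv by linarith+
    then have uR: "real_of_int u \<le> R" "real_of_int v \<le> R" using R by (auto intro: power2_le_imp_le)
    show "(\<integral>\<^sup>+z'. ennreal (f z') \<partial>kern K z) \<le> ennreal B"
    proof (cases "u = 0")
      case True
      have b: "f (max 1 (v - k), 1) \<le> 2 * (R + 2) ^ (2 * m) * (1 + \<bar>real_of_int k\<bar>) ^ (2 * m)" for k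
      proof -
        define w where "w = real_of_int (max 1 (v - k))"
        have w: "1 \<le> w" "w \<le> R + \<bar>real_of_int k\<bar>"
          using uR R unfolding w_def by (auto simp: max_def)
        have "w + 1 \<le> (R + 2) * (1 + \<bar>real_of_int k\<bar>)"
        proof -
          have "0 \<le> R * \<bar>real_of_int k\<bar>" using R by simp
          then show ?thesis using w by (simp add: algebra_simps)
        qed
        then have "(w + 1)\<^sup>2 \<le> ((R + 2) * (1 + \<bar>real_of_int k\<bar>))\<^sup>2" using w by (intro power_mono) auto
        moreover have "w\<^sup>2 + 1 \<le> (w + 1)\<^sup>2" using w by (simp add: power2_sum)
        ultimately have "sqn (max 1 (v - k), 1) \<le> ((R + 2) * (1 + \<bar>real_of_int k\<bar>))\<^sup>2"
          unfolding sqn_def w_def by simp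
        moreover have "quad (max 1 (v - k), 1)" by (simp add: quad_def)
        ultimately show ?thesis using fm[of "(max 1 (v - k), 1)" "(R + 2) * (1 + \<bar>real_of_int k\<bar>)"]
          by (simp add: power_mult_distrib mult.assoc)
      qed
      have "(\<integral>\<^sup>+z'. ennreal (f z') \<partial>kern K z) = (\<integral>\<^sup>+k. ennreal (f (max 1 (v - k), 1)) \<partial>K)"
        unfolding z True nn_integral_kern_axis ..
      also have "\<dots> \<le> (\<integral>\<^sup>+k. ennreal (2 * (R + 2) ^ (2 * m) * (1 + \<bar>real_of_int k\<bar>) ^ (2 * m)) \<partial>K)"
        by (intro nn_integral_mono ennreal_leI b)
      also have "\<dots> = ennreal (measure_pmf.expectation K (\<lambda>k. 2 * (R + 2) ^ (2 * m) * (1 + \<bar>real_of_int k\<bar>) ^ (2 * m)))"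
        using R im by (intro nn_integral_eq_integral) auto
      also have "\<dots> = ennreal (2 * (R + 2) ^ (2 * m) * Mm)" unfolding Mm_def by simp
      also have "\<dots> \<le> ennreal B" unfolding B_def using R by (intro ennreal_leI mult_left_mono) auto
      finally show ?thesis .
    next
      case False
      then have u1: "1 \<le> u" using uv by simp
      have q12: "quad (u, v + 1)" "quad (u - 1, v)" using uv u1 by (auto simp: quad_def)
      have "sqn (u, v + 1) \<le> (R + 2)\<^sup>2" using zR uR R unfolding sqn_def z by (simp add: power2_sum)
      then have a1: "f (u, v + 1) \<le> 2 * (R + 2) ^ (2 * m)" using fm q12 by blast
      have "sqn (u - 1, v) \<le> (R + 2)\<^sup>2" using zR uR R ru unfolding sqn_def z by (simp add: power2_sum power2_diff)
      then have a2: "f (u - 1, v) \<le> 2 * (R + 2) ^ (2 * m)" using fm q12 by blast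
      have "(\<integral>\<^sup>+z'. ennreal (f z') \<partial>kern K z)
        = ennreal ((real_of_int u * f (u, v + 1) + real_of_int v * f (u - 1, v)) / real_of_int (u + v))"
        unfolding z by (rule nn_integral_kern_interior[OF u1 uv(2) f(1)[OF q12(1)] f(1)[OF q12(2)]])
      also have "\<dots> \<le> ennreal ((real_of_int u * (2 * (R + 2) ^ (2 * m)) + real_of_int v * (2 * (R + 2) ^ (2 * m))) / real_of_int (u + v))"
        using ru a1 a2 by (intro ennreal_leI divide_right_mono add_mono mult_left_mono) auto
      also have "\<dots> = ennreal (2 * (R + 2) ^ (2 * m))"
        using ru by (simp add: distrib_right[symmetric])
      also have "\<dots> \<le> ennreal B" unfolding B_def using R M0 by (intro ennreal_leI) (simp add: mult_le_cancel_left1)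
      finally show ?thesis .
    qed
  qed
qed

text \<open>The state \<open>(0, 1)\<close> is exempt from the drift condition because
  \<open>hpot\<close> has its minimum 0 there. The function \<open>f\<close> is taken with value 0
  on the small ball, so in that ball the lower bound on \<open>G\<close> comes from
  \<open>hpot\<close> alone.\<close>

lemma global_lyapunov:
  fixes \<beta> :: real
  assumes mom: "all_moments K" and \<beta>: "\<beta> > 0" and sgn: "1 + 2 * \<beta> < 3 * noise_mean K"
  obtains G \<epsilon> c C where "\<epsilon> > 0" "c > 0" "C > 0" "\<And>z. quad z \<Longrightarrow> 0 \<le> G z"
    "\<And>z. quad z \<Longrightarrow> z \<noteq> (0, 1) \<Longrightarrow> c * sqn z powr \<beta> \<le> G z"
    "\<And>z. quad z \<Longrightarrow> G z \<le> C * sqn z powr \<beta>"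
    "\<And>z. quad z \<Longrightarrow> z \<noteq> (0, 1) \<Longrightarrow> \<epsilon> * sqn z powr (\<beta> - 1) \<le> G z \<and>
       (\<integral>\<^sup>+z'. ennreal (G z') \<partial>kern K z) \<le> ennreal (G z - \<epsilon> * sqn z powr (\<beta> - 1))"
proof (rule lyap_kern_drift[OF mom _ order_refl zero_le_one])
  show "\<beta> * (1 + 2 * \<beta> - 3 * noise_mean K) < 0" using \<beta> sgn by (intro mult_pos_neg) auto
next
  fix f \<rho> R \<epsilon>
  assume \<epsilon>: "\<epsilon> > 0" and \<rho>: "1 \<le> \<rho>" "\<rho> < R"
    and f0: "\<And>z. quad z \<Longrightarrow> 0 \<le> f z"
    and fc: "\<And>z. quad z \<Longrightarrow> sqn z < \<rho>\<^sup>2 \<Longrightarrow> f z = 0"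
    and fl: "\<And>z. quad z \<Longrightarrow> \<rho>\<^sup>2 \<le> sqn z \<Longrightarrow> sqn z powr \<beta> / 2 \<le> f z"
    and fu: "\<And>z. quad z \<Longrightarrow> \<rho>\<^sup>2 \<le> sqn z \<Longrightarrow> f z \<le> 2 * sqn z powr \<beta>"
    and fd: "\<And>z. quad z \<Longrightarrow> R\<^sup>2 \<le> sqn z \<Longrightarrow> \<epsilon> * sqn z powr (\<beta> - 1) \<le> f z \<and>
       (\<integral>\<^sup>+z'. ennreal (f z') \<partial>kern K z) \<le> ennreal (f z - \<epsilon> * sqn z powr (\<beta> - 1))"
  have fu': "f z \<le> 2 * sqn z powr \<beta>" if "quad z" for z
    using fc[OF that] fu[OF that] by (cases "sqn z < \<rho>\<^sup>2") auto
  have R1: "R \<ge> 1" using \<rho> by simp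
  obtain B where B: "B \<ge> 0" "\<And>z. quad z \<Longrightarrow> sqn z < R\<^sup>2 \<Longrightarrow> (\<integral>\<^sup>+z'. ennreal (f z') \<partial>kern K z) \<le> ennreal B"
    using kern_integral_bounded[OF mom less_imp_le[OF \<beta>] R1 f0 fu'] by blast
  define L where "L = nat \<lceil>3 * R\<rceil>"
  have dL: "hdist z \<le> L" if "quad z" "sqn z < R\<^sup>2" for z
  proof -
    have "(real_of_int (fst z))\<^sup>2 \<le> R\<^sup>2" "(real_of_int (snd z))\<^sup>2 \<le> R\<^sup>2"
      using that(2) zero_le_power2[of "real_of_int (fst z)"] zero_le_power2[of "real_of_int (snd z)"]
      unfolding sqn_def by linarith+
    then have "real_of_int (fst z) \<le> R" "real_of_int (snd z) \<le> R" using R1 by (auto intro: power2_le_imp_le)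
    then have "real_of_int (fst z + 2 * snd z - 2) \<le> 3 * R" by simp
    then have "fst z + 2 * snd z - 2 \<le> \<lceil>3 * R\<rceil>" by linarith
    then show ?thesis unfolding hdist_def L_def by (intro nat_mono)
  qed
  define P where "P = measure_pmf.prob K {1..}"
  have P: "P > 0"
  proof (rule ccontr)
    assume "\<not> P > 0"
    then have "P = 0" unfolding P_def by (simp add: not_less measure_le_0_iff)
    then have "AE k in K. k \<notin> {1..}" unfolding P_def
      by (subst (asm) measure_pmf.prob_eq_0) auto
    then have "AE k in K. real_of_int k \<le> 0" by eventually_elim auto
    then have "noise_mean K \<le> measure_pmf.expectation K (\<lambda>_. 0)"
      unfolding noise_mean_def using all_moments_integrable[OF mom] by (intro integral_mono_AE) auto
    then show False using sgn \<beta> by simp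
  qed
  define \<theta> where "\<theta> = min (1 / (real L + 2)) P / 2"
  have P1: "P \<le> 1" unfolding P_def by simp
  have \<theta>: "0 < \<theta>" "\<theta> < 1" "2 * \<theta> \<le> 1 / (real L + 2)" "2 * \<theta> \<le> P"
    using P P1 unfolding \<theta>_def by (auto simp: min_def)
  define \<phi> where "\<phi> = hpot \<theta> L"
  have \<phi>: "0 \<le> \<phi> z" "\<phi> z \<le> 1" for z unfolding \<phi>_def using hpot_bounds[OF \<theta>(1,2)] by auto
  \<comment> \<open>Solves \<open>Q * \<theta> ^ L = B + \<epsilon> * (R^2) powr \<beta>\<close>:
    the gain of \<open>hpot\<close> must pay both for the possible increase \<open>B\<close> of
    \<open>f\<close> and for the drift to be shown.\<close>
  define Q where "Q = (B + \<epsilon> * (R\<^sup>2) powr \<beta>) / \<theta> ^ L"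
  have Q: "Q > 0" unfolding Q_def using B \<epsilon> R1 \<theta> by (intro divide_pos_pos add_nonneg_pos mult_pos_pos) auto
  define G where "G = (\<lambda>z. f z + Q * \<phi> z)"
  have IG: "(\<integral>\<^sup>+z'. ennreal (G z') \<partial>kern K z)
    = (\<integral>\<^sup>+z'. ennreal (f z') \<partial>kern K z) + ennreal Q * (\<integral>\<^sup>+z'. ennreal (\<phi> z') \<partial>kern K z)" if "quad z" for z
  proof -
    have "(\<integral>\<^sup>+z'. ennreal (G z') \<partial>kern K z) = (\<integral>\<^sup>+z'. ennreal (f z') + ennreal Q * ennreal (\<phi> z') \<partial>kern K z)"
      using quad_kern[OF that] f0 \<phi> Q unfolding G_def
      by (intro nn_integral_cong_AE) (auto simp: AE_measure_pmf_iff ennreal_plus ennreal_mult)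
    then show ?thesis by (simp add: nn_integral_add nn_integral_cmult)
  qed
  \<comment> \<open>Outside the ball of radius \<open>\<rho>\<close> the function \<open>f\<close>
    gives \<open>1 / 2\<close>; inside it \<open>f\<close> vanishes and
    \<open>\<phi> z \<ge> 1 - \<theta>\<close> supplies the bound.\<close>
  define c where "c = min (1 / 2) (Q * (1 - \<theta>) / (\<rho>\<^sup>2) powr \<beta>)"
  show thesis
  proof (rule that[of \<epsilon> c "2 + Q" G])
    show "0 < \<epsilon>" by (rule \<epsilon>)
    show "0 < c" unfolding c_def using Q \<theta> \<rho> by simp
    show "0 < 2 + Q" using Q by simp
    fix z assume q: "quad z"
    have s1: "sqn z \<ge> 1" by (rule sqn_ge1[OF q])
    show "0 \<le> G z" unfolding G_def using f0[OF q] \<phi> Q by simp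
    show "G z \<le> (2 + Q) * sqn z powr \<beta>"
    proof -
      have "Q * \<phi> z \<le> Q * sqn z powr \<beta>"
        using Q \<phi>(2)[of z] ge_one_powr_ge_zero[OF s1, of \<beta>] \<beta> by (intro mult_left_mono) auto
      then show ?thesis unfolding G_def using fu'[OF q] by (simp add: algebra_simps)
    qed
    assume nt: "z \<noteq> (0, 1)"
    show "c * sqn z powr \<beta> \<le> G z"
    proof (cases "sqn z < \<rho>\<^sup>2")
      case False
      have "c * sqn z powr \<beta> \<le> 1 / 2 * sqn z powr \<beta>"
        unfolding c_def by (intro mult_right_mono min.cobounded1) auto
      also have "\<dots> \<le> f z" using fl[OF q] False by simp
      also have "\<dots> \<le> G z" unfolding G_def using \<phi> Q by simp
      finally show ?thesis .
    next
      case True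
      have d1: "1 \<le> hdist z" using q nt by (cases z) (auto simp: hdist_def quad_def)
      have "\<rho>\<^sup>2 \<le> R\<^sup>2" using \<rho> by (intro power_mono) auto
      then have "sqn z < R\<^sup>2" using True by linarith
      then have "\<phi> z = 1 - \<theta> ^ hdist z" unfolding \<phi>_def hpot_def using dL[OF q] by simp
      moreover have "\<theta> ^ hdist z \<le> \<theta> ^ 1" using d1 \<theta> by (intro power_decreasing) auto
      ultimately have p: "1 - \<theta> \<le> \<phi> z" by simp
      have "c * sqn z powr \<beta> \<le> Q * (1 - \<theta>) / (\<rho>\<^sup>2) powr \<beta> * (\<rho>\<^sup>2) powr \<beta>"
        using True s1 \<beta> Q \<theta> unfolding c_def by (intro mult_mono powr_mono2 min.cobounded2) auto
      also have "\<dots> = Q * (1 - \<theta>)" using \<rho> by simp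
      also have "\<dots> \<le> Q * \<phi> z" using p Q by (intro mult_left_mono) auto
      also have "\<dots> \<le> G z" unfolding G_def using f0[OF q] by simp
      finally show ?thesis .
    qed
    have Lo: "\<theta> ^ L \<le> \<phi> z \<and> (\<integral>\<^sup>+z'. ennreal (\<phi> z') \<partial>kern K z) \<le> ennreal (\<phi> z - \<theta> ^ L)" if "hdist z \<le> L"
      using hpot_drift[OF q nt that \<theta>[unfolded P_def]] unfolding \<phi>_def by blast
    have I\<phi>: "(\<integral>\<^sup>+z'. ennreal (\<phi> z') \<partial>kern K z) \<le> ennreal (\<phi> z)"
    proof (cases "hdist z \<le> L")
      case True
      have "\<phi> z - \<theta> ^ L \<le> \<phi> z" using \<theta> by simp
      then show ?thesis using Lo[OF True] ennreal_leI order_trans by blast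
    next
      case False
      have "(\<integral>\<^sup>+z'. ennreal (\<phi> z') \<partial>kern K z) \<le> (\<integral>\<^sup>+z'. 1 \<partial>kern K z)"
        using \<phi> by (intro nn_integral_mono) auto
      then show ?thesis using False unfolding \<phi>_def hpot_def by simp
    qed
    show "\<epsilon> * sqn z powr (\<beta> - 1) \<le> G z \<and>
       (\<integral>\<^sup>+z'. ennreal (G z') \<partial>kern K z) \<le> ennreal (G z - \<epsilon> * sqn z powr (\<beta> - 1))"
    proof (cases "sqn z < R\<^sup>2")
      case False
      then have f: "\<epsilon> * sqn z powr (\<beta> - 1) \<le> f z"
        "(\<integral>\<^sup>+z'. ennreal (f z') \<partial>kern K z) \<le> ennreal (f z - \<epsilon> * sqn z powr (\<beta> - 1))" using fd[OF q] by auto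
      have "(\<integral>\<^sup>+z'. ennreal (G z') \<partial>kern K z) \<le> ennreal (f z - \<epsilon> * sqn z powr (\<beta> - 1)) + ennreal Q * ennreal (\<phi> z)"
        unfolding IG[OF q] by (intro add_mono f mult_left_mono I\<phi>) auto
      also have "\<dots> = ennreal (G z - \<epsilon> * sqn z powr (\<beta> - 1))"
        using f Q \<phi> unfolding G_def by (simp add: ennreal_mult[symmetric] ennreal_plus[symmetric] algebra_simps del: ennreal_plus)
      finally have I: "(\<integral>\<^sup>+z'. ennreal (G z') \<partial>kern K z) \<le> ennreal (G z - \<epsilon> * sqn z powr (\<beta> - 1))" .
      have "0 \<le> Q * \<phi> z" using Q \<phi>[of z] by simp
      then have "\<epsilon> * sqn z powr (\<beta> - 1) \<le> G z" using f(1) unfolding G_def by linarith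
      then show ?thesis using I by blast
    next
      case True
      have l: "\<theta> ^ L \<le> \<phi> z" "(\<integral>\<^sup>+z'. ennreal (\<phi> z') \<partial>kern K z) \<le> ennreal (\<phi> z - \<theta> ^ L)"
        using Lo[OF dL[OF q True]] by auto
      have e: "\<epsilon> * sqn z powr (\<beta> - 1) \<le> \<epsilon> * (R\<^sup>2) powr \<beta>"
      proof -
        have "sqn z powr (\<beta> - 1) \<le> sqn z powr \<beta>" using s1 by (intro powr_mono) auto
        also have "\<dots> \<le> (R\<^sup>2) powr \<beta>" using s1 True \<beta> by (intro powr_mono2) auto
        finally show ?thesis using \<epsilon> by (intro mult_left_mono) auto
      qed
      have Q\<theta>: "Q * \<theta> ^ L = B + \<epsilon> * (R\<^sup>2) powr \<beta>" unfolding Q_def using \<theta> by simp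
      have Q\<phi>: "Q * \<theta> ^ L \<le> Q * \<phi> z" using Q l by (intro mult_left_mono) auto
      have "(\<integral>\<^sup>+z'. ennreal (G z') \<partial>kern K z) \<le> ennreal B + ennreal Q * ennreal (\<phi> z - \<theta> ^ L)"
        unfolding IG[OF q] by (intro add_mono B(2)[OF q True] mult_left_mono l) auto
      also have "\<dots> = ennreal (B + Q * (\<phi> z - \<theta> ^ L))"
        using B Q l by (simp add: ennreal_mult ennreal_plus)
      also have "\<dots> \<le> ennreal (G z - \<epsilon> * sqn z powr (\<beta> - 1))"
        using e Q\<theta> f0[OF q] unfolding G_def right_diff_distrib by (intro ennreal_leI) linarith
      finally have I: "(\<integral>\<^sup>+z'. ennreal (G z') \<partial>kern K z) \<le> ennreal (G z - \<epsilon> * sqn z powr (\<beta> - 1))" .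
      have "\<epsilon> * sqn z powr (\<beta> - 1) \<le> G z" using e Q\<theta> Q\<phi> f0[OF q] B(1) unfolding G_def by linarith
      then show ?thesis using I by blast
    qed
  qed
qed

subsection \<open>Supermartingales dominating powers of the area\<close>

text \<open>Young's inequality for \<open>x\<close> and \<open>g\<close> with weights
  \<open>\<sigma>\<close> and \<open>1 - \<sigma>\<close>, divided by
  \<open>g powr (1 - \<sigma>)\<close>.\<close>

lemma powr_le_tangent:
  fixes x g :: real
  assumes "0 \<le> x" "0 < g" "0 \<le> \<sigma>" "\<sigma> \<le> 1"
  shows "x powr \<sigma> \<le> (1 - \<sigma>) * g powr \<sigma> + \<sigma> * g powr (\<sigma> - 1) * x"
proof (cases "x = 0")
  case False
  then have x: "x > 0" using assms by simp
  have "x powr \<sigma> * g powr (1 - \<sigma>) \<le> \<sigma> * x + (1 - \<sigma>) * g"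
    using assms x by (intro Youngs_inequality_0) auto
  then have "x powr \<sigma> * g powr (1 - \<sigma>) * g powr (\<sigma> - 1) \<le> (\<sigma> * x + (1 - \<sigma>) * g) * g powr (\<sigma> - 1)"
    by (intro mult_right_mono) auto
  moreover have "g powr (1 - \<sigma>) * g powr (\<sigma> - 1) = 1" using assms by (simp flip: powr_add)
  moreover have "g * g powr (\<sigma> - 1) = g powr \<sigma>" using assms by (simp add: powr_diff)
  ultimately show ?thesis by (simp add: algebra_simps)
qed (use assms in auto)

text \<open>Convexity of \<open>x powr q\<close> for
  \<open>a + y = (1 - t) * (a + m) + t * (y / t)\<close> with \<open>t = m / (a + m)\<close>. The
  bound is affine in \<open>y powr q\<close>, hence can be integrated, and is an equality at
  \<open>y = m\<close>.\<close>

lemma powr_add_le_chord: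
  fixes a m y q :: real
  assumes a: "0 \<le> a" and m: "0 < m" and y: "0 \<le> y" and q: "1 \<le> q"
  shows "(a + y) powr q \<le> a / (a + m) * (a + m) powr q + m / (a + m) * ((a + m) / m) powr q * y powr q"
proof -
  define t where "t = m / (a + m)"
  have t: "0 < t" "t \<le> 1" "1 - t = a / (a + m)" unfolding t_def using a m by (auto simp: field_simps)
  show ?thesis
  proof (cases "y = 0")
    case True
    have "(a / (a + m)) powr q \<le> (a / (a + m)) powr 1"
      using a m q by (intro powr_mono') auto
    then have "(a / (a + m)) powr q * (a + m) powr q \<le> a / (a + m) * (a + m) powr q"
      using a m by (intro mult_right_mono) auto
    moreover have "(a / (a + m)) powr q * (a + m) powr q = a powr q"
      using a m by (simp flip: powr_mult)
    ultimately show ?thesis using True by simp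
  next
    case False
    then have y: "y > 0" using y by simp
    have yt: "t * (y / t) = y" using t by simp
    have at: "(1 - t) * (a + m) = a" unfolding t(3) using a m by simp
    have "((1 - t) *\<^sub>R (a + m) + t *\<^sub>R (y / t)) powr q \<le> (1 - t) * (a + m) powr q + t * (y / t) powr q"
      using t y a m by (intro convex_onD[OF powr_convex[OF q]]) auto
    then have "(a + y) powr q \<le> (1 - t) * (a + m) powr q + t * (y / t) powr q"
      unfolding real_scaleR_def yt at .
    moreover have "(y / t) powr q = ((a + m) / m) powr q * y powr q"
      unfolding t_def using a m y by (simp add: mult.commute flip: powr_mult)
    ultimately show ?thesis unfolding t(3) by (simp add: t_def mult.assoc)
  qed
qed

text \<open>Minkowski's inequality for the constant \<open>a\<close> and the function
  \<open>F powr (1 / q)\<close>, obtained by integrating the chord bound at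
  \<open>m\<close>.\<close>

lemma nn_integral_powr_Minkowski:
  fixes P :: "'b pmf" and F :: "'b \<Rightarrow> real"
  assumes F: "\<And>x. x \<in> set_pmf P \<Longrightarrow> 0 \<le> F x" and a: "0 \<le> a" and m: "0 < m" and q: "1 \<le> q"
    and I: "(\<integral>\<^sup>+x. ennreal (F x) \<partial>P) \<le> ennreal (m powr q)"
  shows "(\<integral>\<^sup>+x. ennreal ((a + F x powr (1 / q)) powr q) \<partial>P) \<le> ennreal ((a + m) powr q)"
proof -
  define c0 where "c0 = a / (a + m) * (a + m) powr q"
  define c1 where "c1 = m / (a + m) * ((a + m) / m) powr q"
  have c: "0 \<le> c0" "0 \<le> c1" unfolding c0_def c1_def using a m by auto
  have "(\<integral>\<^sup>+x. ennreal ((a + F x powr (1 / q)) powr q) \<partial>P) \<le> (\<integral>\<^sup>+x. ennreal c0 + ennreal c1 * ennreal (F x) \<partial>P)"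
  proof (rule nn_integral_mono_AE, unfold AE_measure_pmf_iff, intro ballI)
    fix x assume x: "x \<in> set_pmf P"
    have "(F x powr (1 / q)) powr q = F x" using F[OF x] q by (simp add: powr_powr)
    then have "(a + F x powr (1 / q)) powr q \<le> c0 + c1 * F x"
      using powr_add_le_chord[OF a m _ q, of "F x powr (1 / q)"] unfolding c0_def c1_def by simp
    then show "ennreal ((a + F x powr (1 / q)) powr q) \<le> ennreal c0 + ennreal c1 * ennreal (F x)"
      using F[OF x] c by (simp add: ennreal_mult[symmetric] ennreal_plus[symmetric] ennreal_leI del: ennreal_plus)
  qed
  also have "\<dots> = ennreal c0 + ennreal c1 * (\<integral>\<^sup>+x. ennreal (F x) \<partial>P)"
    by (simp add: nn_integral_add nn_integral_cmult)
  also have "\<dots> \<le> ennreal c0 + ennreal c1 * ennreal (m powr q)"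
    by (intro add_left_mono mult_left_mono I) auto
  also have "\<dots> = ennreal (c0 + c1 * m powr q)" using c by (simp add: ennreal_mult ennreal_plus)
  also have "c0 + c1 * m powr q = (a + m) powr q"
  proof -
    have "((a + m) / m) powr q * m powr q = (a + m) powr q" using a m by (simp flip: powr_mult)
    then have "c0 + c1 * m powr q = (a / (a + m) + m / (a + m)) * (a + m) powr q"
      unfolding c0_def c1_def by (simp add: algebra_simps)
    also have "a / (a + m) + m / (a + m) = 1" using a m by (simp flip: add_divide_distrib)
    finally show ?thesis by simp
  qed
  finally show ?thesis .
qed

lemma coord_sum_le: "quad z \<Longrightarrow> real_of_int (fst z + snd z) \<le> 2 * sqrt (sqn z)"
proof -
  assume "quad z"
  then have "0 \<le> real_of_int (fst z)" "0 \<le> real_of_int (snd z)" by (auto simp: quad_def)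
  moreover have "real_of_int (fst z) \<le> sqrt (sqn z)" "real_of_int (snd z) \<le> sqrt (sqn z)"
    unfolding sqn_def by (auto intro!: real_le_rsqrt)
  ultimately show ?thesis by simp
qed

text \<open>
  The current state contributes \<open>\<delta> * (u + v)\<close> to the rescaled area \<open>a\<close>. If \<open>G\<close> is of order
  \<open>r powr (3 * q)\<close> and has drift \<open>- \<epsilon> * r powr (3 * q - 2)\<close>, then by Minkowski's inequality
  \<open>(a + G powr (1 / q)) powr q\<close> is a supermartingale when \<open>q \<ge> 1\<close>.
\<close>

lemma moment_potential_ge1:
  fixes q :: real
  assumes mom: "all_moments K" and q: "1 \<le> q" and sgn: "1 + 3 * q < 3 * noise_mean K"
  obtains V \<delta> where "\<delta> > 0" "\<And>a z. 0 \<le> a \<Longrightarrow> quad z \<Longrightarrow> a powr q \<le> V a z"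
    "\<And>a z. 0 \<le> a \<Longrightarrow> quad z \<Longrightarrow> z \<noteq> (0, 1) \<Longrightarrow>
      (\<integral>\<^sup>+z'. ennreal (V (a + \<delta> * real_of_int (fst z + snd z)) z') \<partial>kern K z) \<le> ennreal (V a z)"
proof (rule global_lyapunov[OF mom, of "3 * q / 2"])
  show "0 < 3 * q / 2" using q by simp
  show "1 + 2 * (3 * q / 2) < 3 * noise_mean K" using sgn by simp
next
  define \<beta> where "\<beta> = 3 * q / 2"
  fix G \<epsilon> c C
  assume \<epsilon>: "(\<epsilon>::real) > 0" and c: "(c::real) > 0" and C: "(C::real) > 0" and G0: "\<And>z. quad z \<Longrightarrow> 0 \<le> G z"
    and Gl: "\<And>z. quad z \<Longrightarrow> z \<noteq> (0, 1) \<Longrightarrow> c * sqn z powr (3 * q / 2) \<le> G z"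
    and Gu: "\<And>z. quad z \<Longrightarrow> G z \<le> C * sqn z powr (3 * q / 2)"
    and Gd: "\<And>z. quad z \<Longrightarrow> z \<noteq> (0, 1) \<Longrightarrow> \<epsilon> * sqn z powr (3 * q / 2 - 1) \<le> G z \<and>
       (\<integral>\<^sup>+z'. ennreal (G z') \<partial>kern K z) \<le> ennreal (G z - \<epsilon> * sqn z powr (3 * q / 2 - 1))"
  \<comment> \<open>By the tangent of \<open>x powr (1 / q)\<close> at \<open>G z\<close>, losing
    \<open>e\<close> lowers \<open>G powr (1 / q)\<close> by at least
    \<open>e / q * G z powr (1 / q - 1)\<close>. With \<open>G \<le> C * s powr \<beta>\<close> this
    is at least a multiple of \<open>sqrt s\<close>, and \<open>u + v \<le> 2 * sqrt s\<close> then
    determines \<open>\<delta>\<close>.\<close>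
  define \<delta> where "\<delta> = \<epsilon> * C powr (1 / q - 1) / (4 * q)"
  define V where "V = (\<lambda>a z. (a + G z powr (1 / q)) powr q)"
  show thesis
  proof (rule that[of \<delta> V])
    show "\<delta> > 0" unfolding \<delta>_def using \<epsilon> C q by simp
    fix a :: real and z assume a: "0 \<le> a" and qz: "quad z"
    show "a powr q \<le> V a z" unfolding V_def using a q by (intro powr_mono2) auto
    assume nt: "z \<noteq> (0, 1)"
    define s where "s = sqn z"
    have s1: "s \<ge> 1" unfolding s_def by (rule sqn_ge1[OF qz])
    have Gp: "G z > 0"
    proof -
      have "0 < c * s powr \<beta>" using c s1 by simp
      also have "\<dots> \<le> G z" using Gl[OF qz nt] by (simp add: s_def \<beta>_def)
      finally show ?thesis .
    qed
    \<comment> \<open>Only half of the drift is spent, so that \<open>G z - e\<close> and with it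
      \<open>m\<close> stay positive.\<close>
    define e where "e = \<epsilon> * s powr (\<beta> - 1) / 2"
    have e0: "e > 0" unfolding e_def using \<epsilon> s1 by simp
    have eG: "2 * e \<le> G z" "(\<integral>\<^sup>+z'. ennreal (G z') \<partial>kern K z) \<le> ennreal (G z - 2 * e)"
      using Gd[OF qz nt] by (auto simp: e_def s_def \<beta>_def)
    define m where "m = (G z - e) powr (1 / q)"
    have Ge: "G z - e > 0" using eG e0 by linarith
    have m: "m > 0" "m powr q = G z - e" unfolding m_def using Ge q by (auto simp: powr_powr)
    define \<rho> where "\<rho> = real_of_int (fst z + snd z)"
    have \<rho>: "0 \<le> \<rho>" "\<rho> \<le> 2 * sqrt s" using coord_sum_le[OF qz] qz unfolding \<rho>_def s_def by (auto simp: quad_def)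
    have gap: "\<delta> * \<rho> + m \<le> G z powr (1 / q)"
    proof -
      have "m \<le> (1 - 1 / q) * G z powr (1 / q) + 1 / q * G z powr (1 / q - 1) * (G z - e)"
        unfolding m_def using Ge Gp q by (intro powr_le_tangent) auto
      also have "\<dots> = G z powr (1 / q) - e * G z powr (1 / q - 1) / q"
      proof -
        have "G z powr (1 / q - 1) * G z = G z powr (1 / q)" using Gp by (simp add: powr_diff)
        then show ?thesis using q by (simp add: algebra_simps diff_divide_distrib)
      qed
      finally have m1: "m \<le> G z powr (1 / q) - e * G z powr (1 / q - 1) / q" .
      have "(C * s powr \<beta>) powr (1 / q - 1) \<le> G z powr (1 / q - 1)"
        using Gu[OF qz] Gp q by (intro powr_mono2') (auto simp: s_def \<beta>_def)
      moreover have "(C * s powr \<beta>) powr (1 / q - 1) = C powr (1 / q - 1) * s powr (3 / 2 - \<beta>)"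
      proof -
        have "\<beta> * (1 / q - 1) = 3 / 2 - \<beta>" unfolding \<beta>_def using q by (simp add: field_simps)
        then show ?thesis using C s1 by (subst powr_mult) (auto simp: powr_powr)
      qed
      ultimately have "e / q * (C powr (1 / q - 1) * s powr (3 / 2 - \<beta>)) \<le> e / q * G z powr (1 / q - 1)"
        using e0 q by (intro mult_left_mono) auto
      moreover have "e / q * (C powr (1 / q - 1) * s powr (3 / 2 - \<beta>)) = \<delta> * (2 * sqrt s)"
      proof -
        have "s powr (\<beta> - 1) * s powr (3 / 2 - \<beta>) = sqrt s"
          using s1 by (simp add: powr_add[symmetric] powr_half_sqrt)
        then have "\<delta> * (2 * sqrt s) = \<epsilon> * C powr (1 / q - 1) / (4 * q) * (2 * (s powr (\<beta> - 1) * s powr (3 / 2 - \<beta>)))"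
          unfolding \<delta>_def by simp
        also have "\<dots> = e / q * (C powr (1 / q - 1) * s powr (3 / 2 - \<beta>))"
          unfolding e_def using q by (simp add: field_simps)
        finally show ?thesis by simp
      qed
      moreover have "\<delta> * \<rho> \<le> \<delta> * (2 * sqrt s)" using \<rho> \<open>\<delta> > 0\<close> by (intro mult_left_mono) auto
      ultimately show ?thesis using m1 by simp
    qed
    have "(\<integral>\<^sup>+z'. ennreal (G z') \<partial>kern K z) \<le> ennreal (m powr q)"
      using eG(2) e0 unfolding m(2) by (elim order_trans) (intro ennreal_leI, simp)
    then have "(\<integral>\<^sup>+z'. ennreal ((a + \<delta> * \<rho> + G z' powr (1 / q)) powr q) \<partial>kern K z) \<le> ennreal ((a + \<delta> * \<rho> + m) powr q)"
      using quad_kern[OF qz] G0 a \<rho> \<open>\<delta> > 0\<close> m(1) q by (intro nn_integral_powr_Minkowski) auto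
    also have "\<dots> \<le> ennreal (V a z)"
      unfolding V_def using gap a \<rho> \<open>\<delta> > 0\<close> m(1) q by (intro ennreal_leI powr_mono2) auto
    finally show "(\<integral>\<^sup>+z'. ennreal (V (a + \<delta> * real_of_int (fst z + snd z)) z') \<partial>kern K z) \<le> ennreal (V a z)"
      unfolding V_def \<rho>_def .
  qed
qed

text \<open>
  For \<open>q < 1\<close> the previous potential is convex in \<open>G\<close> and useless. With \<open>\<sigma> = p / q\<close> the replacement
  \<open>tangent_val \<sigma> (max (a powr q) G) G\<close> is the infimum over \<open>g \<ge> a powr q\<close> of the tangents at \<open>g\<close>
  to \<open>x powr \<sigma>\<close>, hence concave in \<open>G\<close>, and it dominates \<open>(1 - \<sigma>) * a powr p\<close>.
\<close>

definition tangent_val :: "real \<Rightarrow> real \<Rightarrow> real \<Rightarrow> real" where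
  "tangent_val \<sigma> g x = (1 - \<sigma>) * g powr \<sigma> + \<sigma> * g powr (\<sigma> - 1) * x"

text \<open>At \<open>g0\<close> the tangent touching at \<open>g\<close> lies above the curve, and
  it is flatter than the tangent at \<open>g0\<close>. Going left from \<open>g0\<close> to
  \<open>x\<close> it therefore stays above the latter.\<close>

lemma tangent_val_mono:
  assumes "0 < \<sigma>" "\<sigma> < 1" "0 \<le> x" "x \<le> g0" "0 < g0" "g0 \<le> g"
  shows "tangent_val \<sigma> g0 x \<le> tangent_val \<sigma> g x"
proof -
  have p: "g powr (\<sigma> - 1) \<le> g0 powr (\<sigma> - 1)" using assms by (intro powr_mono2') auto
  have "\<sigma> * x * (g0 powr (\<sigma> - 1) - g powr (\<sigma> - 1)) \<le> \<sigma> * g0 * (g0 powr (\<sigma> - 1) - g powr (\<sigma> - 1))"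
    using assms p by (intro mult_right_mono mult_left_mono) auto
  also have "\<dots> = \<sigma> * g0 powr \<sigma> - \<sigma> * g powr (\<sigma> - 1) * g0"
  proof -
    have "g0 * g0 powr (\<sigma> - 1) = g0 powr \<sigma>" using assms by (simp add: powr_diff)
    then show ?thesis by (simp add: algebra_simps)
  qed
  also have "\<dots> \<le> (1 - \<sigma>) * (g powr \<sigma> - g0 powr \<sigma>)"
    using powr_le_tangent[of g0 g \<sigma>] assms by (simp add: algebra_simps)
  finally show ?thesis unfolding tangent_val_def by (simp add: algebra_simps)
qed

text \<open>Among the touching points \<open>g \<ge> h\<close> the smallest value at
  \<open>x\<close> is attained at \<open>x\<close> itself if \<open>x \<ge> h\<close>, and otherwise
  at \<open>h\<close>, the admissible point closest to \<open>x\<close>. For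
  \<open>h = x = 0\<close> the left side is 0, since \<open>powr\<close> has value 0 at base
  0.\<close>

lemma tangent_val_max_le:
  assumes "0 < \<sigma>" "\<sigma> < 1" "0 \<le> x" "0 \<le> h" "h \<le> g" "0 < g"
  shows "tangent_val \<sigma> (max h x) x \<le> tangent_val \<sigma> g x"
proof (cases "x \<le> h")
  case True
  show ?thesis
  proof (cases "h = 0")
    case True
    then show ?thesis using \<open>x \<le> h\<close> assms by (simp add: tangent_val_def)
  next
    case False
    then show ?thesis using tangent_val_mono[of \<sigma> x h g] assms True by (simp add: max_def)
  qed
next
  case False
  then have x: "x > 0" using assms by simp
  have "x powr (\<sigma> - 1) * x = x powr \<sigma>" using x by (simp add: powr_diff)
  then have "tangent_val \<sigma> x x = x powr \<sigma>" unfolding tangent_val_def by (simp add: algebra_simps)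
  also have "\<dots> \<le> tangent_val \<sigma> g x" unfolding tangent_val_def using assms by (intro powr_le_tangent) auto
  finally show ?thesis using False by (simp add: max_def)
qed

text \<open>\<open>V a'\<close> lies below the tangent touching at \<open>g'\<close>, which is
  affine in \<open>G\<close>, so the expectation passes through it. Adding the swept area raises the
  touching point by at most \<open>e / 2\<close>, and the loss \<open>e\<close> in the argument,
  weighted with the slope, pays for this.\<close>

lemma moment_potential_lt1:
  fixes p q :: real
  assumes mom: "all_moments K" and p: "0 < p" and q: "p < q" "q < 1" and sgn: "1 + 3 * q < 3 * noise_mean K"
  obtains V \<delta> c0 where "\<delta> > 0" "c0 > 0" "\<And>a z. 0 \<le> a \<Longrightarrow> quad z \<Longrightarrow> c0 * a powr p \<le> V a z"
    "\<And>a z. 0 \<le> a \<Longrightarrow> quad z \<Longrightarrow> z \<noteq> (0, 1) \<Longrightarrow>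
      (\<integral>\<^sup>+z'. ennreal (V (a + \<delta> * real_of_int (fst z + snd z)) z') \<partial>kern K z) \<le> ennreal (V a z)"
proof (rule global_lyapunov[OF mom, of "3 * q / 2"])
  show "0 < 3 * q / 2" using p q by simp
  show "1 + 2 * (3 * q / 2) < 3 * noise_mean K" using sgn by simp
next
  define \<beta> where "\<beta> = 3 * q / 2"
  fix G \<epsilon> c C
  assume \<epsilon>: "(\<epsilon>::real) > 0" and c: "(c::real) > 0" and C: "(C::real) > 0" and G0: "\<And>z. quad z \<Longrightarrow> 0 \<le> G z"
    and Gl: "\<And>z. quad z \<Longrightarrow> z \<noteq> (0, 1) \<Longrightarrow> c * sqn z powr (3 * q / 2) \<le> G z"
    and Gu: "\<And>z. quad z \<Longrightarrow> G z \<le> C * sqn z powr (3 * q / 2)"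
    and Gd: "\<And>z. quad z \<Longrightarrow> z \<noteq> (0, 1) \<Longrightarrow> \<epsilon> * sqn z powr (3 * q / 2 - 1) \<le> G z \<and>
       (\<integral>\<^sup>+z'. ennreal (G z') \<partial>kern K z) \<le> ennreal (G z - \<epsilon> * sqn z powr (3 * q / 2 - 1))"
  define \<sigma> where "\<sigma> = p / q"
  have \<sigma>: "0 < \<sigma>" "\<sigma> < 1" "q * \<sigma> = p" using p q by (auto simp: \<sigma>_def)
  have q0: "q > 0" using p q by simp
  \<comment> \<open>Makes the bound on \<open>g' - g\<close> below come out as \<open>e / 2\<close>.
    In contrast to \<open>q \<ge> 1\<close>, the lower bound on \<open>G\<close> enters, because
    \<open>1 - 1 / q\<close> is negative.\<close>
  define \<delta> where "\<delta> = \<epsilon> / (4 * c powr (1 - 1 / q))"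
  have \<delta>: "\<delta> > 0" unfolding \<delta>_def using \<epsilon> c by simp
  define V where "V = (\<lambda>a z. tangent_val \<sigma> (max (a powr q) (G z)) (G z))"
  show thesis
  proof (rule that[of \<delta> "1 - \<sigma>" V])
    show "\<delta> > 0" by (rule \<delta>)
    show "1 - \<sigma> > 0" using \<sigma> by simp
    fix a :: real and z assume a: "0 \<le> a" and qz: "quad z"
    show "(1 - \<sigma>) * a powr p \<le> V a z"
    proof -
      have "a powr p = (a powr q) powr \<sigma>" using \<sigma> by (simp add: powr_powr)
      also have "\<dots> \<le> (max (a powr q) (G z)) powr \<sigma>" using \<sigma> by (intro powr_mono2) auto
      finally have "(1 - \<sigma>) * a powr p \<le> (1 - \<sigma>) * (max (a powr q) (G z)) powr \<sigma>"
        using \<sigma> by (intro mult_left_mono) auto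
      also have "\<dots> \<le> V a z" unfolding V_def tangent_val_def using \<sigma> G0[OF qz] by simp
      finally show ?thesis .
    qed
    assume nt: "z \<noteq> (0, 1)"
    define s where "s = sqn z"
    have s1: "s \<ge> 1" unfolding s_def by (rule sqn_ge1[OF qz])
    have cs: "0 < c * s powr \<beta>" "c * s powr \<beta> \<le> G z" using c s1 Gl[OF qz nt] by (auto simp: s_def \<beta>_def)
    then have Gp: "G z > 0" by linarith
    define e where "e = \<epsilon> * s powr (\<beta> - 1)"
    have e0: "e > 0" unfolding e_def using \<epsilon> s1 by simp
    have eG: "e \<le> G z" "(\<integral>\<^sup>+z'. ennreal (G z') \<partial>kern K z) \<le> ennreal (G z - e)"
      using Gd[OF qz nt] by (auto simp: e_def s_def \<beta>_def)
    define \<rho> where "\<rho> = real_of_int (fst z + snd z)"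
    have \<rho>: "0 \<le> \<rho>" "\<rho> \<le> 2 * sqrt s" using coord_sum_le[OF qz] qz unfolding \<rho>_def s_def by (auto simp: quad_def)
    define g where "g = max (a powr q) (G z)"
    have g: "g > 0" "a powr q \<le> g" "G z \<le> g" using Gp by (auto simp: g_def)
    define a' where "a' = a + \<delta> * \<rho>"
    have a'0: "a' \<ge> 0" using a \<delta> \<rho> by (simp add: a'_def)
    define g' where "g' = max (a' powr q) g"
    have g': "g' > 0" "g \<le> g'" "a' powr q \<le> g'" using g by (auto simp: g'_def)
    have dg: "g' - g \<le> e / 2"
    proof (cases "a' powr q \<le> g")
      case True then show ?thesis using e0 by (simp add: g'_def)
    next
      case False
      \<comment> \<open>Replacing \<open>a\<close> by \<open>y \<ge> a\<close> only enlarges the new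
        touching point, and concavity of \<open>x powr q\<close> at \<open>y\<close> bounds the
        increment by \<open>y powr (q - 1) * (\<delta> * \<rho>)\<close>, which the lower bound on
        \<open>g\<close> controls.\<close>
      define y where "y = g powr (1 / q)"
      have y: "y > 0" "y powr q = g" using g q0 by (auto simp: y_def powr_powr)
      have "a = (a powr q) powr (1 / q)" using a q0 by (simp add: powr_powr)
      also have "\<dots> \<le> y" unfolding y_def using g q0 by (intro powr_mono2) auto
      finally have ay: "a \<le> y" .
      have "a' powr q \<le> (y + \<delta> * \<rho>) powr q" using ay a'0 q0 unfolding a'_def by (intro powr_mono2) auto
      also have "\<dots> \<le> (1 - q) * y powr q + q * y powr (q - 1) * (y + \<delta> * \<rho>)"
        using y \<delta> \<rho> q0 q by (intro powr_le_tangent) auto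
      also have "\<dots> = g + q * y powr (q - 1) * (\<delta> * \<rho>)"
      proof -
        have "y powr (q - 1) * y = g" using y by (simp add: powr_diff)
        then have "q * y powr (q - 1) * y = q * g" by simp
        then show ?thesis unfolding distrib_left y(2) by (simp add: left_diff_distrib)
      qed
      also have "q * y powr (q - 1) * (\<delta> * \<rho>) \<le> 1 * y powr (q - 1) * (\<delta> * \<rho>)"
        using q \<delta> \<rho> by (intro mult_right_mono) auto
      also have "y powr (q - 1) = g powr (1 - 1 / q)"
        unfolding y_def powr_powr using q0 by (simp add: right_diff_distrib)
      also have "1 * g powr (1 - 1 / q) * (\<delta> * \<rho>) \<le> (c powr (1 - 1 / q) * s powr (\<beta> - 3 / 2)) * (\<delta> * (2 * sqrt s))"
      proof -
        have "g powr (1 - 1 / q) \<le> (c * s powr \<beta>) powr (1 - 1 / q)"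
          using cs g q q0 by (intro powr_mono2') auto
        also have "\<dots> = c powr (1 - 1 / q) * s powr (\<beta> - 3 / 2)"
        proof -
          have "\<beta> * (1 - 1 / q) = \<beta> - 3 / 2" unfolding \<beta>_def using q0 by (simp add: field_simps)
          then show ?thesis using c s1 by (subst powr_mult) (auto simp: powr_powr)
        qed
        finally show ?thesis unfolding mult_1 using \<delta> \<rho> by (intro mult_mono) auto
      qed
      also have "\<dots> = e / 2"
      proof -
        have "s powr (\<beta> - 3 / 2) * sqrt s = s powr (\<beta> - 1)"
          using s1 by (simp flip: powr_half_sqrt powr_add)
        then show ?thesis unfolding \<delta>_def e_def using c by (simp add: field_simps)
      qed
      finally show ?thesis using False by (simp add: g'_def)
    qed
    have gg: "g' \<le> 2 * g" using dg eG g by linarith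
    have main: "tangent_val \<sigma> g' (G z - e) \<le> V a z"
    proof -
      have p1: "g' powr (\<sigma> - 1) \<le> g powr (\<sigma> - 1)" using g g' \<sigma> by (intro powr_mono2') auto
      have p2: "g powr (\<sigma> - 1) \<le> 2 * g' powr (\<sigma> - 1)"
      proof -
        have "(2 * g) powr (\<sigma> - 1) \<le> g' powr (\<sigma> - 1)" using g g' gg \<sigma> by (intro powr_mono2') auto
        then have h: "2 powr (\<sigma> - 1) * g powr (\<sigma> - 1) \<le> g' powr (\<sigma> - 1)" using g by (simp add: powr_mult)
        have "2 powr (- 1) \<le> 2 powr (\<sigma> - 1)" using \<sigma> by (intro powr_mono) auto
        then have "1 / 2 \<le> (2::real) powr (\<sigma> - 1)" by (simp add: powr_minus)
        then have "1 / 2 * g powr (\<sigma> - 1) \<le> 2 powr (\<sigma> - 1) * g powr (\<sigma> - 1)" by (intro mult_right_mono) auto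
        then show ?thesis using h by linarith
      qed
      have "g' powr \<sigma> \<le> (1 - \<sigma>) * g powr \<sigma> + \<sigma> * g powr (\<sigma> - 1) * g'"
        using g g' \<sigma> by (intro powr_le_tangent) auto
      moreover have "g powr (\<sigma> - 1) * g = g powr \<sigma>" using g by (simp add: powr_diff)
      ultimately have "g' powr \<sigma> - g powr \<sigma> \<le> \<sigma> * g powr (\<sigma> - 1) * (g' - g)"
        by (simp add: algebra_simps)
      also have "\<dots> \<le> \<sigma> * (2 * g' powr (\<sigma> - 1)) * (e / 2)"
        using p2 dg g' \<sigma> by (intro mult_mono mult_left_mono) auto
      finally have d1: "g' powr \<sigma> - g powr \<sigma> \<le> \<sigma> * g' powr (\<sigma> - 1) * e" by simp
      have "(1 - \<sigma>) * (g' powr \<sigma> - g powr \<sigma>) \<le> 1 * (\<sigma> * g' powr (\<sigma> - 1) * e)"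
        using d1 \<sigma> g' g by (intro mult_mono) (auto intro: powr_mono2 simp: e0 less_imp_le)
      moreover have "\<sigma> * g' powr (\<sigma> - 1) * G z \<le> \<sigma> * g powr (\<sigma> - 1) * G z"
        using p1 \<sigma> Gp by (intro mult_right_mono mult_left_mono) auto
      ultimately show ?thesis unfolding V_def tangent_val_def g_def[symmetric]
        by (simp add: algebra_simps)
    qed
    define k0 where "k0 = (1 - \<sigma>) * g' powr \<sigma>"
    define k1 where "k1 = \<sigma> * g' powr (\<sigma> - 1)"
    have k: "0 \<le> k0" "0 \<le> k1" using \<sigma> by (auto simp: k0_def k1_def)
    have "(\<integral>\<^sup>+z'. ennreal (V a' z') \<partial>kern K z) \<le> (\<integral>\<^sup>+z'. ennreal k0 + ennreal k1 * ennreal (G z') \<partial>kern K z)"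
    proof (rule nn_integral_mono_AE, unfold AE_measure_pmf_iff, intro ballI)
      fix z' assume "z' \<in> set_pmf (kern K z)"
      then have "G z' \<ge> 0" using quad_kern[OF qz] G0 by blast
      then have "V a' z' \<le> k0 + k1 * G z'"
        using tangent_val_max_le[OF \<sigma>(1,2) \<open>G z' \<ge> 0\<close> _ g'(3,1)] unfolding V_def k0_def k1_def tangent_val_def by simp
      then show "ennreal (V a' z') \<le> ennreal k0 + ennreal k1 * ennreal (G z')"
        using \<open>G z' \<ge> 0\<close> k by (simp add: ennreal_mult[symmetric] ennreal_plus[symmetric] ennreal_leI del: ennreal_plus)
    qed
    also have "\<dots> = ennreal k0 + ennreal k1 * (\<integral>\<^sup>+z'. ennreal (G z') \<partial>kern K z)"
      by (simp add: nn_integral_add nn_integral_cmult)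
    also have "\<dots> \<le> ennreal k0 + ennreal k1 * ennreal (G z - e)"
      by (intro add_left_mono mult_left_mono eG) auto
    also have "\<dots> = ennreal (tangent_val \<sigma> g' (G z - e))"
      using k eG by (simp add: ennreal_mult ennreal_plus tangent_val_def k0_def k1_def)
    also have "\<dots> \<le> ennreal (V a z)" by (intro ennreal_leI main)
    finally show "(\<integral>\<^sup>+z'. ennreal (V (a + \<delta> * real_of_int (fst z + snd z)) z') \<partial>kern K z) \<le> ennreal (V a z)"
      unfolding a'_def \<rho>_def .
  qed
qed

lemma moment_potential:
  fixes p :: real
  assumes mom: "all_moments K" and p: "0 < p" and sgn: "1 + 3 * p < 3 * noise_mean K"
  obtains V \<delta> c0 where "\<delta> > 0" "c0 > 0" "\<And>a z. 0 \<le> a \<Longrightarrow> quad z \<Longrightarrow> c0 * a powr p \<le> V a z"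
    "\<And>a z. 0 \<le> a \<Longrightarrow> quad z \<Longrightarrow> z \<noteq> (0, 1) \<Longrightarrow>
      (\<integral>\<^sup>+z'. ennreal (V (a + \<delta> * real_of_int (fst z + snd z)) z') \<partial>kern K z) \<le> ennreal (V a z)"
proof (cases "1 \<le> p")
  case True
  show thesis
  proof (rule moment_potential_ge1[OF mom True sgn])
    fix V \<delta>
    assume "(\<delta>::real) > 0" "\<And>a z. 0 \<le> a \<Longrightarrow> quad z \<Longrightarrow> a powr p \<le> V a z"
      "\<And>a z. 0 \<le> a \<Longrightarrow> quad z \<Longrightarrow> z \<noteq> (0, 1) \<Longrightarrow>
        (\<integral>\<^sup>+z'. ennreal (V (a + \<delta> * real_of_int (fst z + snd z)) z') \<partial>kern K z) \<le> ennreal (V a z)"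
    then show thesis by (intro that[of \<delta> 1 V]) simp_all
  qed
next
  case False
  \<comment> \<open>The midpoint between \<open>p\<close> and the smaller of the two strict upper
    limits on \<open>q\<close>.\<close>
  define q where "q = (p + min 1 (noise_mean K - 1 / 3)) / 2"
  have q: "p < q" "q < 1" "1 + 3 * q < 3 * noise_mean K"
    using False sgn unfolding q_def by (auto simp: min_def field_simps)
  show thesis
    by (rule moment_potential_lt1[OF mom p q]) (rule that; assumption)
qed

subsection \<open>The urn as a Markov chain of histories\<close>

text \<open>In the first and third quadrants \<open>\<bar>x\<bar>\<close> is run down while
  \<open>\<bar>y\<bar>\<close> grows; in the other two the roles are exchanged. Points of norm 1
  become \<open>(0, 1)\<close>.\<close>

definition rot :: "int \<times> int \<Rightarrow> int \<times> int" where
  "rot z = (case z of (x, y) \<Rightarrow>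
     if x * y > 0 then (\<bar>x\<bar>, \<bar>y\<bar>) else if x * y < 0 then (\<bar>y\<bar>, \<bar>x\<bar>) else (0, \<bar>x\<bar> + \<bar>y\<bar>))"

definition ustep :: "int pmf \<Rightarrow> int \<times> int \<Rightarrow> (int \<times> int) pmf" where
  "ustep K z = (case z of (x, y) \<Rightarrow>
     if x = 0 then map_pmf (\<lambda>k. (- sgn y, sgn y * max 1 (\<bar>y\<bar> - k))) K
     else if y = 0 then map_pmf (\<lambda>k. (sgn x * max 1 (\<bar>x\<bar> - k), sgn x)) K
     else map_pmf (\<lambda>b. if b then (x, y + sgn x) else (x - sgn y, y))
            (bernoulli_pmf (real_of_int \<bar>x\<bar> / real_of_int (\<bar>x\<bar> + \<bar>y\<bar>))))"

lemma quad_rot: "z \<noteq> (0, 0) \<Longrightarrow> quad (rot z)"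
  by (cases z) (auto simp: quad_def rot_def zero_less_mult_iff mult_less_0_iff)

lemma rot_sum: "fst (rot z) + snd (rot z) = \<bar>fst z\<bar> + \<bar>snd z\<bar>"
  by (cases z) (auto simp: rot_def)

lemma rot_target: "z \<noteq> (0, 0) \<Longrightarrow> rot z = (0, 1) \<longleftrightarrow> \<bar>fst z\<bar> + \<bar>snd z\<bar> = 1"
  using rot_sum[of z] quad_rot[of z] by (cases "rot z") (auto simp: quad_def)

lemma bernoulli_pmf_flip:
  assumes "0 \<le> p" "p \<le> 1"
  shows "map_pmf Not (bernoulli_pmf p) = bernoulli_pmf (1 - p)"
proof (rule pmf_eqI)
  fix b :: bool
  have "pmf (map_pmf Not (bernoulli_pmf p)) (Not (Not b)) = pmf (bernoulli_pmf p) (Not b)"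
    by (rule pmf_map_inj') (auto simp: inj_def)
  then show "pmf (map_pmf Not (bernoulli_pmf p)) b = pmf (bernoulli_pmf (1 - p)) b"
    using assms by (cases b) auto
qed

text \<open>The four quadrants are lumped into one: the dynamics commutes with quarter turns, so the
  image of the chain under \<open>rot\<close> is again Markov.\<close>

lemma map_rot_ustep:
  assumes "z \<noteq> (0, 0)"
  shows "map_pmf rot (ustep K z) = kern K (rot z)"
proof -
  obtain x y where z: "z = (x, y)" by (cases z)
  consider "x = 0" "y \<noteq> 0" | "x \<noteq> 0" "y = 0" | "x * y > 0" | "x * y < 0"
    using assms z by (metis linorder_neqE_linordered_idom mult_eq_0_iff)
  then show ?thesis
  proof cases
    case 1
    have "rot (- sgn y, sgn y * max 1 (\<bar>y\<bar> - k)) = (max 1 (\<bar>y\<bar> - k), 1)" for k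
      using 1 by (auto simp: rot_def sgn_if abs_mult max_def)
    then show ?thesis using 1 by (simp add: z ustep_def kern_def pmf.map_comp o_def) (simp add: rot_def)
  next
    case 2
    have "rot (sgn x * max 1 (\<bar>x\<bar> - k), sgn x) = (max 1 (\<bar>x\<bar> - k), 1)" for k
      using 2 by (auto simp: rot_def sgn_if abs_mult max_def)
    then show ?thesis using 2 by (simp add: z ustep_def kern_def pmf.map_comp o_def) (simp add: rot_def)
  next
    case 3
    have xy: "x \<noteq> 0" "y \<noteq> 0" using 3 by auto
    have r1: "rot (x, y + sgn x) = (\<bar>x\<bar>, \<bar>y\<bar> + 1)"
      using 3 by (auto simp: rot_def sgn_if zero_less_mult_iff mult_less_0_iff)
    have r2: "rot (x - sgn y, y) = (\<bar>x\<bar> - 1, \<bar>y\<bar>)"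
      using 3 by (auto simp: rot_def sgn_if zero_less_mult_iff mult_less_0_iff)
    have "rot z = (\<bar>x\<bar>, \<bar>y\<bar>)" using 3 by (simp add: z rot_def)
    then show ?thesis using xy
      by (simp add: z ustep_def kern_def pmf.map_comp o_def if_distrib[of rot] r1 r2 cong: if_cong)
  next
    case 4
    have xy: "x \<noteq> 0" "y \<noteq> 0" using 4 by auto
    have r1: "rot (x, y + sgn x) = (\<bar>y\<bar> - 1, \<bar>x\<bar>)"
      using 4 by (auto simp: rot_def sgn_if zero_less_mult_iff mult_less_0_iff)
    have r2: "rot (x - sgn y, y) = (\<bar>y\<bar>, \<bar>x\<bar> + 1)"
      using 4 by (auto simp: rot_def sgn_if zero_less_mult_iff mult_less_0_iff)
    have rz: "rot z = (\<bar>y\<bar>, \<bar>x\<bar>)" using 4 by (simp add: z rot_def)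
    define p where "p = real_of_int \<bar>y\<bar> / real_of_int (\<bar>y\<bar> + \<bar>x\<bar>)"
    have p: "0 \<le> p" "p \<le> 1" unfolding p_def by (auto simp: divide_le_eq)
    have "1 - p = real_of_int \<bar>x\<bar> / real_of_int (\<bar>x\<bar> + \<bar>y\<bar>)"
    proof -
      have "\<bar>real_of_int x\<bar> + \<bar>real_of_int y\<bar> > 0" using xy by simp
      then show ?thesis unfolding p_def by (simp add: field_simps)
    qed
    then have "map_pmf rot (ustep K z) = map_pmf (\<lambda>b. if b then (\<bar>y\<bar> - 1, \<bar>x\<bar>) else (\<bar>y\<bar>, \<bar>x\<bar> + 1)) (bernoulli_pmf (1 - p))"
      using xy by (simp add: z ustep_def pmf.map_comp o_def if_distrib[of rot] r1 r2 cong: if_cong)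
    \<comment> \<open>For \<open>x * y < 0\<close> it is the vertical move that runs the counter
      down, so the coin has to be flipped.\<close>
    also have "\<dots> = map_pmf (\<lambda>b. if b then (\<bar>y\<bar>, \<bar>x\<bar> + 1) else (\<bar>y\<bar> - 1, \<bar>x\<bar>)) (bernoulli_pmf p)"
      unfolding bernoulli_pmf_flip[OF p, symmetric] pmf.map_comp o_def by (intro map_pmf_cong) auto
    also have "\<dots> = kern K (rot z)" unfolding rz kern_def p_def using xy by simp
    finally show ?thesis .
  qed
qed

lemma ustep_nonzero: "z \<noteq> (0, 0) \<Longrightarrow> z' \<in> set_pmf (ustep K z) \<Longrightarrow> z' \<noteq> (0, 0)"
proof -
  assume z: "z \<noteq> (0, 0)" "z' \<in> set_pmf (ustep K z)"
  have "rot z' \<in> set_pmf (map_pmf rot (ustep K z))" using z(2) by auto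
  then have "quad (rot z')" using quad_kern[OF quad_rot[OF z(1)]] unfolding map_rot_ustep[OF z(1)] by blast
  then show ?thesis by (auto simp: rot_def quad_def)
qed

text \<open>The law of the history \<open>[Z\<^sub>n, \<dots>, Z\<^sub>0]\<close>, most recent state first.\<close>

primrec law :: "int pmf \<Rightarrow> int \<Rightarrow> nat \<Rightarrow> (int \<times> int) list pmf" where
  "law K z0 0 = return_pmf [(z0, 1)]"
| "law K z0 (Suc n) = bind_pmf (law K z0 n) (\<lambda>l. map_pmf (\<lambda>z. z # l) (ustep K (hd l)))"

text \<open>A history determines its predecessor, so a single term of the mixture survives.\<close>

lemma pmf_law_Suc: "pmf (law K z0 (Suc n)) (z # l) = pmf (law K z0 n) l * pmf (ustep K (hd l)) z"
proof -
  have "pmf (map_pmf (\<lambda>z. z # l') (ustep K (hd l'))) (z # l) = indicator {l} l' * pmf (ustep K (hd l)) z" for l'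
  proof (cases "l' = l")
    case True
    have "pmf (map_pmf (\<lambda>z. z # l) (ustep K (hd l))) ((\<lambda>z. z # l) z) = pmf (ustep K (hd l)) z"
      by (rule pmf_map_inj') (auto simp: inj_def)
    then show ?thesis using True by simp
  next
    case False
    then have "z # l \<notin> set_pmf (map_pmf (\<lambda>z. z # l') (ustep K (hd l')))" by auto
    then show ?thesis using False by (simp add: pmf_eq_0_set_pmf)
  qed
  then show ?thesis by (simp add: pmf_bind measure_pmf_single)
qed

lemma law_support: "z0 \<ge> 1 \<Longrightarrow> l \<in> set_pmf (law K z0 n) \<Longrightarrow> l \<noteq> [] \<and> (0, 0) \<notin> set l"
proof (induction n arbitrary: l)
  case (Suc n)
  then obtain l' z where l: "l = z # l'" "l' \<in> set_pmf (law K z0 n)" "z \<in> set_pmf (ustep K (hd l'))" by auto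
  with Suc have IH: "l' \<noteq> []" "(0, 0) \<notin> set l'" by auto
  then have "hd l' \<noteq> (0, 0)" by (metis list.set_sel(1))
  then have "z \<noteq> (0, 0)" using ustep_nonzero l(3) by blast
  then show ?case using l IH by auto
qed auto

text \<open>The length condition allows \<open>W\<close> to inspect the initial segment up to time
  \<open>m\<close>; the supermartingale inequality is then required only from that time on.\<close>

lemma law_supermartingale:
  fixes W :: "(int \<times> int) list \<Rightarrow> ennreal"
  assumes z0: "z0 \<ge> 1"
    and W: "\<And>l. l \<noteq> [] \<Longrightarrow> (0, 0) \<notin> set l \<Longrightarrow> length l > m \<Longrightarrow> (\<integral>\<^sup>+z. W (z # l) \<partial>ustep K (hd l)) \<le> W l"
    and n: "m \<le> n"
  shows "(\<integral>\<^sup>+l. W l \<partial>law K z0 n) \<le> (\<integral>\<^sup>+l. W l \<partial>law K z0 m)"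
  using n
proof (induction n rule: dec_induct)
  case (step n)
  have len: "length l = Suc n" if "l \<in> set_pmf (law K z0 n)" for l n using that
    by (induction n arbitrary: l) auto
  have "(\<integral>\<^sup>+l. W l \<partial>law K z0 (Suc n)) = (\<integral>\<^sup>+l. (\<integral>\<^sup>+z. W (z # l) \<partial>ustep K (hd l)) \<partial>law K z0 n)"
    by simp
  also have "\<dots> \<le> (\<integral>\<^sup>+l. W l \<partial>law K z0 n)"
    using law_support[OF z0] len[of _ n] step(1)
    by (intro nn_integral_mono_AE) (auto simp: AE_measure_pmf_iff intro!: W)
  finally show ?case using step.IH by simp
qed simp

section \<open>From the hypotheses on the urn to the law of its histories\<close>

lemma ex_pmf_of_prob_space:
  fixes N :: "'b::countable measure"
  assumes "prob_space N" "sets N = UNIV"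
  shows "\<exists>p. measure_pmf p = N"
proof -
  interpret prob_space N by fact
  have "(\<Union>x\<in>{x. measure N {x} = 0}. {x}) \<in> null_sets N"
    using assms(2) by (intro null_sets_UN') (auto simp: null_sets_def emeasure_eq_measure)
  then have "AE x in N. measure N {x} \<noteq> 0" by (intro AE_I'[of "{x. measure N {x} = 0}"]) auto
  then show ?thesis using assms by (intro exI[of _ "Abs_pmf N"]) (simp add: Abs_pmf_inverse)
qed

lemma distr_eq_pmfI:
  fixes f :: "'a \<Rightarrow> 'b::countable"
  assumes "f \<in> measurable M (count_space UNIV)" "\<And>x. emeasure M {\<omega>\<in>space M. f \<omega> = x} = ennreal (pmf p x)"
  shows "distr M (count_space UNIV) f = measure_pmf p"
proof (rule measure_eqI_countable[of _ UNIV])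
  fix x :: 'b
  have "f -` {x} \<inter> space M = {\<omega>\<in>space M. f \<omega> = x}" by auto
  then show "emeasure (distr M (count_space UNIV) f) {x} = emeasure (measure_pmf p) {x}"
    using assms by (simp add: emeasure_distr emeasure_pmf_single)
qed auto

lemma measurable_Pair_countable:
  fixes f :: "'a \<Rightarrow> 'b::countable" and g :: "'a \<Rightarrow> 'c::countable"
  assumes "f \<in> measurable M (count_space UNIV)" "g \<in> measurable M (count_space UNIV)"
  shows "(\<lambda>x. (f x, g x)) \<in> measurable M (count_space UNIV)"
  using measurable_Pair[OF assms] by (simp add: pair_measure_countable)

context noisy_simple_harmonic_urn
begin

definition hist :: "nat \<Rightarrow> 'a \<Rightarrow> (int \<times> int) list" where
  "hist n \<omega> = rev (map (\<lambda>k. (X k \<omega>, Y k \<omega>)) [0..<Suc n])"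

lemma hist_0: "hist 0 \<omega> = [(X 0 \<omega>, Y 0 \<omega>)]" by (simp add: hist_def)

lemma hist_Suc: "hist (Suc n) \<omega> = (X (Suc n) \<omega>, Y (Suc n) \<omega>) # hist n \<omega>"
  by (simp add: hist_def)

lemma hist_eq_iff: "hist n \<omega> = l \<longleftrightarrow> length l = Suc n \<and> (\<forall>k\<le>n. (X k \<omega>, Y k \<omega>) = rev l ! k)"
proof -
  have "hist n \<omega> = l \<longleftrightarrow> map (\<lambda>k. (X k \<omega>, Y k \<omega>)) [0..<Suc n] = rev l"
    unfolding hist_def by (metis rev_swap)
  also have "\<dots> \<longleftrightarrow> length l = Suc n \<and> (\<forall>k\<le>n. (X k \<omega>, Y k \<omega>) = rev l ! k)"
    unfolding list_eq_iff_nth_eq by (auto simp del: upt_Suc simp: less_Suc_eq_le)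
  finally show ?thesis .
qed

lemma measurable_state: "(\<lambda>\<omega>. (X n \<omega>, Y n \<omega>)) \<in> measurable M (count_space UNIV)"
  using X_measurable[of n] Y_measurable[of n] by (rule measurable_Pair_countable)

lemma measurable_hist: "hist n \<in> measurable M (count_space UNIV)"
proof (induction n)
  case 0
  show ?case unfolding hist_0[abs_def] using measurable_compose[OF measurable_state[of 0], of "\<lambda>z. [z]"] by simp
next
  case (Suc n)
  have "(\<lambda>\<omega>. ((X (Suc n) \<omega>, Y (Suc n) \<omega>), hist n \<omega>)) \<in> measurable M (count_space UNIV)"
    using measurable_state[of "Suc n"] Suc by (rule measurable_Pair_countable)
  from measurable_compose[OF this, of "\<lambda>(z, l). z # l"] show ?case by (simp add: hist_Suc[abs_def])
qed

lemma measurable_kappa: "kappa n \<in> measurable M (count_space UNIV)"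
  using kappa_indep unfolding indep_vars_def by auto

definition noise :: "int pmf" where
  "noise = (SOME p. measure_pmf p = distr M (count_space UNIV) (kappa 0))"

lemma measure_noise: "measure_pmf noise = distr M (count_space UNIV) (kappa 0)"
  unfolding noise_def
  by (rule someI_ex, rule ex_pmf_of_prob_space) (auto intro!: prob_space_distr measurable_kappa)

text \<open>Up to a null set, the event that \<open>z\<close> follows \<open>l\<close> is the
  intersection of a past event with an event about \<open>kappa n\<close>, and independence turns
  its probability into a product.\<close>

lemma trans_prob_axis:
  assumes ax: "AE \<omega> in M. hist n \<omega> = l \<longrightarrow> (X (Suc n) \<omega>, Y (Suc n) \<omega>) = \<phi> (kappa n \<omega>)"
  shows "prob {\<omega>\<in>space M. hist (Suc n) \<omega> = z # l} = prob {\<omega>\<in>space M. hist n \<omega> = l} * pmf (map_pmf \<phi> noise) z"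
proof -
  define S where "S = \<phi> -` {z}"
  have A: "{\<omega>\<in>space M. kappa n \<omega> \<in> S} \<in> sets (vimage_algebra (space M) (kappa n) (count_space UNIV))"
  proof -
    have "kappa n -` S \<inter> space M \<in> sets (vimage_algebra (space M) (kappa n) (count_space UNIV))"
      by (rule in_vimage_algebra) auto
    then show ?thesis by (simp add: vimage_def Int_def conj_commute)
  qed
  have B: "{\<omega>\<in>space M. hist n \<omega> = l} \<in> sets (vimage_algebra (space M)
            (\<lambda>\<omega>. (map (\<lambda>k. (X k \<omega>, Y k \<omega>)) [0..<Suc n], map (\<lambda>k. kappa k \<omega>) [1..<n]))
            (count_space UNIV))"
  proof -
    \<comment> \<open>The past algebra is generated by the chronological trajectory together with
      the earlier noises, hence \<open>rev l\<close> and the factor \<open>UNIV\<close>.\<close>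
    have "(\<lambda>\<omega>. (map (\<lambda>k. (X k \<omega>, Y k \<omega>)) [0..<Suc n], map (\<lambda>k. kappa k \<omega>) [1..<n])) -` ({rev l} \<times> UNIV) \<inter> space M
       \<in> sets (vimage_algebra (space M)
            (\<lambda>\<omega>. (map (\<lambda>k. (X k \<omega>, Y k \<omega>)) [0..<Suc n], map (\<lambda>k. kappa k \<omega>) [1..<n]))
            (count_space UNIV))"
      by (rule in_vimage_algebra) auto
    moreover have "(\<lambda>\<omega>. (map (\<lambda>k. (X k \<omega>, Y k \<omega>)) [0..<Suc n], map (\<lambda>k. kappa k \<omega>) [1..<n])) -` ({rev l} \<times> UNIV) \<inter> space M
       = {\<omega>\<in>space M. hist n \<omega> = l}"
      unfolding hist_def by (auto simp del: upt_Suc)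
    ultimately show ?thesis by simp
  qed
  have "prob {\<omega>\<in>space M. hist (Suc n) \<omega> = z # l} = prob ({\<omega>\<in>space M. kappa n \<omega> \<in> S} \<inter> {\<omega>\<in>space M. hist n \<omega> = l})"
  proof (rule finite_measure_eq_AE)
    show "AE \<omega> in M. (\<omega> \<in> {\<omega>\<in>space M. hist (Suc n) \<omega> = z # l}) = (\<omega> \<in> {\<omega>\<in>space M. kappa n \<omega> \<in> S} \<inter> {\<omega>\<in>space M. hist n \<omega> = l})"
      using ax by eventually_elim (auto simp: hist_Suc S_def)
    show "{\<omega>\<in>space M. hist (Suc n) \<omega> = z # l} \<in> sets M" using measurable_hist[of "Suc n"] by measurable
    have "{\<omega>\<in>space M. kappa n \<omega> \<in> S} \<in> sets M" using measurable_kappa[of n] by measurable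
    moreover have "{\<omega>\<in>space M. hist n \<omega> = l} \<in> sets M" using measurable_hist[of n] by measurable
    ultimately show "{\<omega>\<in>space M. kappa n \<omega> \<in> S} \<inter> {\<omega>\<in>space M. hist n \<omega> = l} \<in> sets M" by simp
  qed
  also have "\<dots> = prob {\<omega>\<in>space M. kappa n \<omega> \<in> S} * prob {\<omega>\<in>space M. hist n \<omega> = l}"
    by (rule indep_setD[OF kappa_indep_past A B])
  also have "prob {\<omega>\<in>space M. kappa n \<omega> \<in> S} = measure (distr M (count_space UNIV) (kappa n)) S"
    using measurable_kappa[of n] by (subst measure_distr) (auto intro!: arg_cong[where f=prob])
  also have "\<dots> = measure noise S" unfolding kappa_ident_distr[of n] measure_noise ..
  also have "\<dots> = pmf (map_pmf \<phi> noise) z" by (simp add: pmf_map S_def)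
  finally show ?thesis by simp
qed

lemma trans_prob:
  "prob {\<omega>\<in>space M. hist (Suc n) \<omega> = z # l} = prob {\<omega>\<in>space M. hist n \<omega> = l} * pmf (ustep noise (hd l)) z"
proof (cases "prob {\<omega>\<in>space M. hist n \<omega> = l} = 0")
  case True
  have "prob {\<omega>\<in>space M. hist (Suc n) \<omega> = z # l} \<le> prob {\<omega>\<in>space M. hist n \<omega> = l}"
    using measurable_hist[of n] by (intro finite_measure_mono) (auto simp: hist_Suc)
  then show ?thesis using True measure_nonneg[of M] by (metis antisym mult_zero_left)
next
  case False
  then have "{\<omega>\<in>space M. hist n \<omega> = l} \<noteq> {}" by (metis measure_empty)
  then obtain \<omega>0 where "hist n \<omega>0 = l" by auto
  then have len: "length l = Suc n" by (simp add: hist_eq_iff)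
  define h where "h = (\<lambda>k. rev l ! k)"
  have hn: "h n = hd l" unfolding h_def using len by (cases l) (auto simp: nth_append)
  have E: "hist n \<omega> = l \<longleftrightarrow> (\<forall>k\<le>n. (X k \<omega>, Y k \<omega>) = h k)" for \<omega>
    unfolding hist_eq_iff h_def using len by simp
  have last: "hist n \<omega> = l \<Longrightarrow> (X n \<omega>, Y n \<omega>) = hd l" for \<omega> using E[of \<omega>] hn by simp
  obtain x y where xy: "hd l = (x, y)" by (cases "hd l")
  show ?thesis
  proof (cases "x = 0 \<or> y = 0")
    case True
    show ?thesis
    proof (cases "x = 0")
      case True
      have u: "ustep noise (hd l) = map_pmf (\<lambda>k. (- sgn y, sgn y * max 1 (\<bar>y\<bar> - k))) noise"
        by (simp add: xy ustep_def True)
      show ?thesis unfolding u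
        by (rule trans_prob_axis, use step_from_y_axis[of n] in eventually_elim) (use last xy True in auto)
    next
      case False
      then have y: "y = 0" using True by simp
      have u: "ustep noise (hd l) = map_pmf (\<lambda>k. (sgn x * max 1 (\<bar>x\<bar> - k), sgn x)) noise"
        using False y by (simp add: xy ustep_def)
      show ?thesis unfolding u
        by (rule trans_prob_axis, use step_from_x_axis[of n] in eventually_elim) (use last xy y in auto)
    qed
  next
    case nz: False
    define p where "p = real_of_int \<bar>x\<bar> / real_of_int (\<bar>x\<bar> + \<bar>y\<bar>)"
    define z1 where "z1 = (x, y + sgn x)"
    define z2 where "z2 = (x - sgn y, y)"
    have p: "0 \<le> p" "p \<le> 1" unfolding p_def by (auto simp: divide_le_eq)
    have q: "real_of_int \<bar>y\<bar> / real_of_int (\<bar>x\<bar> + \<bar>y\<bar>) = 1 - p"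
    proof -
      have "\<bar>real_of_int x\<bar> + \<bar>real_of_int y\<bar> > 0" using nz by (intro add_pos_pos) auto
      then show ?thesis unfolding p_def by (simp add: field_simps)
    qed
    have z12: "z1 \<noteq> z2" unfolding z1_def z2_def using nz by (auto simp: sgn_if)
    have u: "ustep noise (hd l) = map_pmf (\<lambda>b. if b then z1 else z2) (bernoulli_pmf p)"
      using nz unfolding xy ustep_def p_def z1_def z2_def by simp
    define e where "e = prob {\<omega>\<in>space M. hist n \<omega> = l}"
    have e: "e > 0" using False unfolding e_def by (simp add: zero_less_measure_iff)
    have Eset: "{\<omega>\<in>space M. \<forall>k\<le>n. (X k \<omega>, Y k \<omega>) = h k} = {\<omega>\<in>space M. hist n \<omega> = l}"
      using E by auto
    have Hset: "{\<omega>\<in>space M. (X (Suc n) \<omega>, Y (Suc n) \<omega>) = w \<and> (\<forall>k\<le>n. (X k \<omega>, Y k \<omega>) = h k)}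
      = {\<omega>\<in>space M. hist (Suc n) \<omega> = w # l}" for w
      using E by (auto simp: hist_Suc)
    have hxy: "h n = (x, y)" "x * y \<noteq> 0" "\<P>(\<omega> in M. \<forall>k\<le>n. (X k \<omega>, Y k \<omega>) = h k) > 0"
      using hn xy nz e unfolding Eset e_def by auto
    have P1: "prob {\<omega>\<in>space M. hist (Suc n) \<omega> = z1 # l} = e * p"
      using step_vertical[of h, OF hxy] e unfolding cond_prob_def Eset z1_def[symmetric] Hset p_def[symmetric] e_def[symmetric]
      by (simp add: field_simps)
    have P2: "prob {\<omega>\<in>space M. hist (Suc n) \<omega> = z2 # l} = e * (1 - p)"
      using step_horizontal[of h, OF hxy] e unfolding cond_prob_def Eset z2_def[symmetric] Hset q e_def[symmetric]
      by (simp add: field_simps)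
    have meas: "{\<omega>\<in>space M. hist (Suc n) \<omega> = w} \<in> sets M" for w using measurable_hist[of "Suc n"] by measurable
    have inj: "inj (\<lambda>b. if b then z1 else z2)" using z12 by (auto simp: inj_def)
    consider "z = z1" | "z = z2" | "z \<noteq> z1" "z \<noteq> z2" by auto
    then show ?thesis
    proof cases
      case 1
      have "pmf (map_pmf (\<lambda>b. if b then z1 else z2) (bernoulli_pmf p)) ((\<lambda>b. if b then z1 else z2) True) = pmf (bernoulli_pmf p) True"
        by (rule pmf_map_inj'[OF inj])
      then show ?thesis unfolding u 1 using P1 p e_def by simp
    next
      case 2
      have "pmf (map_pmf (\<lambda>b. if b then z1 else z2) (bernoulli_pmf p)) ((\<lambda>b. if b then z1 else z2) False) = pmf (bernoulli_pmf p) False"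
        by (rule pmf_map_inj'[OF inj])
      then show ?thesis unfolding u 2 using P2 p e_def by simp
    next
      case 3
      \<comment> \<open>The hypotheses give the probabilities of the two admissible moves. These
        already exhaust the probability \<open>e\<close> of the history, so a third continuation has
        probability zero.\<close>
      have "prob ({\<omega>\<in>space M. hist (Suc n) \<omega> = z # l} \<union> ({\<omega>\<in>space M. hist (Suc n) \<omega> = z1 # l} \<union> {\<omega>\<in>space M. hist (Suc n) \<omega> = z2 # l})) \<le> e"
        unfolding e_def using measurable_hist[of n] by (intro finite_measure_mono) (auto simp: hist_Suc)
      moreover have "prob ({\<omega>\<in>space M. hist (Suc n) \<omega> = z # l} \<union> ({\<omega>\<in>space M. hist (Suc n) \<omega> = z1 # l} \<union> {\<omega>\<in>space M. hist (Suc n) \<omega> = z2 # l}))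
         = prob {\<omega>\<in>space M. hist (Suc n) \<omega> = z # l} + (e * p + e * (1 - p))"
        unfolding P1[symmetric] P2[symmetric] using 3 z12
        by (subst finite_measure_Union, (auto simp: meas)[3], subst finite_measure_Union) (auto simp: meas)
      ultimately have "prob {\<omega>\<in>space M. hist (Suc n) \<omega> = z # l} \<le> 0" by (simp add: algebra_simps)
      moreover have "z \<notin> set_pmf (ustep noise (hd l))" unfolding u using 3 by auto
      ultimately show ?thesis by (simp add: set_pmf_iff measure_le_0_iff)
    qed
  qed
qed

text \<open>From here on, expectations of functions of the history are integrals against a
  \<open>pmf\<close> on a countable type.\<close>

lemma distr_hist: "distr M (count_space UNIV) (hist n) = measure_pmf (law noise (int z0) n)"
proof -
  have P: "prob {\<omega>\<in>space M. hist n \<omega> = l} = pmf (law noise (int z0) n) l" for l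
  proof (induction n arbitrary: l)
    case 0
    have meas: "{\<omega>\<in>space M. hist 0 \<omega> = l} \<in> sets M" using measurable_hist[of 0] by measurable
    show ?case
    proof (cases "l = [(int z0, 1)]")
      case True
      have "prob {\<omega>\<in>space M. hist 0 \<omega> = l} = 1"
        by (subst prob_Collect_eq_1[OF meas]) (use start True in \<open>simp add: hist_0\<close>)
      then show ?thesis using True by simp
    next
      case False
      have "AE \<omega> in M. hist 0 \<omega> \<noteq> l"
        using start by eventually_elim (use False in \<open>auto simp: hist_0\<close>)
      then have "prob {\<omega>\<in>space M. hist 0 \<omega> = l} = 0" by (subst prob_Collect_eq_0[OF meas])
      then show ?thesis using False by simp
    qed
  next
    case (Suc n)
    show ?case
    proof (cases l)
      case Nil
      have "[] \<notin> set_pmf (law noise (int z0) (Suc n))" by auto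
      then show ?thesis using Nil by (simp add: hist_Suc pmf_eq_0_set_pmf)
    next
      case (Cons z l')
      show ?thesis unfolding Cons trans_prob pmf_law_Suc Suc ..
    qed
  qed
  show ?thesis using P by (intro distr_eq_pmfI measurable_hist) (simp add: emeasure_eq_measure)
qed

lemma nn_integral_hist: "(\<integral>\<^sup>+\<omega>. f (hist n \<omega>) \<partial>M) = (\<integral>\<^sup>+l. f l \<partial>law noise (int z0) n)"
  unfolding distr_hist[symmetric] using measurable_hist by (subst nn_integral_distr) auto

lemma AE_hist: "AE \<omega> in M. hist n \<omega> \<in> set_pmf (law noise (int z0) n)"
proof -
  have "AE l in distr M (count_space UNIV) (hist n). l \<in> set_pmf (law noise (int z0) n)"
    unfolding distr_hist by (rule AE_pmfI)
  then show ?thesis using measurable_hist by (subst (asm) AE_distr_iff) auto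
qed

end

subsection \<open>Area and survival\<close>

definition norm1 :: "int \<times> int \<Rightarrow> int" where
  "norm1 z = \<bar>fst z\<bar> + \<bar>snd z\<bar>"

definition hit :: "(int \<times> int) list \<Rightarrow> bool" where
  "hit l \<longleftrightarrow> (\<exists>z\<in>set l. norm1 z = 1)"

text \<open>Half the absolute determinant of the two newest states. The stopping test looks at the
  tail only: the triangle of the step that reaches norm 1 still belongs to the area.\<close>

definition tri :: "(int \<times> int) list \<Rightarrow> real" where
  "tri l = (case l of z' # z # _ \<Rightarrow>
     if hit (tl l) then 0 else real_of_int \<bar>fst z * snd z' - fst z' * snd z\<bar> / 2 | _ \<Rightarrow> 0)"

text \<open>
  An upper bound for the area whose increment depends only on the state being left.
\<close>

primrec swept :: "(int \<times> int) list \<Rightarrow> real" where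
  "swept [] = 0"
| "swept (z # l) = (if l = [] \<or> hit l then swept l else swept l + real_of_int (norm1 (hd l)))"

lemma hit_Cons [simp]: "hit (z # l) \<longleftrightarrow> norm1 z = 1 \<or> hit l"
  by (auto simp: hit_def)

lemma swept_nonneg: "0 \<le> swept l"
  by (induction l) (auto simp: norm1_def)

lemma tri_nonneg: "0 \<le> tri l"
  by (auto simp: tri_def split: list.split)

text \<open>Twice the area is \<open>\<bar>x\<bar>\<close> or \<open>\<bar>y\<bar>\<close> of the
  state being left. On an axis the noise shifts the new point parallel to that axis, at distance 1,
  and so does not affect the triangle.\<close>

lemma ustep_triangle:
  assumes "z \<noteq> (0, 0)" "z' \<in> set_pmf (ustep K z)"
  shows "1 \<le> \<bar>fst z * snd z' - fst z' * snd z\<bar>" "\<bar>fst z * snd z' - fst z' * snd z\<bar> \<le> norm1 z"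
proof -
  obtain x y where z: "z = (x, y)" by (cases z)
  consider k where "x = 0" "z' = (- sgn y, sgn y * max 1 (\<bar>y\<bar> - k))"
    | k where "x \<noteq> 0" "y = 0" "z' = (sgn x * max 1 (\<bar>x\<bar> - k), sgn x)"
    | "x \<noteq> 0" "y \<noteq> 0" "z' = (x, y + sgn x)" | "x \<noteq> 0" "y \<noteq> 0" "z' = (x - sgn y, y)"
    using assms(2) unfolding z ustep_def by (auto split: if_splits)
  then have "\<bar>fst z * snd z' - fst z' * snd z\<bar> = \<bar>x\<bar> \<and> x \<noteq> 0 \<or> \<bar>fst z * snd z' - fst z' * snd z\<bar> = \<bar>y\<bar> \<and> y \<noteq> 0"
    using assms(1) by cases (auto simp: z algebra_simps abs_mult sgn_if)
  then show "1 \<le> \<bar>fst z * snd z' - fst z' * snd z\<bar>" "\<bar>fst z * snd z' - fst z' * snd z\<bar> \<le> norm1 z"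
    by (auto simp: norm1_def z)
qed

lemma tri_bounds:
  assumes "l \<noteq> []" "hd l \<noteq> (0, 0)" "z' \<in> set_pmf (ustep K (hd l))"
  shows "\<not> hit l \<Longrightarrow> 1 / 2 \<le> tri (z' # l)" "tri (z' # l) \<le> swept (z' # l) - swept l"
proof -
  obtain z l' where l: "l = z # l'" using assms by (cases l) auto
  have t: "1 \<le> real_of_int \<bar>fst z * snd z' - fst z' * snd z\<bar>"
    "real_of_int \<bar>fst z * snd z' - fst z' * snd z\<bar> \<le> real_of_int (norm1 z)"
    using ustep_triangle[of z z' K] assms unfolding l by (auto simp del: of_int_abs)
  show "\<not> hit l \<Longrightarrow> 1 / 2 \<le> tri (z' # l)" using t(1) by (simp add: l tri_def)
  have "0 \<le> real_of_int (norm1 z)" by (simp add: norm1_def)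
  then show "tri (z' # l) \<le> swept (z' # l) - swept l" using t(2) by (auto simp: l tri_def)
qed

section \<open>Extended powers, triangle areas and moments of the swept area\<close>

lemma ennreal_powr_SUP_le:
  assumes p: "0 < p" and B: "\<And>n. 0 \<le> B n" and x: "x \<le> (SUP n. ennreal (B n))"
  shows "ennreal_powr x p \<le> (SUP n. ennreal (B n powr p))"
proof (cases "(SUP n. ennreal (B n powr p)) = \<infinity>")
  case True
  show ?thesis unfolding True infinity_ennreal_def by (rule top_greatest)
next
  case False
  then obtain s where s: "0 \<le> s" "(SUP n. ennreal (B n powr p)) = ennreal s"
    by (metis ennreal_cases infinity_ennreal_def)
  have "B n \<le> s powr (1 / p)" for n
  proof -
    have "ennreal (B n powr p) \<le> ennreal s" unfolding s(2)[symmetric] by (rule SUP_upper) simp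
    then have "B n powr p \<le> s" using s(1) by simp
    then have "(B n powr p) powr (1 / p) \<le> s powr (1 / p)" using p by (intro powr_mono2) auto
    then show ?thesis using B[of n] p by (simp add: powr_powr)
  qed
  then have xs: "x \<le> ennreal (s powr (1 / p))"
    by (intro order_trans[OF x] SUP_least ennreal_leI)
  then have fin: "x \<noteq> \<infinity>" by (metis ennreal_less_top infinity_ennreal_def leD)
  have "enn2real x \<le> s powr (1 / p)" using xs by (simp add: enn2real_leI)
  then have "enn2real x powr p \<le> (s powr (1 / p)) powr p" using p by (intro powr_mono2) auto
  also have "\<dots> = s" using p s(1) by (simp add: powr_powr)
  finally show ?thesis unfolding s(2) ennreal_powr_def using p fin by (simp add: ennreal_leI)
qed

lemma ennreal_powr_nonpos_le:
  assumes "p \<le> 0" "0 < t" "ennreal t \<le> x"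
  shows "ennreal_powr x p \<le> ennreal (t powr p)"
proof (cases "x = \<infinity>")
  case True then show ?thesis using assms by (auto simp: ennreal_powr_def)
next
  case False
  then obtain s where s: "x = ennreal s" "0 \<le> s" by (metis ennreal_cases infinity_ennreal_def)
  then have ts: "t \<le> s" using assms by simp
  then have "s powr p \<le> t powr p" using assms by (intro powr_mono2') auto
  then show ?thesis using s ts assms by (auto simp: ennreal_powr_def ennreal_leI)
qed

lemma urn_triangle_area_eq:
  "urn_triangle_area X Y (Suc n) \<omega> = real_of_int \<bar>X n \<omega> * Y (Suc n) \<omega> - X (Suc n) \<omega> * Y n \<omega>\<bar> / 2"
proof -
  have "urn_triangle_area X Y (Suc n) \<omega>
    = measure lborel (convex hull {0, int_point (X n \<omega>) (Y n \<omega>), int_point (X (Suc n) \<omega>) (Y (Suc n) \<omega>)})"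
    by (simp add: urn_triangle_area_def)
  also have "\<dots> = \<bar>X (Suc n) \<omega> * Y n \<omega> - X n \<omega> * Y (Suc n) \<omega>\<bar> / 2"
    unfolding content_triangle by (simp add: int_point_def)
  finally show ?thesis by (simp add: abs_minus_commute)
qed

text \<open>The \<open>m\<close>-th power of \<open>1 + y \<le> c * exp (l * y / m)\<close>, where
  \<open>c\<close> absorbs both the constant 1 and the slope \<open>m / l\<close>.\<close>

lemma power_le_exp:
  assumes l: "l > 0"
  obtains C where "\<And>k::int. (1 + \<bar>real_of_int k\<bar>) ^ m \<le> C * exp (l * \<bar>real_of_int k\<bar>)"
proof (cases "m = 0")
  case True
  show thesis by (rule that[of 1]) (use True l in auto)
next
  case False
  define c where "c = max 1 (real m / l)"
  have c: "c \<ge> 1" "real m / l \<le> c" by (auto simp: c_def)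
  show thesis
  proof (rule that[of "c ^ m"])
    fix k :: int
    define y where "y = \<bar>real_of_int k\<bar>"
    have y: "y \<ge> 0" by (simp add: y_def)
    have "1 + y \<le> c * (1 + l * y / real m)"
    proof -
      have "1 \<le> c * (l / real m)" using c(2) l False by (simp add: field_simps)
      then have "y * 1 \<le> y * (c * (l / real m))" using y by (intro mult_left_mono) auto
      then show ?thesis using c(1) by (simp add: algebra_simps)
    qed
    also have "\<dots> \<le> c * exp (l * y / real m)" using c by (intro mult_left_mono exp_ge_add_one_self) auto
    finally have "(1 + y) ^ m \<le> (c * exp (l * y / real m)) ^ m" using y by (intro power_mono) auto
    also have "\<dots> = c ^ m * exp (l * y)"
      using False by (simp add: power_mult_distrib exp_of_nat_mult[symmetric])
    finally show "(1 + \<bar>real_of_int k\<bar>) ^ m \<le> c ^ m * exp (l * \<bar>real_of_int k\<bar>)" unfolding y_def .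
  qed
qed

text \<open>After the first hit, \<open>W\<close> retains only the lower bound of the potential. The
  swept area is constant from then on, hence so is \<open>W\<close>, and no drift inequality at
  \<open>(0, 1)\<close> is called for.\<close>

lemma swept_moment_bound:
  fixes p :: real
  assumes mom: "all_moments K" and p: "0 < p" and sgn: "1 + 3 * p < 3 * noise_mean K" and z0: "(z0::int) \<ge> 1"
  obtains C where "\<And>n. (\<integral>\<^sup>+l. ennreal (swept l powr p) \<partial>law K z0 n) \<le> ennreal C"
proof (rule moment_potential[OF mom p sgn])
  fix V \<delta> c0
  assume \<delta>: "(\<delta>::real) > 0" and c0: "(c0::real) > 0"
    and Vl: "\<And>a z. 0 \<le> a \<Longrightarrow> quad z \<Longrightarrow> c0 * a powr p \<le> V a z"
    and Vd: "\<And>a z. 0 \<le> a \<Longrightarrow> quad z \<Longrightarrow> z \<noteq> (0, 1) \<Longrightarrow>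
      (\<integral>\<^sup>+z'. ennreal (V (a + \<delta> * real_of_int (fst z + snd z)) z') \<partial>kern K z) \<le> ennreal (V a z)"
  define W where "W = (\<lambda>l. if hit l then ennreal (c0 * (\<delta> * swept l) powr p) else ennreal (V (\<delta> * swept l) (rot (hd l))))"
  have W: "(\<integral>\<^sup>+z. W (z # l) \<partial>ustep K (hd l)) \<le> W l" if l: "l \<noteq> []" "(0, 0) \<notin> set l" for l
  proof (cases "hit l")
    case True
    then have "W (z # l) = W l" for z by (simp add: W_def)
    then show ?thesis by simp
  next
    case False
    define z where "z = hd l"
    have zl: "z \<in> set l" using l unfolding z_def by simp
    then have z: "z \<noteq> (0, 0)" using l by auto
    have nt: "rot z \<noteq> (0, 1)" using False zl unfolding rot_target[OF z] hit_def norm1_def by auto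
    define a where "a = \<delta> * swept l"
    have a: "0 \<le> a" unfolding a_def using \<delta> swept_nonneg[of l] by simp
    define a' where "a' = a + \<delta> * real_of_int (fst (rot z) + snd (rot z))"
    have a': "\<delta> * swept (z' # l) = a'" for z'
      using False l unfolding a'_def a_def rot_sum by (simp add: z_def norm1_def distrib_left)
    have a'0: "a' \<ge> 0" using a'[of z] swept_nonneg[of "z # l"] \<delta> by (metis mult_nonneg_nonneg less_imp_le)
    have "(\<integral>\<^sup>+z'. W (z' # l) \<partial>ustep K z) \<le> (\<integral>\<^sup>+z'. ennreal (V a' (rot z')) \<partial>ustep K z)"
    proof (rule nn_integral_mono_AE, unfold AE_measure_pmf_iff, intro ballI)
      fix z' assume "z' \<in> set_pmf (ustep K z)"
      then have "quad (rot z')" using ustep_nonzero[OF z] quad_rot by blast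
      then show "W (z' # l) \<le> ennreal (V a' (rot z'))"
        using Vl[OF a'0, of "rot z'"] False unfolding W_def a' by (simp add: ennreal_leI)
    qed
    also have "\<dots> = (\<integral>\<^sup>+z'. ennreal (V a' z') \<partial>map_pmf rot (ustep K z))" by simp
    also have "\<dots> \<le> ennreal (V a (rot z))"
      unfolding map_rot_ustep[OF z] a'_def by (rule Vd[OF a quad_rot[OF z] nt])
    also have "\<dots> = W l" using False unfolding W_def a_def z_def by simp
    finally show ?thesis unfolding z_def .
  qed
  define c1 where "c1 = c0 * \<delta> powr p"
  have c1: "c1 > 0" unfolding c1_def using c0 \<delta> by simp
  define w where "w = V 0 (rot (z0, 1))"
  have Wl: "ennreal c1 * ennreal (swept l powr p) \<le> W l" if "l \<noteq> []" "(0, 0) \<notin> set l" for l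
  proof -
    have eq: "c1 * swept l powr p = c0 * (\<delta> * swept l) powr p"
      unfolding c1_def using \<delta> swept_nonneg[of l] by (simp add: powr_mult)
    have "hd l \<noteq> (0, 0)" using that by (metis list.set_sel(1))
    then have "c0 * (\<delta> * swept l) powr p \<le> V (\<delta> * swept l) (rot (hd l))"
      using \<delta> swept_nonneg[of l] by (intro Vl quad_rot) auto
    then have "ennreal (c0 * (\<delta> * swept l) powr p) \<le> W l"
      unfolding W_def by (auto intro: ennreal_leI)
    then show ?thesis using c1 eq by (simp add: ennreal_mult[symmetric])
  qed
  show thesis
  proof (rule that[of "w / c1"])
    fix n
    have "ennreal c1 * (\<integral>\<^sup>+l. ennreal (swept l powr p) \<partial>law K z0 n) = (\<integral>\<^sup>+l. ennreal c1 * ennreal (swept l powr p) \<partial>law K z0 n)"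
      by (simp add: nn_integral_cmult)
    also have "\<dots> \<le> (\<integral>\<^sup>+l. W l \<partial>law K z0 n)"
      using law_support[OF z0] by (intro nn_integral_mono_AE) (auto simp: AE_measure_pmf_iff intro!: Wl)
    also have "\<dots> \<le> (\<integral>\<^sup>+l. W l \<partial>law K z0 0)"
      by (rule law_supermartingale[OF z0]) (use W in auto)
    also have "\<dots> = ennreal w"
      using z0 by (simp add: W_def w_def hit_def norm1_def)
    finally have le: "ennreal c1 * (\<integral>\<^sup>+l. ennreal (swept l powr p) \<partial>law K z0 n) \<le> ennreal w" .
    have "(\<integral>\<^sup>+l. ennreal (swept l powr p) \<partial>law K z0 n)
      = ennreal (1 / c1) * (ennreal c1 * (\<integral>\<^sup>+l. ennreal (swept l powr p) \<partial>law K z0 n))"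
      using c1 by (simp add: mult.assoc[symmetric] ennreal_mult[symmetric])
    also have "\<dots> \<le> ennreal (1 / c1) * ennreal w" by (intro mult_left_mono le) auto
    also have "\<dots> = ennreal (w / c1)" using c1 by (simp add: ennreal_mult'[symmetric])
    finally show "(\<integral>\<^sup>+l. ennreal (swept l powr p) \<partial>law K z0 n) \<le> ennreal (w / c1)" .
  qed
qed

section \<open>Escape without hitting the stopping set\<close>

primrec climb :: "int \<Rightarrow> nat \<Rightarrow> (int \<times> int) list" where
  "climb z0 0 = [(z0, 1)]"
| "climb z0 (Suc j) = (z0, int j + 2) # climb z0 j"

lemma hd_climb: "hd (climb z0 j) = (z0, int j + 1)"
  by (cases j) auto

lemma not_hit_climb: "z0 \<ge> 1 \<Longrightarrow> \<not> hit (climb z0 j)"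
  by (induction j) (auto simp: norm1_def hit_def)

lemma climb_positive:
  assumes "z0 \<ge> 1"
  shows "pmf (law K z0 j) (climb z0 j) > 0"
proof (induction j)
  case (Suc j)
  define p where "p = real_of_int \<bar>z0\<bar> / real_of_int (\<bar>z0\<bar> + \<bar>int j + 1\<bar>)"
  have "0 < p" "p < 1" unfolding p_def using assms by (auto simp: divide_less_eq)
  then have "(z0, int j + 2) \<in> set_pmf (ustep K (z0, int j + 1))"
    using assms unfolding ustep_def by (auto simp: p_def[symmetric] simp del: of_int_add of_int_abs)
  then show ?case using Suc unfolding climb.simps pmf_law_Suc hd_climb
    by (simp add: pmf_positive)
qed simp

text \<open>Capping \<open>f\<close> at \<open>c\<close> makes it maximal on the ball of radius
  \<open>R\<close>, where its drift is unknown and the inequality becomes trivial. Outside, the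
  minimum with a constant preserves the supermartingale property.\<close>

lemma escape_potential:
  assumes mom: "all_moments K" and sgn: "noise_mean K < 1 / 3" and z0: "(z0::int) \<ge> 1"
  obtains g :: "int \<times> int \<Rightarrow> real" and c :: real and N :: nat where "c > 0" "\<And>z. quad z \<Longrightarrow> 0 \<le> g z"
    "\<And>z. quad z \<Longrightarrow> (\<integral>\<^sup>+z'. ennreal (g z') \<partial>kern K z) \<le> ennreal (g z)"
    "g (z0, int N + 1) < c" "g (0, 1) = c"
proof -
  define \<mu> where "\<mu> = noise_mean K"
  \<comment> \<open>The midpoint of the admissible interval from
    \<open>- (1 - 3 * \<mu>) / 2\<close> to 0.\<close>
  define \<beta> where "\<beta> = - (1 - 3 * \<mu>) / 4"
  have \<beta>: "\<beta> < 0" "1 + 2 * \<beta> - 3 * \<mu> > 0" unfolding \<beta>_def \<mu>_def using sgn by (auto simp: field_simps)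
  have sg: "\<beta> * (1 + 2 * \<beta> - 3 * noise_mean K) < 0" using \<beta> unfolding \<mu>_def by (intro mult_neg_pos)
  show thesis
  proof (rule lyap_kern_drift[OF mom sg zero_le_one order_refl])
    fix f \<rho> R \<epsilon>
    assume \<epsilon>: "\<epsilon> > 0" and \<rho>: "1 \<le> \<rho>" "\<rho> < R"
      and f0: "\<And>z. quad z \<Longrightarrow> 0 \<le> f z"
      and fc: "\<And>z. quad z \<Longrightarrow> sqn z < \<rho>\<^sup>2 \<Longrightarrow> f z = 1"
      and fl: "\<And>z. quad z \<Longrightarrow> \<rho>\<^sup>2 \<le> sqn z \<Longrightarrow> sqn z powr \<beta> / 2 \<le> f z"
      and fu: "\<And>z. quad z \<Longrightarrow> \<rho>\<^sup>2 \<le> sqn z \<Longrightarrow> f z \<le> 2 * sqn z powr \<beta>"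
      and fd: "\<And>z. quad z \<Longrightarrow> R\<^sup>2 \<le> sqn z \<Longrightarrow> \<epsilon> * sqn z powr (\<beta> - 1) \<le> f z \<and>
         (\<integral>\<^sup>+z'. ennreal (f z') \<partial>kern K z) \<le> ennreal (f z - \<epsilon> * sqn z powr (\<beta> - 1))"
    \<comment> \<open>A lower bound of \<open>f\<close> on the ball of radius \<open>R\<close>:
      \<open>f\<close> is 1 near the origin, and elsewhere at least half of a power that decreases
      with the norm.\<close>
    define c where "c = min 1 ((R\<^sup>2) powr \<beta> / 2)"
    have c: "c > 0" using \<rho> by (simp add: c_def)
    have fc': "c \<le> f z" if q: "quad z" "sqn z < R\<^sup>2" for z
    proof (cases "sqn z < \<rho>\<^sup>2")
      case True then show ?thesis using fc[OF q(1)] by (simp add: c_def)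
    next
      case False
      have "c \<le> (R\<^sup>2) powr \<beta> / 2" unfolding c_def by (rule min.cobounded2)
      also have "\<dots> \<le> sqn z powr \<beta> / 2"
        using q(2) sqn_ge1[OF q(1)] \<beta> by (intro divide_right_mono powr_mono2') auto
      also have "\<dots> \<le> f z" using fl[OF q(1)] False by simp
      finally show ?thesis .
    qed
    \<comment> \<open>\<open>2 * sqn z powr \<beta> < c\<close> once \<open>sqn z\<close> exceeds
      \<open>(c / 2) powr (1 / \<beta>)\<close>; the entry \<open>\<rho>\<close> puts the point
      outside the truncated ball, where this upper bound on \<open>f\<close> holds.\<close>
    define y where "y = max \<rho> ((c / 2) powr (1 / \<beta>))"
    define N where "N = nat \<lceil>y\<rceil>"
    have N: "y \<le> real N" unfolding N_def by linarith
    show thesis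
    proof (rule that[of c "\<lambda>z. min (f z) c" N])
      show "c > 0" by (rule c)
      fix z assume q: "quad z"
      show "0 \<le> min (f z) c" using f0[OF q] c by simp
      have I1: "(\<integral>\<^sup>+z'. ennreal (min (f z') c) \<partial>kern K z) \<le> ennreal c"
      proof -
        have "(\<integral>\<^sup>+z'. ennreal (min (f z') c) \<partial>kern K z) \<le> (\<integral>\<^sup>+z'. ennreal c \<partial>kern K z)"
          by (intro nn_integral_mono ennreal_leI) auto
        then show ?thesis by simp
      qed
      show "(\<integral>\<^sup>+z'. ennreal (min (f z') c) \<partial>kern K z) \<le> ennreal (min (f z) c)"
      proof (cases "sqn z < R\<^sup>2")
        case True then show ?thesis using I1 fc'[OF q] by (simp add: min_def)
      next
        case False
        have "(\<integral>\<^sup>+z'. ennreal (min (f z') c) \<partial>kern K z) \<le> (\<integral>\<^sup>+z'. ennreal (f z') \<partial>kern K z)"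
          by (intro nn_integral_mono ennreal_leI) auto
        also have "\<dots> \<le> ennreal (f z - \<epsilon> * sqn z powr (\<beta> - 1))" using fd[OF q] False by simp
        also have "\<dots> \<le> ennreal (f z)" using \<epsilon> by (intro ennreal_leI) simp
        finally show ?thesis using I1 by (simp add: min_def)
      qed
    next
      define z where "z = (z0, int N + 1)"
      have q: "quad z" using z0 by (simp add: z_def quad_def)
      have N1: "1 \<le> real N" using N \<rho> by (simp add: y_def)
      have s: "(real N + 1)\<^sup>2 \<le> sqn z" unfolding sqn_def z_def by simp
      have "y\<^sup>2 \<le> (real N + 1)\<^sup>2" using N \<rho> by (intro power_mono) (auto simp: y_def)
      moreover have "\<rho>\<^sup>2 \<le> y\<^sup>2" using \<rho> by (intro power_mono) (auto simp: y_def)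
      ultimately have s\<rho>: "\<rho>\<^sup>2 \<le> sqn z" using s by simp
      have "(c / 2) powr (1 / \<beta>) \<le> y" by (simp add: y_def)
      also have "y < real N + 1" using N by simp
      also have "\<dots> \<le> (real N + 1)\<^sup>2" using N1 by (simp add: power2_eq_square)
      finally have "(c / 2) powr (1 / \<beta>) < sqn z" using s by simp
      then have "sqn z powr \<beta> < ((c / 2) powr (1 / \<beta>)) powr \<beta>"
        using \<beta> c by (intro powr_less_mono2_neg) auto
      also have "\<dots> = c / 2" using \<beta> c by (simp add: powr_powr)
      finally have "2 * sqn z powr \<beta> < c" by simp
      then have "f z < c" using fu[OF q s\<rho>] by simp
      then show "min (f (z0, int N + 1)) c < c" by (simp add: z_def)
      have "1\<^sup>2 < R\<^sup>2" using \<rho> by (intro power_strict_mono) auto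
      then have "c \<le> f (0, 1)" by (intro fc') (auto simp: quad_def sqn_def)
      then show "min (f (0, 1)) c = c" by simp
    qed
  qed
qed

section \<open>Transfer to the probability space of the urn\<close>

context noisy_simple_harmonic_urn
begin

lemma set_hist: "set (hist n \<omega>) = (\<lambda>k. (X k \<omega>, Y k \<omega>)) ` {..n}"
  unfolding hist_def by (auto simp del: upt_Suc simp: less_Suc_eq_le)

text \<open>The index shift agrees with the tail test in \<open>tri\<close>. A trajectory that never
  hits is included, because the infimum of the empty set is infinite.\<close>

lemma tau_ge_iff: "enat (Suc n) \<le> urn_tau X Y \<omega> \<longleftrightarrow> \<not> hit (hist n \<omega>)"
proof -
  have "enat (Suc n) \<le> urn_tau X Y \<omega> \<longleftrightarrow> (\<forall>k. \<bar>X k \<omega>\<bar> + \<bar>Y k \<omega>\<bar> = 1 \<longrightarrow> Suc n \<le> k)"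
    unfolding urn_tau_def le_Inf_iff by auto
  also have "\<dots> \<longleftrightarrow> (\<forall>k\<le>n. \<bar>X k \<omega>\<bar> + \<bar>Y k \<omega>\<bar> \<noteq> 1)" by (meson not_less_eq_eq)
  also have "\<dots> \<longleftrightarrow> \<not> hit (hist n \<omega>)" unfolding hit_def set_hist norm1_def by auto
  finally show ?thesis .
qed

lemma hist_ne: "hist n \<omega> \<noteq> []" by (cases n) (auto simp: hist_0 hist_Suc)

lemma hd_hist: "hd (hist n \<omega>) = (X n \<omega>, Y n \<omega>)" by (cases n) (auto simp: hist_0 hist_Suc)

lemma urn_area_eq: "urn_area X Y \<omega> = (\<Sum>n. ennreal (tri (hist n \<omega>)))"
proof -
  have "(if 1 \<le> n \<and> enat n \<le> urn_tau X Y \<omega> then ennreal (urn_triangle_area X Y n \<omega>) else 0) = ennreal (tri (hist n \<omega>))" for n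
  proof (cases n)
    case 0 then show ?thesis by (simp add: hist_0 tri_def)
  next
    case (Suc k)
    obtain l where l: "hist k \<omega> = (X k \<omega>, Y k \<omega>) # l" using hist_ne[of k \<omega>] hd_hist[of k \<omega>] by (cases "hist k \<omega>") auto
    show ?thesis using tau_ge_iff[of k \<omega>] unfolding Suc urn_triangle_area_eq hist_Suc l tri_def by auto
  qed
  then show ?thesis unfolding urn_area_def by simp
qed

lemma measurable_urn_area: "urn_area X Y \<in> borel_measurable M"
proof -
  have "(\<lambda>\<omega>. ennreal (tri (hist n \<omega>))) \<in> borel_measurable M" for n
    using measurable_compose[OF measurable_hist[of n], of "\<lambda>l. ennreal (tri l)" borel] by simp
  then show ?thesis unfolding urn_area_eq[abs_def] by (intro borel_measurable_suminf_order)
qed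

lemma AE_tri: "AE \<omega> in M. \<forall>n. (\<not> hit (hist n \<omega>) \<longrightarrow> 1 / 2 \<le> tri (hist (Suc n) \<omega>)) \<and>
    tri (hist (Suc n) \<omega>) \<le> swept (hist (Suc n) \<omega>) - swept (hist n \<omega>)"
  unfolding AE_all_countable
proof
  fix n
  show "AE \<omega> in M. (\<not> hit (hist n \<omega>) \<longrightarrow> 1 / 2 \<le> tri (hist (Suc n) \<omega>)) \<and>
    tri (hist (Suc n) \<omega>) \<le> swept (hist (Suc n) \<omega>) - swept (hist n \<omega>)"
    using AE_hist[of "Suc n"]
  proof eventually_elim
    case (elim \<omega>)
    then obtain l z where l: "hist (Suc n) \<omega> = z # l" "l \<in> set_pmf (law noise (int z0) n)" "z \<in> set_pmf (ustep noise (hd l))"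
      by auto
    then have h: "hist n \<omega> = l" by (simp add: hist_Suc)
    have "l \<noteq> []" "(0, 0) \<notin> set l" using law_support[OF _ l(2)] z0_pos by auto
    then have "l \<noteq> []" "hd l \<noteq> (0, 0)" by (auto dest: list.set_sel(1))
    from tri_bounds[OF this l(3)] show ?case unfolding l(1) h by simp
  qed
qed

lemma swept_hist_mono: "swept (hist n \<omega>) \<le> swept (hist (Suc n) \<omega>)"
  by (simp add: hist_Suc norm1_def)

lemma AE_area_le: "AE \<omega> in M. urn_area X Y \<omega> \<le> (SUP n. ennreal (swept (hist n \<omega>)))"
  using AE_tri
proof eventually_elim
  case (elim \<omega>)
  have "(\<Sum>i<Suc n. tri (hist i \<omega>)) \<le> swept (hist n \<omega>)" for n
  proof (induction n)
    case 0 then show ?case by (simp add: hist_0 tri_def)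
  next
    case (Suc n)
    have "tri (hist (Suc n) \<omega>) \<le> swept (hist (Suc n) \<omega>) - swept (hist n \<omega>)" using elim by blast
    then show ?case using Suc by simp
  qed
  moreover have "(\<Sum>i<n. tri (hist i \<omega>)) \<le> (\<Sum>i<Suc n. tri (hist i \<omega>))" for n by (simp add: tri_nonneg)
  ultimately have le: "(\<Sum>i<n. tri (hist i \<omega>)) \<le> swept (hist n \<omega>)" for n by (meson order_trans)
  show ?case unfolding urn_area_eq suminf_eq_SUP
  proof (rule SUP_least)
    fix n
    have "(\<Sum>i<n. ennreal (tri (hist i \<omega>))) = ennreal (\<Sum>i<n. tri (hist i \<omega>))"
      by (intro sum_ennreal tri_nonneg)
    also have "\<dots> \<le> ennreal (swept (hist n \<omega>))" by (intro ennreal_leI le)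
    also have "\<dots> \<le> (SUP n. ennreal (swept (hist n \<omega>)))" by (rule SUP_upper) simp
    finally show "(\<Sum>i<n. ennreal (tri (hist i \<omega>))) \<le> (SUP n. ennreal (swept (hist n \<omega>)))" .
  qed
qed

lemma AE_area_ge: "AE \<omega> in M. ennreal (1 / 2) \<le> urn_area X Y \<omega>"
  using AE_tri start
proof eventually_elim
  case (elim \<omega>)
  have "\<not> hit (hist 0 \<omega>)" using elim(2) z0_pos by (simp add: hist_0 hit_def norm1_def)
  then have "1 / 2 \<le> tri (hist (Suc 0) \<omega>)" using elim(1) by blast
  then have "ennreal (1 / 2) \<le> ennreal (tri (hist (Suc 0) \<omega>))" by (rule ennreal_leI)
  also have "\<dots> \<le> (\<Sum>n. ennreal (tri (hist n \<omega>)))"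
    using sum_le_suminf[of "\<lambda>n. ennreal (tri (hist n \<omega>))" "{Suc 0}"] by simp
  finally show ?case unfolding urn_area_eq .
qed

lemma AE_area_top: "AE \<omega> in M. (\<forall>n. \<not> hit (hist n \<omega>)) \<longrightarrow> urn_area X Y \<omega> = \<infinity>"
  using AE_tri
proof eventually_elim
  case (elim \<omega>)
  show ?case
  proof
    assume nh: "\<forall>n. \<not> hit (hist n \<omega>)"
    have ge: "real n / 2 \<le> (\<Sum>i<Suc n. tri (hist i \<omega>))" for n
    proof (induction n)
      case 0 then show ?case by (simp add: tri_nonneg)
    next
      case (Suc n)
      have "1 / 2 \<le> tri (hist (Suc n) \<omega>)" using elim nh by blast
      then show ?case using Suc by simp
    qed
    have ge2: "ennreal (real n / 2) \<le> urn_area X Y \<omega>" for n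
    proof -
      have "ennreal (real n / 2) \<le> ennreal (\<Sum>i<Suc n. tri (hist i \<omega>))" by (intro ennreal_leI ge)
      also have "\<dots> = (\<Sum>i<Suc n. ennreal (tri (hist i \<omega>)))" by (intro sum_ennreal[symmetric] tri_nonneg)
      also have "\<dots> \<le> urn_area X Y \<omega>" unfolding urn_area_eq by (intro sum_le_suminf) auto
      finally show ?thesis .
    qed
    show "urn_area X Y \<omega> = \<infinity>"
    proof (rule ccontr)
      assume "urn_area X Y \<omega> \<noteq> \<infinity>"
      then obtain s where s: "urn_area X Y \<omega> = ennreal s" "0 \<le> s" by (metis ennreal_cases infinity_ennreal_def)
      obtain n :: nat where "2 * s < real n" using reals_Archimedean2 by blast
      then show False using ge2[of n] s by simp
    qed
  qed
qed

lemma noise_moments: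
  assumes "\<exists>l>0. integrable M (\<lambda>\<omega>. exp (l * \<bar>real_of_int (kappa 0 \<omega>)\<bar>))"
  shows "all_moments noise"
  unfolding all_moments_def
proof
  fix m
  obtain l where l: "l > 0" "integrable M (\<lambda>\<omega>. exp (l * \<bar>real_of_int (kappa 0 \<omega>)\<bar>))" using assms by blast
  have i: "integrable (measure_pmf noise) (\<lambda>k. exp (l * \<bar>real_of_int k\<bar>))"
    unfolding measure_noise using l(2) measurable_kappa by (subst integrable_distr_eq) auto
  show "integrable (measure_pmf noise) (\<lambda>k. (1 + \<bar>real_of_int k\<bar>) ^ m)"
  proof (rule power_le_exp[OF l(1), of m])
    fix C
    assume C: "\<And>k::int. (1 + \<bar>real_of_int k\<bar>) ^ m \<le> C * exp (l * \<bar>real_of_int k\<bar>)"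
    from i have "integrable (measure_pmf noise) (\<lambda>k. C * exp (l * \<bar>real_of_int k\<bar>))" by simp
    then show ?thesis
      by (rule Bochner_Integration.integrable_bound) (auto intro: order_trans[OF C abs_ge_self])
  qed
qed

lemma noise_mean_eq: "noise_mean noise = (LINT \<omega>|M. real_of_int (kappa 0 \<omega>))"
  unfolding noise_mean_def measure_noise using measurable_kappa by (subst integral_distr) auto

lemma drop_hist: "N \<le> n \<Longrightarrow> drop (n - N) (hist n \<omega>) = hist N \<omega>"
  by (induction n rule: dec_induct) (auto simp: hist_Suc Suc_diff_le)

lemma length_hist: "length (hist n \<omega>) = Suc n"
  by (simp add: hist_def)

text \<open>On the climb, an event of probability \<open>a\<close>, the stopped potential starts at
  \<open>b < c\<close>, and it equals \<open>c\<close> after a hit. Hence climbing and then hitting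
  has probability at most \<open>a * b / c < a\<close>.\<close>

lemma area_infinite_pos:
  assumes mom: "all_moments noise" and sgn: "noise_mean noise < 1 / 3"
  shows "\<P>(\<omega> in M. urn_area X Y \<omega> = \<infinity>) > 0"
proof -
  have z01: "int z0 \<ge> 1" using z0_pos by simp
  show ?thesis
  proof (rule escape_potential[OF mom sgn z01])
    fix g :: "int \<times> int \<Rightarrow> real" and c N
    assume c: "(c::real) > 0" and g0: "\<And>z. quad z \<Longrightarrow> 0 \<le> g z"
      and gd: "\<And>z. quad z \<Longrightarrow> (\<integral>\<^sup>+z'. ennreal (g z') \<partial>kern noise z) \<le> ennreal (g z)"
      and gN: "g (int z0, int N + 1) < c" and gt: "g (0, 1) = c"
    define L where "L = law noise (int z0)"
    define \<pi> where "\<pi> = climb (int z0) N"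
    define h where "h = (\<lambda>l. if hit l then ennreal c else ennreal (g (rot (hd l))))"
    \<comment> \<open>The newest state comes first, so the \<open>drop\<close> is the segment up to
      time \<open>N\<close>. Requiring it to be the climb restricts to that event without
      conditioning.\<close>
    define W where "W = (\<lambda>l. if drop (length l - Suc N) l = \<pi> then h l else 0)"
    have dr: "drop (length (z # l) - Suc N) (z # l) = drop (length l - Suc N) l" if "length l > N" for z l
    proof -
      have "length (z # l) - Suc N = Suc (length l - Suc N)" using that by simp
      then show ?thesis by (simp only: drop_Suc_Cons)
    qed
    have W: "(\<integral>\<^sup>+z. W (z # l) \<partial>ustep noise (hd l)) \<le> W l"
      if l: "l \<noteq> []" "(0, 0) \<notin> set l" "length l > N" for l
    proof (cases "drop (length l - Suc N) l = \<pi>")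
      case False
      then show ?thesis unfolding W_def dr[OF l(3)] by simp
    next
      case True
      have Wh: "W (z # l) = h (z # l)" "W l = h l" for z unfolding W_def dr[OF l(3)] using True by auto
      show ?thesis
      proof (cases "hit l")
        case True then show ?thesis unfolding Wh h_def by simp
      next
        case False
        define z where "z = hd l"
        have z: "z \<noteq> (0, 0)" using l unfolding z_def by (metis list.set_sel(1))
        have "(\<integral>\<^sup>+z'. h (z' # l) \<partial>ustep noise z) \<le> (\<integral>\<^sup>+z'. ennreal (g (rot z')) \<partial>ustep noise z)"
        proof (rule nn_integral_mono_AE, unfold AE_measure_pmf_iff, intro ballI)
          fix z' assume "z' \<in> set_pmf (ustep noise z)"
          then have "z' \<noteq> (0, 0)" using ustep_nonzero[OF z] by blast
          then have "norm1 z' = 1 \<Longrightarrow> rot z' = (0, 1)" using rot_target[of z'] by (simp add: norm1_def)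
          then show "h (z' # l) \<le> ennreal (g (rot z'))" using False gt by (auto simp: h_def)
        qed
        also have "\<dots> = (\<integral>\<^sup>+z'. ennreal (g z') \<partial>map_pmf rot (ustep noise z))" by simp
        also have "\<dots> \<le> ennreal (g (rot z))" unfolding map_rot_ustep[OF z] by (rule gd[OF quad_rot[OF z]])
        also have "\<dots> = h l" using False by (simp add: h_def z_def)
        finally show ?thesis unfolding Wh z_def .
      qed
    qed
    define a where "a = prob {\<omega>\<in>space M. hist N \<omega> = \<pi>}"
    define b where "b = g (int z0, int N + 1)"
    have b: "0 \<le> b" "b < c" unfolding b_def using gN z01 by (auto intro!: g0 simp: quad_def)
    have measN: "{\<omega>\<in>space M. hist N \<omega> = \<pi>} \<in> sets M" using measurable_hist[of N] by measurable
    have aL: "a = pmf (L N) \<pi>"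
    proof -
      have "pmf (L N) \<pi> = measure (distr M (count_space UNIV) (hist N)) {\<pi>}"
        unfolding distr_hist L_def by (simp add: pmf.rep_eq)
      also have "\<dots> = a" unfolding a_def using measurable_hist[of N]
        by (subst measure_distr) (auto intro!: arg_cong[where f=prob])
      finally show ?thesis by simp
    qed
    have a: "a > 0" unfolding aL L_def \<pi>_def by (rule climb_positive[OF z01])
    have h\<pi>: "h \<pi> = ennreal b"
    proof -
      have "rot (int z0, int N + 1) = (int z0, int N + 1)" using z01 by (simp add: rot_def)
      then show ?thesis using not_hit_climb[OF z01, of N] unfolding h_def \<pi>_def b_def hd_climb by simp
    qed
    have WN: "(\<integral>\<^sup>+l. W l \<partial>L N) = ennreal (a * b)"
    proof -
      have "(\<integral>\<^sup>+l. W l \<partial>L N) = (\<integral>\<^sup>+\<omega>. W (hist N \<omega>) \<partial>M)" unfolding L_def nn_integral_hist ..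
      also have "\<dots> = (\<integral>\<^sup>+\<omega>. ennreal b * indicator {\<omega>\<in>space M. hist N \<omega> = \<pi>} \<omega> \<partial>M)"
        by (intro nn_integral_cong) (auto simp: W_def length_hist h\<pi>)
      also have "\<dots> = ennreal b * ennreal a"
        using measN by (simp add: nn_integral_cmult_indicator emeasure_eq_measure a_def)
      also have "\<dots> = ennreal (a * b)" using a b by (simp add: ennreal_mult mult.commute)
      finally show ?thesis .
    qed
    define E where "E = (\<lambda>n. {\<omega>\<in>space M. hist N \<omega> = \<pi> \<and> hit (hist n \<omega>)})"
    have measE: "E n \<in> sets M" for n
    proof -
      have "{\<omega>\<in>space M. hist n \<omega> \<in> {l. hit l}} \<in> sets M" using measurable_hist[of n] by measurable
      moreover have "E n = {\<omega>\<in>space M. hist N \<omega> = \<pi>} \<inter> {\<omega>\<in>space M. hist n \<omega> \<in> {l. hit l}}" by (auto simp: E_def)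
      ultimately show ?thesis using measN by simp
    qed
    have incE: "incseq E" by (intro incseq_SucI) (auto simp: E_def hist_Suc)
    have PE: "prob (E n) \<le> a * b / c" if n: "N \<le> n" for n
    proof -
      have "ennreal (c * prob (E n)) = (\<integral>\<^sup>+\<omega>. ennreal c * indicator (E n) \<omega> \<partial>M)"
        using measE c by (simp add: nn_integral_cmult_indicator emeasure_eq_measure ennreal_mult)
      also have "\<dots> \<le> (\<integral>\<^sup>+\<omega>. W (hist n \<omega>) \<partial>M)"
        using drop_hist[OF n] by (intro nn_integral_mono) (auto simp: E_def W_def length_hist h_def indicator_def)
      also have "\<dots> = (\<integral>\<^sup>+l. W l \<partial>L n)" unfolding L_def nn_integral_hist ..
      also have "\<dots> \<le> (\<integral>\<^sup>+l. W l \<partial>L N)"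
        unfolding L_def by (rule law_supermartingale[OF z01 W n])
      also have "\<dots> = ennreal (a * b)" by (rule WN)
      finally have "c * prob (E n) \<le> a * b" using a b by simp
      then show ?thesis using c by (simp add: field_simps)
    qed
    \<comment> \<open>Continuity from below carries the bound for a hit by time \<open>n\<close>
      over to a hit at any time.\<close>
    have "(\<lambda>n. prob (E n)) \<longlonglongrightarrow> prob (\<Union>n. E n)"
      using measE incE by (intro finite_Lim_measure_incseq) auto
    then have "prob (\<Union>n. E n) \<le> a * b / c"
      by (rule LIMSEQ_le_const2) (use PE in blast)
    also have "\<dots> < a" using a b c by (simp add: field_simps)
    finally have lt: "prob (\<Union>n. E n) < a" .
    define D where "D = {\<omega>\<in>space M. hist N \<omega> = \<pi>} - (\<Union>n. E n)"
    have "0 < a - prob (\<Union>n. E n)" using lt by simp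
    also have "\<dots> = prob D" unfolding a_def D_def
      by (rule finite_measure_Diff[symmetric]) (use measN measE in \<open>auto simp: E_def\<close>)
    also have "\<dots> \<le> \<P>(\<omega> in M. urn_area X Y \<omega> = \<infinity>)"
    proof (rule finite_measure_mono_AE)
      show "AE \<omega> in M. \<omega> \<in> D \<longrightarrow> \<omega> \<in> {\<omega>\<in>space M. urn_area X Y \<omega> = \<infinity>}"
        using AE_area_top by eventually_elim (auto simp: D_def E_def)
      show "{\<omega>\<in>space M. urn_area X Y \<omega> = \<infinity>} \<in> sets M"
        using measurable_urn_area by measurable
    qed
    finally show ?thesis .
  qed
qed

text \<open>For \<open>p \<le> 0\<close> a positive lower bound on the area suffices; when the mean
  is exactly 1/3, only such exponents occur. For \<open>p > 0\<close> the area is dominated by the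
  increasing limit of the swept areas, and monotone convergence transports their uniform
  bound.\<close>

lemma area_moment_finite:
  assumes mom: "all_moments noise" and p: "p < (3 * noise_mean noise - 1) / 3"
  shows "(\<integral>\<^sup>+ \<omega>. ennreal_powr (urn_area X Y \<omega>) p \<partial>M) < \<infinity>"
proof (cases "p \<le> 0")
  case True
  have "(\<integral>\<^sup>+ \<omega>. ennreal_powr (urn_area X Y \<omega>) p \<partial>M) \<le> (\<integral>\<^sup>+ \<omega>. ennreal ((1 / 2) powr p) \<partial>M)"
    using AE_area_ge by (intro nn_integral_mono_AE, eventually_elim) (rule ennreal_powr_nonpos_le[OF True], auto)
  also have "\<dots> < \<infinity>" by (simp add: emeasure_space_1)
  finally show ?thesis .
next
  case False
  then have p0: "0 < p" by simp
  have sg: "1 + 3 * p < 3 * noise_mean noise" using p by simp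
  have z01: "int z0 \<ge> 1" using z0_pos by simp
  show ?thesis
  proof (rule swept_moment_bound[OF mom p0 sg z01])
    fix C
    assume C: "\<And>n. (\<integral>\<^sup>+l. ennreal (swept l powr p) \<partial>law noise (int z0) n) \<le> ennreal C"
    have "(\<integral>\<^sup>+ \<omega>. ennreal_powr (urn_area X Y \<omega>) p \<partial>M) \<le> (\<integral>\<^sup>+ \<omega>. (SUP n. ennreal (swept (hist n \<omega>) powr p)) \<partial>M)"
      using AE_area_le
      by (intro nn_integral_mono_AE, eventually_elim) (rule ennreal_powr_SUP_le[OF p0 swept_nonneg])
    also have "\<dots> = (SUP n. (\<integral>\<^sup>+ \<omega>. ennreal (swept (hist n \<omega>) powr p) \<partial>M))"
    proof (rule nn_integral_monotone_convergence_SUP)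
      show "incseq (\<lambda>n \<omega>. ennreal (swept (hist n \<omega>) powr p))"
        using swept_hist_mono swept_nonneg p0
        by (intro incseq_SucI le_funI ennreal_leI powr_mono2) auto
      show "(\<lambda>\<omega>. ennreal (swept (hist n \<omega>) powr p)) \<in> borel_measurable M" for n
        using measurable_compose[OF measurable_hist[of n], of "\<lambda>l. ennreal (swept l powr p)" borel] by simp
    qed
    also have "\<dots> \<le> ennreal C"
      by (intro SUP_least) (simp add: nn_integral_hist[of "\<lambda>l. ennreal (swept l powr p)"] C)
    also have "\<dots> < \<infinity>" by simp
    finally show ?thesis .
  qed
qed

end

theorem theorem2p9:
  fixes M :: "'a measure"
    and kappa :: "nat \<Rightarrow> 'a \<Rightarrow> int"
    and X Y :: "nat \<Rightarrow> 'a \<Rightarrow> int"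
    and z0 :: nat
  assumes urn: "noisy_simple_harmonic_urn M kappa X Y z0"
    and exp_moment:
      "\<exists>l>0. integrable M (\<lambda>\<omega>. exp (l * \<bar>real_of_int (kappa 0 \<omega>)\<bar>))"
  shows "((LINT \<omega>|M. real_of_int (kappa 0 \<omega>)) < 1 / 3 \<longrightarrow>
            \<P>(\<omega> in M. urn_area X Y \<omega> = \<infinity>) > 0) \<and>
         ((LINT \<omega>|M. real_of_int (kappa 0 \<omega>)) \<ge> 1 / 3 \<longrightarrow>
            (\<forall>p::real. p < (3 * (LINT \<omega>|M. real_of_int (kappa 0 \<omega>)) - 1) / 3 \<longrightarrow>
               (\<integral>\<^sup>+ \<omega>. ennreal_powr (urn_area X Y \<omega>) p \<partial>M) < \<infinity>))"
proof -
  interpret noisy_simple_harmonic_urn M kappa X Y z0 by (rule urn)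
  have mom: "all_moments noise" by (rule noise_moments[OF exp_moment])
  show ?thesis
    using area_infinite_pos[OF mom] area_moment_finite[OF mom] unfolding noise_mean_eq by blast
qed

end
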